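(* None of the asymptotic cones of the braided Thompson group $BV$ (with the word metric of a finite generating set) has a cut-point.
   Context: **The group $BV$.** Finite rooted binary trees: every interior vertex has a left child (edge labelled $0$) and a right child (edge labelled $1$); a caret is an interior vertex together with its two downward edges; leaves are numbered from left to right starting from $0$. A tree-braid-tree diagram is a triple $(T_+,br,T_-)$ where $T_+,T_-$ are finite rooted binary trees with the same number $n$ of carets (hence $n+1$ leaves) and $br\in B_{n+1}$ is a braid on $n+1$ strands (up to isotopy) whose strands run from the leaves of $T_+$ to the leaves of $T_-$. Splitting of the $i$-th strand: attach a caret to the $i$-th leaf of $T_+$ and to the corresponding leaf of $T_-$, and replace the strand $b_i$ by two parallel strands $b_i,b_i'$, where $b_i'$ is immediately to the right of $b_i$, does not cross $b_i$, and crosses the other strands in the same way as $b_i$ does. The inverse operation is called reduction. Two diagrams are equivalent if they are related by finitely many splittings and reductions; $BV$ is the set of equivalence classes. Product: given $a,b\in BV$, choose representatives $(A_+,br_A,A_-)$ and $(B_+,br_B,B_-)$ with $A_-=B_+$; then $ab$ is the class of $(A_+,br_Abr_B,B_-)$, where $br_Abr_B$ is $br_A$ followed by $br_B$. The group $BV$ is finitely generated. **Asymptotic cones.** An asymptotic cone of a finitely generated group $G$ with word metric $d$ is the $\omega$-ultralimit of the pointed metric spaces $(G,d/d_n,e)$, for a non-principal ultrafilter $\omega$ on $\mathbb{N}$ and a sequence of positive reals $d_n\to\infty$. A cut-point of a connected space is a point whose removal disconnects it. *)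

theory Defs
  imports "HOL-Analysis.Analysis" "HOL-Algebra.Generated_Groups"
begin

section \<open>Braids\<close>

text \<open>
  An \<open>n\<close>-strand braid is a path \<open>b\<close> in the configuration space of \<open>n\<close> labelled points of the
  plane, here \<open>complex\<close>; strand \<open>i < n\<close> is \<open>\<lambda>t. b t i\<close>. The real axis is the left-to-right
  direction of braid diagrams. Both ends lie on it, and the strands are labelled by the
  left-to-right order of their initial points. The ends are not pinned to fixed points of the real
  axis: the ordered \<open>n\<close>-tuples of reals form a contractible (convex) set, so isotopy classes are the
  elements of the usual braid group, and doubling a strand needs no rescaling.
  The unused coordinates \<open>i \<ge> n\<close> are set to \<open>0\<close>.
\<close>

definition config_space :: "nat \<Rightarrow> (nat \<Rightarrow> complex) set" where
  "config_space n = {z. inj_on z {..<n} \<and> (\<forall>i\<ge>n. z i = 0)}"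

definition ends_on_line :: "nat \<Rightarrow> (real \<Rightarrow> nat \<Rightarrow> complex) \<Rightarrow> bool" where
  "ends_on_line n b \<longleftrightarrow>
     (\<forall>i<n. pathstart b i \<in> \<real> \<and> pathfinish b i \<in> \<real>) \<and>
     strict_mono_on {..<n} (\<lambda>i. Re (pathstart b i))"

definition is_braid :: "nat \<Rightarrow> (real \<Rightarrow> nat \<Rightarrow> complex) \<Rightarrow> bool" where
  "is_braid n b \<longleftrightarrow> path b \<and> path_image b \<subseteq> config_space n \<and> ends_on_line n b"

definition isotopic :: "nat \<Rightarrow> (real \<Rightarrow> nat \<Rightarrow> complex) \<Rightarrow> (real \<Rightarrow> nat \<Rightarrow> complex) \<Rightarrow> bool" where
  "isotopic n b c \<longleftrightarrow> homotopic_with_canon (ends_on_line n) {0..1} (config_space n) b c"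

type_synonym braid_class = "(real \<Rightarrow> nat \<Rightarrow> complex) set"

definition braid_class :: "nat \<Rightarrow> (real \<Rightarrow> nat \<Rightarrow> complex) \<Rightarrow> braid_class" where
  "braid_class n b = {c. isotopic n b c}"

definition braids :: "nat \<Rightarrow> braid_class set" where
  "braids n = {braid_class n b | b. is_braid n b}"

definition trivial_braid :: "nat \<Rightarrow> real \<Rightarrow> nat \<Rightarrow> complex" where
  "trivial_braid n = (\<lambda>t i. if i < n then of_nat i else 0)"

text \<open>The position, counted from the left, at which strand \<open>i\<close> ends.\<close>

definition end_pos :: "nat \<Rightarrow> (real \<Rightarrow> nat \<Rightarrow> complex) \<Rightarrow> nat \<Rightarrow> nat" where
  "end_pos n b i = card {j. j < n \<and> Re (pathfinish b j) < Re (pathfinish b i)}"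

text \<open>\<open>b\<close> followed by \<open>c\<close>, for braids such that \<open>c\<close> starts at the points where \<open>b\<close> ends.\<close>

definition braid_comp ::
    "nat \<Rightarrow> (real \<Rightarrow> nat \<Rightarrow> complex) \<Rightarrow> (real \<Rightarrow> nat \<Rightarrow> complex) \<Rightarrow> real \<Rightarrow> nat \<Rightarrow> complex" where
  "braid_comp n b c = b +++ (\<lambda>t i. if i < n then c t (end_pos n b i) else 0)"

definition braid_mult :: "nat \<Rightarrow> braid_class \<Rightarrow> braid_class \<Rightarrow> braid_class" where
  "braid_mult n \<beta> \<gamma> =
     {x. \<exists>b\<in>\<beta>. \<exists>c\<in>\<gamma>. pathfinish b ` {..<n} = pathstart c ` {..<n} \<and>
           isotopic n (braid_comp n b c) x}"

text \<open>
  The new strand \<open>Suc i\<close> is the translate of strand \<open>i\<close> to the right by \<open>\<epsilon>\<close>. It is immediately to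
  the right of strand \<open>i\<close> when no other strand ever meets the horizontal segment between the two
  (\<open>room_right\<close>).
\<close>

definition room_right :: "nat \<Rightarrow> (real \<Rightarrow> nat \<Rightarrow> complex) \<Rightarrow> nat \<Rightarrow> real \<Rightarrow> bool" where
  "room_right n b i \<epsilon> \<longleftrightarrow>
     (\<forall>t\<in>{0..1}. \<forall>j<n. j \<noteq> i \<longrightarrow> (\<forall>r\<in>{0..\<epsilon>}. b t j \<noteq> b t i + complex_of_real r))"

definition double_strand ::
    "nat \<Rightarrow> real \<Rightarrow> (real \<Rightarrow> nat \<Rightarrow> complex) \<Rightarrow> real \<Rightarrow> nat \<Rightarrow> complex" where
  "double_strand i \<epsilon> b =
     (\<lambda>t k. if k \<le> i then b t k
            else if k = Suc i then b t i + complex_of_real \<epsilon>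
            else b t (k - 1))"

section \<open>Tree-braid-tree diagrams and the group \<open>BV\<close>\<close>

datatype btree = Leaf | Caret btree btree

fun carets :: "btree \<Rightarrow> nat" where
  "carets Leaf = 0"
| "carets (Caret l r) = Suc (carets l + carets r)"

definition leaves :: "btree \<Rightarrow> nat" where
  "leaves T = Suc (carets T)"

text \<open>Attach a caret to the \<open>i\<close>-th leaf, for \<open>i < leaves T\<close>.\<close>

fun add_caret :: "nat \<Rightarrow> btree \<Rightarrow> btree" where
  "add_caret i Leaf = Caret Leaf Leaf"
| "add_caret i (Caret l r) =
     (if i < leaves l then Caret (add_caret i l) r else Caret l (add_caret (i - leaves l) r))"

type_synonym diagram = "btree \<times> braid_class \<times> btree"

definition diagrams :: "diagram set" where
  "diagrams = {(T, \<beta>, U). carets T = carets U \<and> \<beta> \<in> braids (leaves T)}"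

inductive_set splitting :: "(diagram \<times> diagram) set" where
  "\<lbrakk>(T, \<beta>, U) \<in> diagrams; b \<in> \<beta>; i < leaves T; \<epsilon> > 0; room_right (leaves T) b i \<epsilon>\<rbrakk> \<Longrightarrow>
   ((T, \<beta>, U),
    (add_caret i T,
     braid_class (Suc (leaves T)) (double_strand i \<epsilon> b),
     add_caret (end_pos (leaves T) b i) U)) \<in> splitting"

definition diagram_equiv :: "(diagram \<times> diagram) set" where
  "diagram_equiv = (splitting \<union> splitting\<inverse>)\<^sup>*"

definition BV_mult :: "diagram set \<Rightarrow> diagram set \<Rightarrow> diagram set" where
  "BV_mult X Y =
     {D. \<exists>T \<beta> U \<gamma> W. (T, \<beta>, U) \<in> X \<and> (U, \<gamma>, W) \<in> Y \<and>
           ((T, braid_mult (leaves U) \<beta> \<gamma>, W), D) \<in> diagram_equiv}"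

definition BV :: "diagram set monoid" where
  "BV = \<lparr>carrier = diagrams // diagram_equiv,
         mult = BV_mult,
         one = diagram_equiv `` {(Leaf, braid_class 1 (trivial_braid 1), Leaf)}\<rparr>"

section \<open>Asymptotic cones\<close>

definition word_length :: "('a, 'b) monoid_scheme \<Rightarrow> 'a set \<Rightarrow> 'a \<Rightarrow> nat" where
  "word_length G S g =
     (LEAST k. \<exists>ws. length ws = k \<and> set ws \<subseteq> S \<union> m_inv G ` S \<and>
                    foldr (mult G) ws (one G) = g)"

definition word_metric :: "('a, 'b) monoid_scheme \<Rightarrow> 'a set \<Rightarrow> 'a \<Rightarrow> 'a \<Rightarrow> real" where
  "word_metric G S g h = real (word_length G S (inv\<^bsub>G\<^esub> g \<otimes>\<^bsub>G\<^esub> h))"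

definition nonprincipal_ultrafilter :: "'i filter \<Rightarrow> bool" where
  "nonprincipal_ultrafilter \<omega> \<longleftrightarrow>
     \<omega> \<noteq> bot \<and>
     (\<forall>P. eventually P \<omega> \<or> eventually (\<lambda>i. \<not> P i) \<omega>) \<and>
     (\<forall>i. \<omega> \<noteq> principal {i})"

text \<open>
  Ultralimit of the pointed metric spaces \<open>(M i, d i, e i)\<close>: sequences at \<open>\<omega>\<close>-bounded distance from
  the base points, modulo \<open>\<omega>\<close>-lim distance \<open>0\<close>, with the \<open>\<omega>\<close>-lim distance. The value \<open>0\<close> outside
  the underlying set only makes the distance total, as \<^locale>\<open>Metric_space\<close> wants it.
\<close>

definition ultralimit_seqs ::
    "'i filter \<Rightarrow> ('i \<Rightarrow> 'a set) \<Rightarrow> ('i \<Rightarrow> 'a \<Rightarrow> 'a \<Rightarrow> real) \<Rightarrow> ('i \<Rightarrow> 'a) \<Rightarrow> ('i \<Rightarrow> 'a) set" where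
  "ultralimit_seqs \<omega> M d e =
     {x. (\<forall>i. x i \<in> M i) \<and> (\<exists>C. eventually (\<lambda>i. d i (e i) (x i) \<le> C) \<omega>)}"

definition ultralimit_eq ::
    "'i filter \<Rightarrow> ('i \<Rightarrow> 'a \<Rightarrow> 'a \<Rightarrow> real) \<Rightarrow> (('i \<Rightarrow> 'a) \<times> ('i \<Rightarrow> 'a)) set" where
  "ultralimit_eq \<omega> d = {(x, y). ((\<lambda>i. d i (x i) (y i)) \<longlongrightarrow> 0) \<omega>}"

definition ultralimit_space ::
    "'i filter \<Rightarrow> ('i \<Rightarrow> 'a set) \<Rightarrow> ('i \<Rightarrow> 'a \<Rightarrow> 'a \<Rightarrow> real) \<Rightarrow> ('i \<Rightarrow> 'a) \<Rightarrow> ('i \<Rightarrow> 'a) set set" where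
  "ultralimit_space \<omega> M d e =
     ultralimit_seqs \<omega> M d e //
       (ultralimit_eq \<omega> d \<inter> (ultralimit_seqs \<omega> M d e \<times> ultralimit_seqs \<omega> M d e))"

definition ultralimit_dist ::
    "'i filter \<Rightarrow> ('i \<Rightarrow> 'a set) \<Rightarrow> ('i \<Rightarrow> 'a \<Rightarrow> 'a \<Rightarrow> real) \<Rightarrow> ('i \<Rightarrow> 'a) \<Rightarrow>
     ('i \<Rightarrow> 'a) set \<Rightarrow> ('i \<Rightarrow> 'a) set \<Rightarrow> real" where
  "ultralimit_dist \<omega> M d e X Y =
     (if X \<in> ultralimit_space \<omega> M d e \<and> Y \<in> ultralimit_space \<omega> M d e
      then THE r. \<exists>x\<in>X. \<exists>y\<in>Y. ((\<lambda>i. d i (x i) (y i)) \<longlongrightarrow> r) \<omega>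
      else 0)"

definition ultralimit ::
    "'i filter \<Rightarrow> ('i \<Rightarrow> 'a set) \<Rightarrow> ('i \<Rightarrow> 'a \<Rightarrow> 'a \<Rightarrow> real) \<Rightarrow> ('i \<Rightarrow> 'a) \<Rightarrow> ('i \<Rightarrow> 'a) set topology" where
  "ultralimit \<omega> M d e =
     Metric_space.mtopology (ultralimit_space \<omega> M d e) (ultralimit_dist \<omega> M d e)"

definition asymptotic_cone ::
    "('a, 'b) monoid_scheme \<Rightarrow> 'a set \<Rightarrow> nat filter \<Rightarrow> (nat \<Rightarrow> real) \<Rightarrow> (nat \<Rightarrow> 'a) set topology" where
  "asymptotic_cone G S \<omega> s =
     ultralimit \<omega> (\<lambda>n. carrier G) (\<lambda>n g h. word_metric G S g h / s n) (\<lambda>n. \<one>\<^bsub>G\<^esub>)"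

text \<open>
  Connectedness of the space itself is not part of the definition: asymptotic cones are connected
  (they are geodesic spaces).
\<close>

definition cut_point :: "'a topology \<Rightarrow> 'a \<Rightarrow> bool" where
  "cut_point X p \<longleftrightarrow>
     p \<in> topspace X \<and> \<not> connected_space (subtopology X (topspace X - {p}))"

end

(*
  An element g of BV that carries a ribbon with address a, as one strand, to the ribbon with address b
  intertwines z(a) and z(b), where z(a) is the generator x0 of Thompson's group F acting inside the
  ribbon a. If a and b are incomparable, z(a) and z(b) generate an undistorted copy of Z^2: the action on
  the Cantor set changes the depth of an address by at most a multiple of word length.
  Hence x can be joined to x q far from the identity whenever q carries a ribbon to a ribbon: run along
  one of the two rays x z^k, x z^-k (they cannot both come close to the identity), apply q at
  distance much larger than the lengths of x and q, and come back; opposite rays are joined around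
  the corner of a flat. Every g is, with linear control of length, a product of three such elements,
  which gives linear divergence. In an asymptotic cone the paths converge to Lipschitz curves that
  avoid the given point.
*)
theory Submission
  imports Defs "HOL-Library.Stream"
begin

section \<open>Braids up to isotopy\<close>

text \<open>The action on the Cantor set forgets braiding, so it cannot by itself give any
  commutation. That comes from one braid identity: when a strand is split twice, splitting the left
  or the right copy the second time gives the same braid, while the trees differ by a rotation. As
  \<open>zel\<close> is a rotation with straight strands, it passes through every strand of every
  diagram. This needs \<open>zel a\<close> to be independent of the tree in which \<open>a\<close>
  is a leaf, and products to be independent of representatives; the latter holds because an
  expansion of a diagram is determined by either of its two trees. The losses in
  \<open>escape\<close> and \<open>move\<close> depend on the lengths of the elements
  \<open>z\<close> involved and would not be uniform over all addresses. Hence the three factors are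
  made to carry ribbons of depth at most 3: a deep ribbon and its image are brought to standard
  addresses by words in a few fixed elements, at a cost linear in depth, and depth is linear in word
  length. The paths at a given scale all lead to one common target; two points are joined through it
  after the excluded point has been translated to the identity.\<close>

definition cfam :: "nat \<Rightarrow> (real \<Rightarrow> real \<Rightarrow> nat \<Rightarrow> complex) \<Rightarrow> bool" where
  "cfam n h \<longleftrightarrow> continuous_on ({0..1} \<times> {0..1}) (\<lambda>y. h (fst y) (snd y)) \<and>
     (\<forall>s\<in>{0..1}. \<forall>t\<in>{0..1}. h s t \<in> config_space n)"

text \<open>The condition on the ends is kept out of \<open>cfam\<close> because the second factor
  of a product, relabelled by the permutation of the first, in general does not start in the
  left-to-right order of its labels.\<close>

definition isotopy :: "nat \<Rightarrow> (real \<Rightarrow> real \<Rightarrow> nat \<Rightarrow> complex) \<Rightarrow> bool" where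
  "isotopy n h \<longleftrightarrow> cfam n h \<and> (\<forall>s\<in>{0..1}. ends_on_line n (h s))"

lemma ends_on_line_iff:
  "ends_on_line n b \<longleftrightarrow> (\<forall>i<n. b 0 i \<in> \<real> \<and> b 1 i \<in> \<real>) \<and>
     (\<forall>i j. i < j \<longrightarrow> j < n \<longrightarrow> Re (b 0 i) < Re (b 0 j))"
  by (auto simp: ends_on_line_def pathstart_def pathfinish_def strict_mono_on_def)

lemma config_space_iff:
  "z \<in> config_space n \<longleftrightarrow> (\<forall>i j. i < j \<longrightarrow> j < n \<longrightarrow> z i \<noteq> z j) \<and> (\<forall>i\<ge>n. z i = 0)"
  unfolding config_space_def inj_on_def
  by (auto, metis lessThan_iff linorder_neqE_nat order_less_trans)

lemma cfam_config: "cfam n h \<Longrightarrow> s \<in> {0..1} \<Longrightarrow> t \<in> {0..1} \<Longrightarrow> h s t \<in> config_space n"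
  by (auto simp: cfam_def)

lemma cfam_continuous_slice:
  assumes "cfam n h" "continuous_on A f" "continuous_on A g" "f ` A \<subseteq> {0..1}" "g ` A \<subseteq> {0..1}"
  shows "continuous_on A (\<lambda>x. h (f x) (g x))"
proof -
  have "continuous_on A ((\<lambda>y. h (fst y) (snd y)) \<circ> (\<lambda>x. (f x, g x)))"
    using assms unfolding cfam_def
    by (intro continuous_on_compose continuous_on_Pair) (auto elim!: continuous_on_subset)
  then show ?thesis by (simp add: o_def)
qed

lemma isotopic_iff:
  "isotopic n b c \<longleftrightarrow> (\<exists>h. isotopy n h \<and> (\<forall>t\<in>{0..1}. h 0 t = b t \<and> h 1 t = c t))"
proof -
  have "isotopic n b c \<longleftrightarrow> (\<exists>h. continuous_map (prod_topology (top_of_set {0..1::real}) (top_of_set {0..1}))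
        (top_of_set (config_space n)) h \<and>
      (\<forall>x \<in> topspace (top_of_set {0..1}). h(0,x) = b x) \<and>
      (\<forall>x \<in> topspace (top_of_set {0..1}). h(1,x) = c x) \<and>
      (\<forall>t \<in> {0..1}. ends_on_line n (\<lambda>x. h(t, x))))"
    unfolding isotopic_def
    by (rule homotopic_with) (auto simp: ends_on_line_iff)
  also have "\<dots> \<longleftrightarrow> (\<exists>h. isotopy n h \<and> (\<forall>t\<in>{0..1}. h 0 t = b t \<and> h 1 t = c t))"
  proof
    assume "\<exists>h. continuous_map (prod_topology (top_of_set {0..1::real}) (top_of_set {0..1}))
        (top_of_set (config_space n)) h \<and>
      (\<forall>x \<in> topspace (top_of_set {0..1}). h(0,x) = b x) \<and>
      (\<forall>x \<in> topspace (top_of_set {0..1}). h(1,x) = c x) \<and>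
      (\<forall>t \<in> {0..1}. ends_on_line n (\<lambda>x. h(t, x)))"
    then obtain h where h: "continuous_map (prod_topology (top_of_set {0..1}) (top_of_set {0..1}))
        (top_of_set (config_space n)) h" 
      "\<forall>x \<in> {0..1}. h(0::real,x) = b x" "\<forall>x \<in> {0..1}. h(1,x) = c x"
      "\<forall>t \<in> {0..1}. ends_on_line n (\<lambda>x. h(t, x))" by auto
    then have "isotopy n (\<lambda>s t. h (s, t))"
      by (auto simp: isotopy_def cfam_def)
    with h show "\<exists>h. isotopy n h \<and> (\<forall>t\<in>{0..1}. h 0 t = b t \<and> h 1 t = c t)" by blast
  next
    assume "\<exists>h. isotopy n h \<and> (\<forall>t\<in>{0..1}. h 0 t = b t \<and> h 1 t = c t)"
    then obtain h where h: "isotopy n h" "\<forall>t\<in>{0..1}. h 0 t = b t \<and> h 1 t = c t" by blast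
    then show "\<exists>h. continuous_map (prod_topology (top_of_set {0..1::real}) (top_of_set {0..1}))
        (top_of_set (config_space n)) h \<and>
      (\<forall>x \<in> topspace (top_of_set {0..1}). h(0,x) = b x) \<and>
      (\<forall>x \<in> topspace (top_of_set {0..1}). h(1,x) = c x) \<and>
      (\<forall>t \<in> {0..1}. ends_on_line n (\<lambda>x. h(t, x)))"
      by (intro exI[of _ "\<lambda>y. h (fst y) (snd y)"]) (auto simp: isotopy_def cfam_def)
  qed
  finally show ?thesis .
qed

section \<open>Isotopy as an equivalence relation on braids\<close>

lemma is_braid_iff:
  "is_braid n b \<longleftrightarrow> continuous_on {0..1} b \<and> (\<forall>t\<in>{0..1}. b t \<in> config_space n) \<and> ends_on_line n b"
  by (auto simp: is_braid_def path_def path_image_def)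

lemma is_braid_start_real: "is_braid n b \<Longrightarrow> i < n \<Longrightarrow> b 0 i \<in> \<real>"
  and is_braid_finish_real: "is_braid n b \<Longrightarrow> i < n \<Longrightarrow> b 1 i \<in> \<real>"
  and is_braid_start_mono: "is_braid n b \<Longrightarrow> i < j \<Longrightarrow> j < n \<Longrightarrow> Re (b 0 i) < Re (b 0 j)"
  and is_braid_config: "is_braid n b \<Longrightarrow> t \<in> {0..1} \<Longrightarrow> b t \<in> config_space n"
  by (auto simp: is_braid_iff ends_on_line_iff)

lemma isotopy_is_braid:
  assumes "isotopy n h" "s \<in> {0..1}"
  shows "is_braid n (h s)"
proof -
  have "continuous_on {0..1} (\<lambda>t. h s t)"
    using assms by (intro cfam_continuous_slice[of n]) (auto simp: isotopy_def)
  then show ?thesis using assms by (auto simp: is_braid_iff isotopy_def cfam_def)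
qed

lemma is_braid_cong:
  assumes "is_braid n b" "\<And>t. t \<in> {0..1} \<Longrightarrow> b t = c t"
  shows "is_braid n c"
proof -
  have "continuous_on {0..1} c" using assms continuous_on_cong[of "{0..1}" "{0..1}" b c]
    by (auto simp: is_braid_iff)
  with assms show ?thesis by (auto simp: is_braid_iff ends_on_line_iff)
qed

lemma isotopic_is_braid:
  assumes "isotopic n b c" shows "is_braid n b" "is_braid n c"
proof -
  obtain h where h: "isotopy n h" "\<forall>t\<in>{0..1}. h 0 t = b t \<and> h 1 t = c t" 
    using assms isotopic_iff by blast
  show "is_braid n b" using h isotopy_is_braid[of n h 0] by (auto intro: is_braid_cong)
  show "is_braid n c" using h isotopy_is_braid[of n h 1] by (auto intro: is_braid_cong)
qed

lemma isotopic_refl: "is_braid n b \<Longrightarrow> isotopic n b b"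
  unfolding isotopic_def homotopic_with_refl
  by (auto simp: is_braid_iff)

lemma isotopic_sym: "isotopic n b c \<Longrightarrow> isotopic n c b"
  unfolding isotopic_def by (rule homotopic_with_symD)

lemma isotopic_trans [trans]: "isotopic n b c \<Longrightarrow> isotopic n c d \<Longrightarrow> isotopic n b d"
  unfolding isotopic_def by (rule homotopic_with_trans)

lemma isotopicI:
  assumes "isotopy n h" "\<And>t. t\<in>{0..1} \<Longrightarrow> h 0 t = b t" "\<And>t. t\<in>{0..1} \<Longrightarrow> h 1 t = c t"
  shows "isotopic n b c"
  using assms isotopic_iff by blast

lemma isotopic_cong:
  assumes "is_braid n b" "\<And>t. t \<in> {0..1} \<Longrightarrow> b t = c t"
  shows "isotopic n b c"
proof -
  have "isotopic n b b" using assms isotopic_refl by blast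
  then show ?thesis unfolding isotopic_iff using assms(2) by auto
qed

text \<open>Linear interpolation between the identity and \<open>f\<close> stays in the unit
  interval and fixes 0 and 1, so every stage has the ends of \<open>b\<close>.\<close>

lemma isotopic_reparam:
  assumes b: "is_braid n b" and f: "continuous_on {0..1} f" "f ` {0..1} \<subseteq> {0..1}"
    "f 0 = 0" "f 1 = (1::real)"
  shows "isotopic n b (\<lambda>t. b (f t))"
proof (rule isotopicI[where h = "\<lambda>s t. b ((1-s) * t + s * f t)"])
  have r: "(1-s) * t + s * f t \<in> {0..1}" if "s \<in> {0..1}" "t \<in> {0..1}" for s t
  proof -
    have "f t \<in> {0..1}" using f(2) that(2) by blast
    then show ?thesis using that convex_bound_le[of t 1 "f t" "1-s" s] by auto
  qed
  have c: "continuous_on ({0..1}\<times>{0..1}) (b \<circ> (\<lambda>y::real\<times>real. (1-fst y) * snd y + fst y * f (snd y)))"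
  proof (rule continuous_on_compose)
    have "continuous_on ({0..1}\<times>{0..1}) (f \<circ> (snd :: real \<times> real \<Rightarrow> real))"
      using f by (intro continuous_on_compose continuous_intros) (auto elim: continuous_on_subset)
    then show "continuous_on ({0..1}\<times>{0..1}) (\<lambda>y::real\<times>real. (1-fst y) * snd y + fst y * f (snd y))"
      by (intro continuous_intros) (auto simp: o_def)
    show "continuous_on ((\<lambda>y. (1 - fst y) * snd y + fst y * f (snd y)) ` ({0..1} \<times> {0..1})) b"
      using b r by (auto simp: is_braid_iff elim!: continuous_on_subset)
  qed
  show "isotopy n (\<lambda>s t. b ((1 - s) * t + s * f t))"
    unfolding isotopy_def cfam_def
  proof (intro conjI ballI)
    show "continuous_on ({0..1} \<times> {0..1}) (\<lambda>y. b ((1 - fst y) * snd y + fst y * f (snd y)))"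
      using c by (simp add: o_def)
    fix s t :: real assume "s \<in> {0..1}" "t \<in> {0..1}"
    then show "b ((1 - s) * t + s * f t) \<in> config_space n"
      using r b by (auto simp: is_braid_iff)
  next
    fix s :: real assume "s \<in> {0..1}"
    then show "ends_on_line n (\<lambda>t. b ((1 - s) * t + s * f t))"
      using b f by (auto simp: is_braid_iff ends_on_line_iff)
  qed
qed auto

subsection \<open>Joining families\<close>

lemma cfam_join:
  assumes "cfam n h" "cfam n k" "\<And>s. s \<in> {0..1} \<Longrightarrow> h s 1 = k s 0"
  shows "cfam n (\<lambda>s. h s +++ k s)"
  unfolding cfam_def
proof (intro conjI ballI)
  show "continuous_on ({0..1} \<times> {0..1}) (\<lambda>y. (h (fst y) +++ k (fst y)) (snd y))"
    using assms by (intro continuous_on_homotopic_join_lemma)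
       (auto simp: cfam_def pathfinish_def pathstart_def)
  fix s t :: real assume "s \<in> {0..1}" "t \<in> {0..1}"
  then show "(h s +++ k s) t \<in> config_space n"
    using assms by (auto simp: joinpaths_def cfam_def)
qed

definition line :: "nat \<Rightarrow> (nat \<Rightarrow> complex) \<Rightarrow> (nat \<Rightarrow> complex) \<Rightarrow> real \<Rightarrow> nat \<Rightarrow> complex" where
  "line n p q t i = (if i < n then of_real (1 - t) * p i + of_real t * q i else 0)"

lemma line_0: "(\<And>i. i \<ge> n \<Longrightarrow> p i = 0) \<Longrightarrow> line n p q 0 = p"
  and line_1: "(\<And>i. i \<ge> n \<Longrightarrow> q i = 0) \<Longrightarrow> line n p q 1 = q"
  by (auto simp: line_def fun_eq_iff)

lemma config_zero: "z \<in> config_space n \<Longrightarrow> i \<ge> n \<Longrightarrow> z i = 0"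
  by (auto simp: config_space_def)

lemma convex_less:
  fixes a b c d t :: real
  assumes "a < b" "c < d" "0 \<le> t" "t \<le> 1"
  shows "(1 - t) * a + t * c < (1 - t) * b + t * d"
proof (cases "t = 0")
  case False
  then have "t * c < t * d" "(1 - t) * a \<le> (1 - t) * b" using assms by (auto intro: mult_left_mono)
  then show ?thesis by linarith
qed (use assms in auto)

text \<open>Points moving linearly along the real axis between two positions with the same order
  keep that order at all times (\<open>convex_less\<close>), hence never collide.\<close>

lemma line_config:
  assumes "p \<in> config_space n" "q \<in> config_space n" "t \<in> {0..1}"
    "\<And>i. i < n \<Longrightarrow> p i \<in> \<real> \<and> q i \<in> \<real>"
    "\<And>i j. i < n \<Longrightarrow> j < n \<Longrightarrow> Re (p i) < Re (p j) \<Longrightarrow> Re (q i) < Re (q j)"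
  shows "line n p q t \<in> config_space n"
  unfolding config_space_iff
proof (intro conjI allI impI)
  fix i j assume ij: "i < j" "j < n"
  then have "p i \<noteq> p j" "p i \<in> \<real>" "p j \<in> \<real>" using assms by (auto simp: config_space_iff)
  then have "Re (p i) < Re (p j) \<or> Re (p j) < Re (p i)"
    by (metis linorder_neqE_linordered_idom of_real_Re)
  then have "Re (line n p q t i) \<noteq> Re (line n p q t j)"
  proof
    assume "Re (p i) < Re (p j)"
    moreover from this have "Re (q i) < Re (q j)" using assms ij by auto
    ultimately show ?thesis using convex_less[of "Re (p i)" "Re (p j)" "Re (q i)" "Re (q j)" t] assms(3) ij
      by (simp add: line_def)
  next
    assume "Re (p j) < Re (p i)"
    moreover from this have "Re (q j) < Re (q i)" using assms ij by auto
    ultimately show ?thesis using convex_less[of "Re (p j)" "Re (p i)" "Re (q j)" "Re (q i)" t] assms(3) ij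
      by (simp add: line_def)
  qed
  then show "line n p q t i \<noteq> line n p q t j" by auto
qed (auto simp: line_def)

lemma cfam_line:
  assumes p: "continuous_on {0..1} p" and q: "continuous_on {0..1} q"
    and "\<And>s. s \<in> {0..1} \<Longrightarrow> p s \<in> config_space n \<and> q s \<in> config_space n"
    and "\<And>s i. s \<in> {0..1} \<Longrightarrow> i < n \<Longrightarrow> p s i \<in> \<real> \<and> q s i \<in> \<real>"
    and "\<And>s i j. s \<in> {0..1} \<Longrightarrow> i < n \<Longrightarrow> j < n \<Longrightarrow> Re (p s i) < Re (p s j) \<Longrightarrow> Re (q s i) < Re (q s j)"
  shows "cfam n (\<lambda>s. line n (p s) (q s))"
  unfolding cfam_def
proof (intro conjI ballI)
  show "continuous_on ({0..1} \<times> {0..1}) (\<lambda>y. line n (p (fst y)) (q (fst y)) (snd y))"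
  proof (rule continuous_on_coordinatewise_then_product)
    fix i
    have aux: "continuous_on ({0..1}\<times>{0..1::real}) (\<lambda>y. u (fst y) i)" if "continuous_on {0..1::real} u" for u :: "real \<Rightarrow> nat \<Rightarrow> complex"
    proof -
      have "continuous_on ({0..1}\<times>{0..1}) ((\<lambda>s. u s i) \<circ> (fst::real\<times>real\<Rightarrow>real))"
        using that by (intro continuous_on_compose continuous_intros)
          (auto elim!: continuous_on_subset dest: continuous_on_product_then_coordinatewise)
      then show ?thesis by (simp add: o_def)
    qed
    show "continuous_on ({0..1} \<times> {0..1}) (\<lambda>y. line n (p (fst y)) (q (fst y)) (snd y) i)"
      unfolding line_def by (cases "i < n") (auto intro!: continuous_intros aux p q)
  qed
  fix s t :: real assume "s \<in> {0..1}" "t \<in> {0..1}"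
  then show "line n (p s) (q s) t \<in> config_space n" using assms(3-5)[of s] by (intro line_config) auto
qed

lemma cfam_const:
  assumes "continuous_on {0..1} b" "\<And>t. t \<in> {0..1} \<Longrightarrow> b t \<in> config_space n"
  shows "cfam n (\<lambda>s. b)"
proof -
  have "continuous_on ({0..1}\<times>{0..1}) (b \<circ> (snd::real\<times>real\<Rightarrow>real))"
    using assms by (intro continuous_on_compose continuous_on_snd continuous_on_id) (auto elim: continuous_on_subset)
  then show ?thesis using assms by (auto simp: cfam_def o_def)
qed

text \<open>
  The end points of \<open>h s\<close> and the initial points of \<open>k s\<close> need not agree for \<open>0 < s < 1\<close>; as they lie
  in the same order on the real axis, a linear motion between them can be inserted.
\<close>

lemma isotopic_join:
  assumes h: "cfam n h" and k: "cfam n k"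
    and hr: "\<And>s i. s \<in> {0..1} \<Longrightarrow> i < n \<Longrightarrow> h s 0 i \<in> \<real> \<and> h s 1 i \<in> \<real> \<and> k s 0 i \<in> \<real> \<and> k s 1 i \<in> \<real>"
    and mono: "\<And>s i j. s \<in> {0..1} \<Longrightarrow> i < j \<Longrightarrow> j < n \<Longrightarrow> Re (h s 0 i) < Re (h s 0 j)"
    and ord: "\<And>s i j. s \<in> {0..1} \<Longrightarrow> i < n \<Longrightarrow> j < n \<Longrightarrow> Re (h s 1 i) < Re (h s 1 j) \<Longrightarrow> Re (k s 0 i) < Re (k s 0 j)"
    and m0: "h 0 1 = k 0 0" and m1: "h 1 1 = k 1 0"
  shows "isotopic n (h 0 +++ k 0) (h 1 +++ k 1)"
proof -
  define l where "l s = line n (h s 1) (k s 0)" for s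
  have l01: "l s 0 = h s 1" "l s 1 = k s 0" if "s \<in> {0..1}" for s
    unfolding l_def using that cfam_config[OF h, of s 1] cfam_config[OF k, of s 0]
    by (auto intro!: line_0 line_1 dest: config_zero)
  have cl: "cfam n l" unfolding l_def
    using hr ord cfam_config[OF h] cfam_config[OF k]
    by (intro cfam_line cfam_continuous_slice[OF h] cfam_continuous_slice[OF k] continuous_intros) auto
  have lk: "cfam n (\<lambda>s. l s +++ k s)" by (rule cfam_join[OF cl k]) (simp add: l01)
  have hlk: "cfam n (\<lambda>s. h s +++ (l s +++ k s))"
    by (rule cfam_join[OF h lk]) (simp add: joinpaths_def l01)
  have iso: "isotopy n (\<lambda>s. h s +++ (l s +++ k s))"
    unfolding isotopy_def using hlk hr mono by (auto simp: ends_on_line_iff joinpaths_def)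
  then have 1: "isotopic n (h 0 +++ (l 0 +++ k 0)) (h 1 +++ (l 1 +++ k 1))"
    by (rule isotopicI) auto
  \<comment> \<open>At \<open>s = 0\<close> and \<open>s = 1\<close> the inserted motion is
    constant, so it is only a pause: \<open>f\<close> runs over the first half at unit speed, rests
    at 1/2 until time 3/4 and then runs at double speed, as in the nested join.\<close>
  define f where "f t = max (min t (1/2)) (2 * t - 1)" for t :: real
  have f: "continuous_on {0..1} f" "f ` {0..1} \<subseteq> {0..1}" "f 0 = 0" "f 1 = 1"
    unfolding f_def by (auto intro!: continuous_intros)
  have 2: "isotopic n (h s +++ k s) (h s +++ (l s +++ k s))" if s: "s = 0 \<or> s = 1" for s
  proof -
    have eq: "h s 1 = k s 0" "s \<in> {0..1}" using s m0 m1 by auto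
    have b: "is_braid n (h s +++ (l s +++ k s))" using isotopy_is_braid[OF iso] s by auto
    have ls: "l s t = k s 0" if "t \<in> {0..1}" for t
      unfolding l_def eq using config_zero[OF cfam_config[OF k eq(2), of 0]]
      by (auto simp: line_def fun_eq_iff algebra_simps)
    have bb: "is_braid n (h s +++ k s)"
    proof -
      have "cfam n (\<lambda>u. (h s +++ k s))"
        using eq by (intro cfam_join cfam_const cfam_continuous_slice[OF h] cfam_continuous_slice[OF k] 
            cfam_config[OF h] cfam_config[OF k] continuous_intros) auto
      then have "isotopy n (\<lambda>u. (h s +++ k s))"
        unfolding isotopy_def using hr[of s] mono[of s] eq by (auto simp: ends_on_line_iff joinpaths_def)
      then show ?thesis using isotopy_is_braid[of n _ 0] by auto
    qed
    have "isotopic n (h s +++ k s) (\<lambda>t. (h s +++ k s) (f t))"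
      by (rule isotopic_reparam[OF bb f])
    also have "isotopic n (\<lambda>t. (h s +++ k s) (f t)) (h s +++ (l s +++ k s))"
    proof (rule isotopic_cong)
      show "is_braid n (\<lambda>t. (h s +++ k s) (f t))" using isotopic_is_braid isotopic_reparam[OF bb f] by blast
      fix t :: real assume t: "t \<in> {0..1}"
      consider "t \<le> 1/2" | "1/2 < t" "t \<le> 3/4" | "3/4 < t" by linarith
      then show "(h s +++ k s) (f t) = (h s +++ (l s +++ k s)) t"
      proof cases
        case 1 then have "f t = t" by (auto simp: f_def)
        then show ?thesis using 1 by (simp add: joinpaths_def)
      next
        case 2 then have ft: "f t = 1/2" by (auto simp: f_def)
        show ?thesis unfolding ft using 2 eq ls[of "2 * (2*t-1)"] by (simp add: joinpaths_def)
      next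
        case 3 then have "f t = 2 * t - 1" by (auto simp: f_def)
        then show ?thesis using 3 by (simp add: joinpaths_def)
      qed
    qed
    finally show ?thesis .
  qed
  show ?thesis using 1 2[of 0] 2[of 1] by (meson isotopic_sym isotopic_trans)
qed

subsection \<open>Ranks and end positions\<close>

definition order_rank :: "nat \<Rightarrow> (nat \<Rightarrow> real) \<Rightarrow> nat \<Rightarrow> nat" where
  "order_rank n f i = card {j. j < n \<and> f j < f i}"

lemma order_rank_mono: "f i < f j \<Longrightarrow> i < n \<Longrightarrow> order_rank n f i < order_rank n f j"
  unfolding order_rank_def by (rule psubset_card_mono) auto

lemma order_rank_less: 
  assumes "i < n" shows "order_rank n f i < n"
proof -
  have "card {j. j < n \<and> f j < f i} < card {..<n}"
    using assms by (intro psubset_card_mono) auto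
  then show ?thesis by (simp add: order_rank_def)
qed

lemma order_rank_less_iff:
  assumes "inj_on f {..<n}" "i < n" "j < n"
  shows "order_rank n f i < order_rank n f j \<longleftrightarrow> f i < f j"
  using assms order_rank_mono[of f i j n] order_rank_mono[of f j i n] 
  by (metis inj_onD lessThan_iff linorder_neqE_linordered_idom order_less_asym order_less_irrefl)

lemma order_rank_bij:
  assumes "inj_on f {..<n}" shows "bij_betw (order_rank n f) {..<n} {..<n}"
proof -
  have "inj_on (order_rank n f) {..<n}"
    using assms order_rank_less_iff[OF assms] 
    by (intro inj_onI) (metis inj_onD lessThan_iff linorder_neqE_linordered_idom order_less_irrefl)
  moreover have "order_rank n f ` {..<n} \<subseteq> {..<n}" using order_rank_less by auto
  ultimately show ?thesis using endo_inj_surj[of "{..<n}" "order_rank n f"] by (auto simp: bij_betw_def)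
qed

text \<open>If \<open>f i = g k\<close>, then the values of \<open>f\<close> below
  \<open>f i\<close> are exactly the values of \<open>g\<close> at the indices below
  \<open>k\<close>, so the rank of \<open>i\<close> is \<open>k\<close>.\<close>

lemma order_rank_match:
  assumes g: "\<And>i j. i < j \<Longrightarrow> j < n \<Longrightarrow> g i < g j"
    and f: "inj_on f {..<n}" and im: "f ` {..<n} = g ` {..<n}" and i: "i < n"
  shows "g (order_rank n f i) = f i"
proof -
  have "f i \<in> g ` {..<n}" using i unfolding im[symmetric] by auto
  then obtain k where k: "k < n" "f i = g k" by auto
  have mono: "g a < g b \<longleftrightarrow> a < b" if "a < n" "b < n" for a b
    using g that by (metis linorder_neqE_nat order_less_asym order_less_irrefl)
  have ginj: "inj_on g {..<k}"
  proof (rule inj_onI)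
    fix x y assume "x \<in> {..<k}" "y \<in> {..<k}" "g x = g y"
    then show "x = y" using mono[of x y] mono[of y x] k by auto
  qed
  have "f ` {j. j < n \<and> f j < f i} = g ` {..<k}"
  proof (intro Set.set_eqI iffI)
    fix x assume "x \<in> f ` {j. j < n \<and> f j < f i}"
    then obtain j where j: "j < n" "f j < f i" "x = f j" by auto
    have "f j \<in> g ` {..<n}" using j unfolding im[symmetric] by auto
    then obtain l where "l < n" "f j = g l" by auto
    with j k mono show "x \<in> g ` {..<k}" by auto
  next
    fix x assume "x \<in> g ` {..<k}"
    then obtain l where l: "l < k" "x = g l" by auto
    then have "g l \<in> f ` {..<n}" using k unfolding im by auto
    then obtain j where "j < n" "f j = g l" by auto
    then show "x \<in> f ` {j. j < n \<and> f j < f i}" using l k mono by (auto intro!: image_eqI[of _ _ j])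
  qed
  moreover have "inj_on f {j. j < n \<and> f j < f i}" using f by (rule inj_on_subset) auto
  then have "card (f ` {j. j < n \<and> f j < f i}) = order_rank n f i" unfolding order_rank_def by (rule card_image)
  ultimately have "order_rank n f i = card (g ` {..<k})" by simp
  also have "\<dots> = k" using ginj by (simp add: card_image)
  finally show ?thesis using k by simp
qed

lemma order_rank_reindex:
  assumes "bij_betw p {..<n} {..<n}"
  shows "order_rank n (\<lambda>j. f (p j)) i = order_rank n f (p i)"
proof -
  have "p ` {j. j < n \<and> f (p j) < f (p i)} = {j. j < n \<and> f j < f (p i)}"
    using assms by (auto simp: bij_betw_def)
  moreover have "inj_on p {j. j < n \<and> f (p j) < f (p i)}"
    using assms by (auto simp: bij_betw_def elim: inj_on_subset)
  then have "card (p ` {j. j < n \<and> f (p j) < f (p i)}) = card {j. j < n \<and> f (p j) < f (p i)}"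
    by (rule card_image)
  ultimately show ?thesis unfolding order_rank_def by simp
qed

lemma order_rank_increasing:
  assumes "\<And>i j. i < j \<Longrightarrow> j < n \<Longrightarrow> f i < f j" "i < n"
  shows "order_rank n f i = i"
proof -
  have "f j < f i \<longleftrightarrow> j < i" if "j < n" for j
    using assms(1)[of j i] assms(1)[of i j] assms(2) that by (cases j i rule: linorder_cases) auto
  then have "{j. j < n \<and> f j < f i} = {..<i}"
    using assms(2) by auto
  then show ?thesis by (simp add: order_rank_def)
qed

lemma end_pos_order_rank: "end_pos n b = order_rank n (\<lambda>j. Re (b 1 j))"
  by (simp add: fun_eq_iff end_pos_def order_rank_def pathfinish_def)

lemma real_config_inj:
  assumes "z \<in> config_space n" "\<And>i. i < n \<Longrightarrow> z i \<in> \<real>"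
  shows "inj_on (\<lambda>j. Re (z j)) {..<n}"
proof (rule inj_onI)
  fix x y assume xy: "x \<in> {..<n}" "y \<in> {..<n}" "Re (z x) = Re (z y)"
  then have "z x = z y" using assms(2) by (metis lessThan_iff of_real_Re)
  then show "x = y" using assms(1) xy by (auto simp: config_space_def dest: inj_onD)
qed

lemma end_inj: "is_braid n b \<Longrightarrow> inj_on (\<lambda>j. Re (b 1 j)) {..<n}"
  by (rule real_config_inj) (auto simp: is_braid_config is_braid_finish_real)

lemma end_pos_bij: "is_braid n b \<Longrightarrow> bij_betw (end_pos n b) {..<n} {..<n}"
  unfolding end_pos_order_rank by (rule order_rank_bij[OF end_inj])

lemma end_pos_less: "i < n \<Longrightarrow> end_pos n b i < n"
  unfolding end_pos_order_rank by (rule order_rank_less)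

lemma end_pos_less_iff:
  "is_braid n b \<Longrightarrow> i < n \<Longrightarrow> j < n \<Longrightarrow> end_pos n b i < end_pos n b j \<longleftrightarrow> Re (b 1 i) < Re (b 1 j)"
  unfolding end_pos_order_rank by (rule order_rank_less_iff[OF end_inj])

lemma nonzero_sign_constant:
  fixes f :: "real \<Rightarrow> real"
  assumes "continuous_on {0..1} f" "\<And>s. s \<in> {0..1} \<Longrightarrow> f s \<noteq> 0" "s \<in> {0..1}"
  shows "f 0 < 0 \<longleftrightarrow> f s < 0"
proof -
  have c: "continuous_on {0..s} f" using assms by (auto elim: continuous_on_subset)
  show ?thesis
    using IVT'[of f 0 0 s] IVT2'[of f s 0 0] c assms 
    by (smt (verit) atLeastAtMost_iff)
qed

text \<open>During an isotopy two end points stay real and distinct, so by the intermediate value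
  theorem the sign of their difference cannot change.\<close>

lemma isotopy_end_pos:
  assumes h: "isotopy n h" and s: "s \<in> {0..1}"
  shows "end_pos n (h s) i = end_pos n (h 0) i \<or> i \<ge> n"
proof (cases "i < n")
  case True
  have "Re (h 0 1 j) < Re (h 0 1 i) \<longleftrightarrow> Re (h s 1 j) < Re (h s 1 i)" if j: "j < n" for j
  proof (cases "j = i")
    case False
    define f where "f u = Re (h u 1 j) - Re (h u 1 i)" for u
    have hc: "continuous_on {0..1} (\<lambda>u. h u 1)"
      using h by (intro cfam_continuous_slice[of n]) (auto simp: isotopy_def intro!: continuous_intros)
    have "continuous_on {0..1} f"
      unfolding f_def by (intro continuous_intros continuous_on_product_then_coordinatewise[OF hc])
    moreover have "f u \<noteq> 0" if "u \<in> {0..1}" for u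
    proof -
      have "inj_on (\<lambda>j. Re (h u 1 j)) {..<n}"
        using isotopy_is_braid[OF h that] by (rule end_inj)
      then show ?thesis using False True j by (auto simp: f_def dest: inj_onD)
    qed
    ultimately have "f 0 < 0 \<longleftrightarrow> f s < 0" by (rule nonzero_sign_constant) (use s in auto)
    then show ?thesis by (auto simp: f_def)
  qed auto
  then show ?thesis by (auto simp: end_pos_def pathfinish_def intro!: arg_cong[of _ _ card])
qed auto

lemma isotopic_end_pos:
  assumes "isotopic n b c" "i < n"
  shows "end_pos n b i = end_pos n c i"
proof -
  obtain h where h: "isotopy n h" "\<forall>t\<in>{0..1}. h 0 t = b t \<and> h 1 t = c t" using assms isotopic_iff by blast
  then have "end_pos n b = end_pos n (h 0)" "end_pos n c = end_pos n (h 1)"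
    by (auto simp: end_pos_def pathfinish_def fun_eq_iff)
  then show ?thesis using isotopy_end_pos[OF h(1), of 1 i] assms by auto
qed

subsection \<open>Composition of braids\<close>

definition relabel :: "nat \<Rightarrow> (nat \<Rightarrow> nat) \<Rightarrow> (real \<Rightarrow> nat \<Rightarrow> complex) \<Rightarrow> real \<Rightarrow> nat \<Rightarrow> complex" where
  "relabel n p c t i = (if i < n then c t (p i) else 0)"

lemma braid_comp_relabel: "braid_comp n b c = b +++ relabel n (end_pos n b) c"
  by (simp add: braid_comp_def relabel_def [abs_def])

definition matched :: "nat \<Rightarrow> (real \<Rightarrow> nat \<Rightarrow> complex) \<Rightarrow> (real \<Rightarrow> nat \<Rightarrow> complex) \<Rightarrow> bool" where
  "matched n b c \<longleftrightarrow> (\<forall>i<n. c 0 (end_pos n b i) = b 1 i)"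

text \<open>A finite set of reals has only one increasing enumeration. Equality of the two sets of
  end points therefore already matches the strands one by one, through the ranks.\<close>

lemma matched_iff:
  assumes b: "is_braid n b" and c: "is_braid n c"
  shows "matched n b c \<longleftrightarrow> pathfinish b ` {..<n} = pathstart c ` {..<n}"
proof
  assume m: "matched n b c"
  have "pathfinish b ` {..<n} = pathstart c ` (end_pos n b ` {..<n})"
    using m by (force simp: matched_def pathfinish_def pathstart_def image_image)
  also have "end_pos n b ` {..<n} = {..<n}" using end_pos_bij[OF b] by (simp add: bij_betw_def)
  finally show "pathfinish b ` {..<n} = pathstart c ` {..<n}" .
next
  assume e: "pathfinish b ` {..<n} = pathstart c ` {..<n}"
  show "matched n b c"
    unfolding matched_def
  proof (intro allI impI)
    fix i assume i: "i < n"
    have "Re (c 0 (order_rank n (\<lambda>j. Re (b 1 j)) i)) = Re (b 1 i)"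
    proof (rule order_rank_match[where g = "\<lambda>j. Re (c 0 j)"])
      show "Re (c 0 i) < Re (c 0 j)" if "i < j" "j < n" for i j using is_braid_start_mono[OF c that] .
      show "inj_on (\<lambda>j. Re (b 1 j)) {..<n}" by (rule end_inj[OF b])
      have "Re ` pathfinish b ` {..<n} = Re ` pathstart c ` {..<n}" using e by simp
      then show "(\<lambda>j. Re (b 1 j)) ` {..<n} = (\<lambda>j. Re (c 0 j)) ` {..<n}"
        by (simp add: image_image pathfinish_def pathstart_def)
    qed (use i in auto)
    then have "Re (c 0 (end_pos n b i)) = Re (b 1 i)" by (simp add: end_pos_order_rank)
    moreover have "c 0 (end_pos n b i) \<in> \<real>" "b 1 i \<in> \<real>"
      using b c i end_pos_less[OF i] by (auto intro: is_braid_start_real is_braid_finish_real)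
    ultimately show "c 0 (end_pos n b i) = b 1 i" by (metis of_real_Re)
  qed
qed

lemma relabel_config:
  assumes "z \<in> config_space n" "bij_betw p {..<n} {..<n}"
  shows "(\<lambda>i. if i < n then z (p i) else 0) \<in> config_space n"
  using assms unfolding config_space_def bij_betw_def inj_on_def
  by auto (metis imageI lessThan_iff)

lemma cfam_relabel:
  assumes "cfam n k" "bij_betw p {..<n} {..<n}"
  shows "cfam n (\<lambda>s. relabel n p (k s))"
  unfolding cfam_def
proof (intro conjI ballI)
  show "continuous_on ({0..1} \<times> {0..1}) (\<lambda>y. relabel n p (k (fst y)) (snd y))"
  proof (rule continuous_on_coordinatewise_then_product)
    fix i show "continuous_on ({0..1} \<times> {0..1}) (\<lambda>y. relabel n p (k (fst y)) (snd y) i)"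
      using assms(1) unfolding relabel_def cfam_def
      by (cases "i < n") (auto dest: continuous_on_product_then_coordinatewise)
  qed
  fix s t :: real assume "s \<in> {0..1}" "t \<in> {0..1}"
  then show "relabel n p (k s) t \<in> config_space n"
    using relabel_config[OF cfam_config[OF assms(1)] assms(2), of s t] by (simp add: relabel_def[abs_def])
qed

text \<open>The intermediate stages need not be composable; \<open>isotopic_join\<close> repairs
  this. The permutation \<open>p\<close> is constant along \<open>h\<close>, so a single relabelling
  of \<open>k\<close> serves all stages.\<close>

lemma isotopy_comp:
  assumes h: "isotopy n h" and k: "isotopy n k"
    and m0: "matched n (h 0) (k 0)" and m1: "matched n (h 1) (k 1)"
  shows "isotopic n (braid_comp n (h 0) (k 0)) (braid_comp n (h 1) (k 1))"
proof -
  define p where "p = end_pos n (h 0)"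
  have hb: "is_braid n (h s)" "is_braid n (k s)" if "s \<in> {0..1}" for s
    using isotopy_is_braid[OF h that] isotopy_is_braid[OF k that] by auto
  have p: "end_pos n (h s) i = p i" if "s \<in> {0..1}" "i < n" for s i
    using isotopy_end_pos[OF h that(1), of i] that by (auto simp: p_def)
  have pb: "bij_betw p {..<n} {..<n}" unfolding p_def by (rule end_pos_bij) (use hb in auto)
  have pl: "i < n \<Longrightarrow> p i < n" for i by (simp add: p_def end_pos_less)
  have hz: "h s 1 i = 0" if "s \<in> {0..1}" "i \<ge> n" for s i
    using is_braid_config[OF hb(1)[OF that(1)], of 1] that by (auto intro: config_zero)
  have "isotopic n (h 0 +++ relabel n p (k 0)) (h 1 +++ relabel n p (k 1))"
  proof (rule isotopic_join)
    show "cfam n h" "cfam n (\<lambda>s. relabel n p (k s))" 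
      using h k pb by (auto simp: isotopy_def intro: cfam_relabel)
    show "h s 0 i \<in> \<real> \<and> h s 1 i \<in> \<real> \<and> relabel n p (k s) 0 i \<in> \<real> \<and> relabel n p (k s) 1 i \<in> \<real>"
      if "s \<in> {0..1}" "i < n" for s i
      using hb[OF that(1)] that pl by (auto simp: relabel_def is_braid_start_real is_braid_finish_real)
    show "Re (h s 0 i) < Re (h s 0 j)" if "s \<in> {0..1}" "i < j" "j < n" for s i j
      using is_braid_start_mono[OF hb(1)[OF that(1)]] that by auto
    show "Re (relabel n p (k s) 0 i) < Re (relabel n p (k s) 0 j)" 
      if "s \<in> {0..1}" "i < n" "j < n" "Re (h s 1 i) < Re (h s 1 j)" for s i j
    proof -
      have "p i < p j" using end_pos_less_iff[OF hb(1)[OF that(1)], of i j] that p by auto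
      then show ?thesis using is_braid_start_mono[OF hb(2)[OF that(1)]] pl that by (auto simp: relabel_def)
    qed
    show "h 0 1 = relabel n p (k 0) 0"
      using m0 hz[of 0] by (auto simp: relabel_def matched_def fun_eq_iff p_def)
    show "h 1 1 = relabel n p (k 1) 0"
      using m1 hz[of 1] p[of 1] by (auto simp: relabel_def matched_def fun_eq_iff)
  qed
  moreover have "relabel n p (k 1) = relabel n (end_pos n (h 1)) (k 1)"
    using p[of 1] by (auto simp: relabel_def fun_eq_iff)
  ultimately show ?thesis by (simp add: braid_comp_relabel p_def)
qed

lemma isotopy_const: "is_braid n b \<Longrightarrow> isotopy n (\<lambda>s. b)"
  by (auto simp: isotopy_def is_braid_iff intro: cfam_const)

lemma braid_comp_is_braid:
  assumes "is_braid n b" "is_braid n c" "matched n b c"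
  shows "is_braid n (braid_comp n b c)"
  using isotopy_comp[OF isotopy_const[OF assms(1)] isotopy_const[OF assms(2)]] assms isotopic_is_braid by blast

lemma end_pos_cong: "(\<And>t. t \<in> {0..1} \<Longrightarrow> b t = c t) \<Longrightarrow> end_pos n b = end_pos n c"
  by (auto simp: end_pos_def pathfinish_def fun_eq_iff)

lemma braid_comp_isotopic:
  assumes "isotopic n b b'" "isotopic n c c'" "matched n b c" "matched n b' c'"
  shows "isotopic n (braid_comp n b c) (braid_comp n b' c')"
proof -
  obtain h where h: "isotopy n h" "\<And>t. t\<in>{0..1} \<Longrightarrow> h 0 t = b t \<and> h 1 t = b' t" 
    using assms(1) isotopic_iff by blast
  obtain k where k: "isotopy n k" "\<And>t. t\<in>{0..1} \<Longrightarrow> k 0 t = c t \<and> k 1 t = c' t" 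
    using assms(2) isotopic_iff by blast
  have e: "end_pos n (h 0) = end_pos n b" "end_pos n (h 1) = end_pos n b'"
    using h by (auto intro!: end_pos_cong)
  have *: "isotopic n (braid_comp n (h 0) (k 0)) (braid_comp n (h 1) (k 1))"
    using assms h k by (intro isotopy_comp) (auto simp: matched_def e)
  have "braid_comp n (h 0) (k 0) t = braid_comp n b c t" "braid_comp n (h 1) (k 1) t = braid_comp n b' c' t" 
    if "t \<in> {0..1}" for t
    using h(2)[of "2*t"] k(2)[of "2*t-1"] that by (auto simp: braid_comp_relabel joinpaths_def e relabel_def fun_eq_iff)
  then show ?thesis using * isotopic_cong isotopic_is_braid[OF *] by (meson isotopic_sym isotopic_trans)
qed

lemma end_pos_comp:
  assumes "is_braid n b" "i < n"
  shows "end_pos n (braid_comp n b c) i = end_pos n c (end_pos n b i)"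
proof -
  have "end_pos n (braid_comp n b c) i = order_rank n (\<lambda>j. Re (c 1 (end_pos n b j))) i"
    using assms(2) unfolding end_pos_order_rank by (auto simp: braid_comp_def joinpaths_def order_rank_def end_pos_order_rank intro!: arg_cong[of _ _ card])
  then show ?thesis using order_rank_reindex[OF end_pos_bij[OF assms(1)], of "\<lambda>j. Re (c 1 j)" i]
    by (simp add: end_pos_order_rank)
qed

text \<open>A linear motion from the prescribed initial points to those of \<open>c\<close> is put
  in front of \<open>c\<close>. Letting its starting point slide along the axis from
  \<open>c 0\<close> to \<open>a\<close> is an isotopy, and at \<open>s = 0\<close> the added piece
  is only a pause.\<close>

lemma braid_start_adjust:
  assumes c: "is_braid n c" and a: "\<And>i j. i < j \<Longrightarrow> j < n \<Longrightarrow> a i < a j"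
  obtains c' where "isotopic n c c'" "\<And>i. i < n \<Longrightarrow> c' 0 i = of_real (a i)"
proof -
  define q where "q s = line n (c 0) (\<lambda>i. of_real (a i)) s" for s
  define h where "h s = line n (q s) (c 0)" for s
  have cz: "i \<ge> n \<Longrightarrow> c 0 i = 0" for i using is_braid_config[OF c, of 0] by (auto intro: config_zero)
  have q0: "q 0 = c 0" using cz by (auto simp: q_def intro: line_0)
  have Req: "Re (q s i) < Re (q s j)" if "i < j" "j < n" "s \<in> {0..1}" for s i j
    using that convex_less[of "Re (c 0 i)" "Re (c 0 j)" "a i" "a j" s] is_braid_start_mono[OF c, of i j] a
    by (auto simp: q_def line_def)
  have qreal: "q s i \<in> \<real>" for s i
    using is_braid_start_real[OF c] by (auto simp: q_def line_def)
  have qconf: "q s \<in> config_space n" if "s \<in> {0..1}" for s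
    unfolding config_space_iff
  proof (intro conjI allI impI)
    fix i j assume "i < j" "j < n"
    then show "q s i \<noteq> q s j" using Req[of i j s] that by auto
  qed (auto simp: q_def line_def)
  have h1: "h s 1 = c 0" "h s 0 = q s" for s 
    using cz by (auto simp: h_def q_def intro!: line_1 line_0) (auto simp: line_def)
  have qc: "continuous_on {0..1} q"
  proof (rule continuous_on_coordinatewise_then_product)
    fix i show "continuous_on {0..1} (\<lambda>s. q s i)"
      unfolding q_def line_def by (cases "i < n") (auto intro!: continuous_intros)
  qed
  have hf: "cfam n h" unfolding h_def
  proof (rule cfam_line[OF qc])
    show "Re (c 0 i) < Re (c 0 j)" if "s \<in> {0..1}" "i < n" "j < n" "Re (q s i) < Re (q s j)" for s i j
    proof -
      have "i < j" using Req[of j i s] that by (metis linorder_neqE_nat order_less_asym order_less_irrefl)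
      then show ?thesis using is_braid_start_mono[OF c] that by auto
    qed
  qed (use c qconf qreal in \<open>auto simp: is_braid_config is_braid_start_real\<close>)
  have j: "cfam n (\<lambda>s. h s +++ c)"
    by (rule cfam_join[OF hf cfam_const]) (use c h1 in \<open>auto simp: is_braid_iff\<close>)
  have iso: "isotopy n (\<lambda>s. h s +++ c)"
    unfolding isotopy_def using j Req qreal c h1
    by (auto simp: ends_on_line_iff joinpaths_def is_braid_finish_real)
  then have 1: "isotopic n (h 0 +++ c) (h 1 +++ c)" by (rule isotopicI) auto
  have f: "continuous_on {0..1} (\<lambda>t::real. max 0 (2 * t - 1))" by (intro continuous_intros)
  have 2: "isotopic n c (\<lambda>t. c (max 0 (2 * t - 1)))"
    by (rule isotopic_reparam[OF c f]) auto
  have hc: "h 0 t = c 0" for t unfolding h_def q0 using cz by (auto simp: line_def fun_eq_iff algebra_simps)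
  have 3: "isotopic n (\<lambda>t. c (max 0 (2 * t - 1))) (h 0 +++ c)"
    using isotopic_is_braid(2)[OF 2] by (rule isotopic_cong) (auto simp: joinpaths_def hc)
  have "isotopic n c (h 1 +++ c)" using 1 2 3 isotopic_trans by blast
  moreover have "(h 1 +++ c) 0 i = of_real (a i)" if "i < n" for i
    using that by (simp add: joinpaths_def h1 q_def line_def)
  ultimately show ?thesis using that by blast
qed

lemma braid_match:
  assumes b: "is_braid n b" and c: "is_braid n c"
  obtains c' where "isotopic n c c'" "matched n b c'"
proof -
  define p where "p = end_pos n b"
  define q where "q = inv_into {..<n} p"
  \<comment> \<open>The end points of \<open>b\<close> listed from left to right, to which the start
    of \<open>c\<close> is moved.\<close>
  define a where "a k = Re (b 1 (q k))" for k
  have pb: "bij_betw p {..<n} {..<n}" unfolding p_def by (rule end_pos_bij[OF b])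
  have pq: "p (q k) = k" "q k < n" if "k < n" for k
    using that pb bij_betw_inv_into_right[OF pb, of k] bij_betw_inv_into[OF pb] 
    by (auto simp: q_def bij_betw_def)
  have qp: "q (p k) = k" if "k < n" for k
    using that bij_betw_inv_into_left[OF pb, of k] by (auto simp: q_def)
  have "a i < a j" if "i < j" "j < n" for i j
    using end_pos_less_iff[OF b, of "q i" "q j"] pq[of i] pq[of j] that by (auto simp: a_def p_def)
  then obtain c' where c': "isotopic n c c'" "\<And>i. i < n \<Longrightarrow> c' 0 i = of_real (a i)"
    using braid_start_adjust[OF c, of a] by blast
  have "matched n b c'"
    unfolding matched_def
  proof (intro allI impI)
    fix i assume i: "i < n"
    then have "c' 0 (p i) = of_real (Re (b 1 i))" using c'(2)[of "p i"] end_pos_less[OF i, of b] qp[OF i]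
      by (simp add: a_def p_def)
    then show "c' 0 (end_pos n b i) = b 1 i" using is_braid_finish_real[OF b i] by (simp add: p_def)
  qed
  then show ?thesis using c' that by blast
qed

lemma braid_comp_assoc:
  assumes b: "is_braid n b" and c: "is_braid n c" and d: "is_braid n d"
    and m: "matched n b c" "matched n c d"
  shows "matched n (braid_comp n b c) d" "matched n b (braid_comp n c d)"
    "isotopic n (braid_comp n (braid_comp n b c) d) (braid_comp n b (braid_comp n c d))"
proof -
  let ?bc = "braid_comp n b c" and ?cd = "braid_comp n c d"
  have pl: "i < n \<Longrightarrow> end_pos n b i < n" for i by (rule end_pos_less)
  show 1: "matched n ?bc d"
    unfolding matched_def
    using m pl end_pos_comp[OF b] by (auto simp: matched_def braid_comp_def joinpaths_def)
  show 2: "matched n b ?cd"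
    using m by (auto simp: matched_def braid_comp_def joinpaths_def)
  have L: "is_braid n (braid_comp n ?bc d)"
    using b c d m 1 by (intro braid_comp_is_braid) auto
  \<comment> \<open>Pulls the division 1/4, 1/4, 1/2 of time in the left bracketing back to the
    division 1/2, 1/4, 1/4 of the right one.\<close>
  define f where "f t = max (t/2) (max (t - 1/4) (2 * t - 1))" for t :: real
  have f: "continuous_on {0..1} f" "f ` {0..1} \<subseteq> {0..1}" "f 0 = 0" "f 1 = 1"
    unfolding f_def by (auto intro!: continuous_intros simp: le_max_iff_disj)
  have "isotopic n (braid_comp n ?bc d) (\<lambda>t. braid_comp n ?bc d (f t))"
    by (rule isotopic_reparam[OF L f])
  also have "isotopic n (\<lambda>t. braid_comp n ?bc d (f t)) (braid_comp n b ?cd)"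
  proof (rule isotopic_cong)
    show "is_braid n (\<lambda>t. braid_comp n ?bc d (f t))" 
      using isotopic_is_braid(2)[OF isotopic_reparam[OF L f]] .
    fix t :: real assume t: "t \<in> {0..1}"
    consider "t \<le> 1/2" | "1/2 < t" "t \<le> 3/4" | "3/4 < t" by linarith
    then show "braid_comp n ?bc d (f t) = braid_comp n b ?cd t"
    proof cases
      case 1 then have ft: "f t = t / 2" by (auto simp: f_def)
      show ?thesis unfolding ft using 1 by (simp add: joinpaths_def braid_comp_def)
    next
      case 2 then have ft: "f t = t - 1/4" by (auto simp: f_def)
      have "2 * (2 * (t - 1/4)) - 1 = 2 * (2 * t - 1)" by simp
      then show ?thesis unfolding ft using 2 by (auto simp: joinpaths_def braid_comp_def)
    next
      case 3 then have ft: "f t = 2 * t - 1" by (auto simp: f_def)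
      have "braid_comp n ?bc d (2 * t - 1) i = braid_comp n b ?cd t i" for i
      proof (cases "i < n")
        case True
        have "braid_comp n ?bc d (2 * t - 1) i = d (2 * (2 * t - 1) - 1) (end_pos n ?bc i)"
          using 3 True by (simp add: joinpaths_def braid_comp_def[of n ?bc])
        moreover have "braid_comp n b ?cd t i = ?cd (2 * t - 1) (end_pos n b i)"
          using 3 True by (simp add: joinpaths_def braid_comp_def[of n b ?cd])
        moreover have "?cd (2 * t - 1) (end_pos n b i) = d (2 * (2 * t - 1) - 1) (end_pos n c (end_pos n b i))"
          using 3 pl[OF True] by (simp add: joinpaths_def braid_comp_def)
        ultimately show ?thesis by (simp add: end_pos_comp[OF b True])
      next
        case False
        then show ?thesis using 3 by (auto simp: joinpaths_def braid_comp_def)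
      qed
      then show ?thesis unfolding ft by blast
    qed
  qed
  finally show "isotopic n (braid_comp n ?bc d) (braid_comp n b ?cd)" .
qed

section \<open>Straight braids and inverses of braids\<close>

definition const_braid :: "nat \<Rightarrow> (nat \<Rightarrow> real) \<Rightarrow> real \<Rightarrow> nat \<Rightarrow> complex" where
  "const_braid n a t i = (if i < n then of_real (a i) else 0)"

lemma const_braid_is_braid:
  assumes "\<And>i j. i < j \<Longrightarrow> j < n \<Longrightarrow> a i < a j"
  shows "is_braid n (const_braid n a)"
proof -
  have "const_braid n a = (\<lambda>t. const_braid n a 0)" by (auto simp: const_braid_def fun_eq_iff)
  then have "continuous_on {0..1} (const_braid n a)" by (metis continuous_on_const)
  moreover have "i < j \<Longrightarrow> j < n \<Longrightarrow> a i \<noteq> a j" for i j using assms[of i j] by auto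
  ultimately show ?thesis using assms by (auto simp: is_braid_iff config_space_iff ends_on_line_iff const_braid_def)
qed

lemma const_braid_isotopic:
  assumes "\<And>i j. i < j \<Longrightarrow> j < n \<Longrightarrow> a i < a j" "\<And>i j. i < j \<Longrightarrow> j < n \<Longrightarrow> a' i < a' j"
  shows "isotopic n (const_braid n a) (const_braid n a')"
proof (rule isotopicI)
  let ?h = "\<lambda>s. const_braid n (\<lambda>i. (1 - s) * a i + s * a' i)"
  have m: "(1 - s) * a i + s * a' i < (1 - s) * a j + s * a' j" if "s \<in> {0..1}" "i < j" "j < n" for s i j
    using that assms by (intro convex_less) auto
  have "is_braid n (?h s)" if "s \<in> {0..1}" for s using m[OF that] by (intro const_braid_is_braid) auto
  moreover have "continuous_on ({0..1} \<times> {0..1}) (\<lambda>y. ?h (fst y) (snd y))"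
  proof (rule continuous_on_coordinatewise_then_product)
    fix i show "continuous_on ({0..1} \<times> {0..1}) (\<lambda>y. ?h (fst y) (snd y) i)"
      by (cases "i < n") (auto simp: const_braid_def intro!: continuous_intros)
  qed
  ultimately show "isotopy n ?h" by (auto simp: isotopy_def cfam_def is_braid_iff)
qed auto

lemma trivial_braid_const: "trivial_braid n = const_braid n real"
  by (auto simp: trivial_braid_def const_braid_def fun_eq_iff)

lemma end_pos_const: "(\<And>i j. i < j \<Longrightarrow> j < n \<Longrightarrow> a i < a j) \<Longrightarrow> i < n \<Longrightarrow> end_pos n (const_braid n a) i = i"
  unfolding end_pos_order_rank by (intro order_rank_increasing) (auto simp: const_braid_def)

text \<open>The product waits at the initial points of \<open>b\<close> and then runs
  \<open>b\<close> at double speed, which is a reparametrization of \<open>b\<close>.\<close>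

lemma braid_comp_const_left:
  assumes b: "is_braid n b"
  defines "a \<equiv> \<lambda>i. Re (b 0 i)"
  shows "matched n (const_braid n a) b" "isotopic n (braid_comp n (const_braid n a) b) b"
proof -
  have inc: "a i < a j" if "i < j" "j < n" for i j using is_braid_start_mono[OF b that] by (simp add: a_def)
  have b0: "of_real (a i) = b 0 i" if "i < n" for i using is_braid_start_real[OF b that] by (simp add: a_def)
  have e: "end_pos n (const_braid n a) i = i" if "i < n" for i using end_pos_const inc that by blast
  show m: "matched n (const_braid n a) b" using b0 e by (auto simp: matched_def const_braid_def)
  have f: "continuous_on {0..1} (\<lambda>t::real. max 0 (2 * t - 1))" by (intro continuous_intros)
  have r: "isotopic n b (\<lambda>t. b (max 0 (2 * t - 1)))"
    by (rule isotopic_reparam[OF b f]) auto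
  have bz: "b t i = 0" if "i \<ge> n" "t \<in> {0..1}" for t i using is_braid_config[OF b that(2)] that(1) by (rule config_zero)
  have "isotopic n (\<lambda>t. b (max 0 (2 * t - 1))) (braid_comp n (const_braid n a) b)"
    using isotopic_is_braid(2)[OF r] 
  proof (rule isotopic_cong)
    fix t :: real assume "t \<in> {0..1}"
    then show "b (max 0 (2 * t - 1)) = braid_comp n (const_braid n a) b t"
      using b0 e bz by (auto simp: braid_comp_def joinpaths_def const_braid_def fun_eq_iff)
  qed
  then show "isotopic n (braid_comp n (const_braid n a) b) b" using r isotopic_sym isotopic_trans by blast
qed

text \<open>The inverse is \<open>b\<close> run backwards, with strands renamed by the inverse
  permutation \<open>q\<close> so that labels again follow the order of the initial points. Turning
  round earlier and earlier contracts the product to a straight braid.\<close>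

lemma braid_inverse:
  assumes b: "is_braid n b"
  obtains c where "is_braid n c" "matched n c b" "isotopic n (braid_comp n c b) (trivial_braid n)"
proof -
  define p where "p = end_pos n b"
  define q where "q = inv_into {..<n} p"
  have pb: "bij_betw p {..<n} {..<n}" unfolding p_def by (rule end_pos_bij[OF b])
  have qb: "bij_betw q {..<n} {..<n}" unfolding q_def by (rule bij_betw_inv_into[OF pb])
  have pq: "p (q k) = k" "q k < n" if "k < n" for k
    using that pb bij_betw_inv_into_right[OF pb, of k] qb 
    by (auto simp: q_def bij_betw_def)
  have bz: "b t i = 0" if "i \<ge> n" "t \<in> {0..1}" for t i using is_braid_config[OF b that(2)] that(1) by (rule config_zero)
  define h where "h s t = relabel n q (\<lambda>u. b (1 - (1 - s) * u)) t" for s t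
  define c where "c = h 0"
  have bc: "continuous_on {0..1} b" using b by (auto simp: is_braid_iff)
  have qmono: "Re (b 1 (q i)) < Re (b 1 (q j))" if "i < j" "j < n" for i j
    using end_pos_less_iff[OF b, of "q i" "q j"] pq[of i] pq[of j] that by (auto simp: p_def)
  have fam: "cfam n (\<lambda>s. relabel n q (\<lambda>u. b (1 - (1 - s) * g u)))" 
    if g: "continuous_on {0..1} g" "\<And>u. u \<in> {0..1} \<Longrightarrow> g u \<in> {0..1}" for g
  proof (rule cfam_relabel[OF _ qb])
    have r: "1 - (1 - s) * g u \<in> {0..1}" if "s \<in> {0..1}" "u \<in> {0..1}" for s u
      using g(2)[OF that(2)] that mult_le_one[of "1 - s" "g u"] by (auto simp: mult_le_one)
    show "cfam n (\<lambda>s u. b (1 - (1 - s) * g u))"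
      unfolding cfam_def
    proof (intro conjI ballI)
      have "continuous_on ({0..1}\<times>{0..1}) (g \<circ> (snd :: real \<times> real \<Rightarrow> real))"
        using g by (intro continuous_on_compose continuous_on_snd continuous_on_id) (auto elim: continuous_on_subset)
      then have "continuous_on ({0..1}\<times>{0..1}) (b \<circ> (\<lambda>y. 1 - (1 - fst y) * g (snd y)))"
        using r bc by (intro continuous_on_compose) 
          (auto simp: o_def intro!: continuous_intros elim!: continuous_on_subset)
      then show "continuous_on ({0..1} \<times> {0..1}) (\<lambda>y. b (1 - (1 - fst y) * g (snd y)))" by (simp add: o_def)
    qed (use r b in \<open>auto simp: is_braid_config\<close>)
  qed
  have c_eq: "c t i = (if i < n then b (1 - t) (q i) else 0)" for t i
    by (simp add: c_def h_def relabel_def)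
  have hf: "cfam n h" using fam[of "\<lambda>u. u"] by (simp add: h_def[abs_def] relabel_def)
  have "continuous_on {0..1} (\<lambda>t. h 0 t)" by (rule cfam_continuous_slice[OF hf]) auto
  then have cb: "is_braid n c"
    using cfam_config[OF hf, of 0] pq qmono b
    by (auto simp: is_braid_iff c_def[symmetric] ends_on_line_iff) 
       (auto simp: c_eq intro: is_braid_finish_real is_braid_start_real)
  have ec: "end_pos n c i = q i" if "i < n" for i
  proof -
    have "end_pos n c i = order_rank n (\<lambda>j. Re (b 0 (q j))) i"
      using that unfolding end_pos_order_rank by (auto simp: c_eq order_rank_def intro!: arg_cong[of _ _ card])
    also have "\<dots> = order_rank n (\<lambda>j. Re (b 0 j)) (q i)" by (rule order_rank_reindex[OF qb])
    also have "\<dots> = q i" using is_braid_start_mono[OF b] pq that by (intro order_rank_increasing) auto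
    finally show ?thesis .
  qed
  have m: "matched n c b" by (auto simp: matched_def ec c_eq)
  \<comment> \<open>A tent function: at \<open>s = 0\<close> the path \<open>1 - g u\<close> goes
    back along \<open>b\<close> and returns, at \<open>s = 1\<close> the factor \<open>1 - s\<close>
    freezes everything at the end of \<open>b\<close>.\<close>
  define g where "g u = 1 - \<bar>1 - 2 * u\<bar>" for u :: real
  have g: "continuous_on {0..1} g" "\<And>u. u \<in> {0..1} \<Longrightarrow> g u \<in> {0..1}"
    unfolding g_def by (auto intro!: continuous_intros)
  define H where "H s = relabel n q (\<lambda>u. b (1 - (1 - s) * g u))" for s
  have famH: "cfam n H" using fam[OF g] by (simp add: H_def[abs_def])
  have "isotopy n H" unfolding isotopy_def 
    using famH pq qmono b 
    by (auto simp: ends_on_line_iff H_def relabel_def g_def is_braid_finish_real)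
  then have "isotopic n (braid_comp n c b) (const_braid n (\<lambda>i. Re (b 1 (q i))))"
  proof (rule isotopicI)
    fix t :: real assume t: "t \<in> {0..1}"
    show "H 0 t = braid_comp n c b t"
    proof (cases "t \<le> 1/2")
      case True then have "g t = 2 * t" by (auto simp: g_def)
      then show ?thesis using True by (auto simp: H_def relabel_def braid_comp_def joinpaths_def c_eq fun_eq_iff)
    next
      case False then have "1 - g t = 2 * t - 1" by (auto simp: g_def)
      then have "b (1 - g t) = b (2 * t - 1)" by (simp only:)
      then show ?thesis using False by (auto simp: H_def relabel_def braid_comp_def joinpaths_def ec fun_eq_iff)
    qed
    show "H 1 t = const_braid n (\<lambda>i. Re (b 1 (q i))) t"
      using is_braid_finish_real[OF b] pq by (auto simp: H_def relabel_def const_braid_def fun_eq_iff)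
  qed
  also have "isotopic n (const_braid n (\<lambda>i. Re (b 1 (q i)))) (trivial_braid n)"
    unfolding trivial_braid_const using qmono by (intro const_braid_isotopic) auto
  finally show ?thesis using that cb m by blast
qed

subsection \<open>Doubling a strand\<close>

lemma double_strand_eq:
  "double_strand i \<epsilon> b t k =
     b t (if k \<le> i then k else k - 1) + (if k = Suc i then complex_of_real \<epsilon> else 0)"
  by (auto simp: double_strand_def)

lemma room_right_mono: "room_right n b i \<epsilon> \<Longrightarrow> \<delta> \<le> \<epsilon> \<Longrightarrow> room_right n b i \<delta>"
  by (auto simp: room_right_def)

lemma room_rightD:
  assumes "room_right n b i \<epsilon>" "t \<in> {0..1}" "j < n" "j \<noteq> i" "0 \<le> r" "r \<le> \<epsilon>"
  shows "b t j \<noteq> b t i + complex_of_real r"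
  using assms by (auto simp: room_right_def)

lemma room_right_cong: 
  "(\<And>t. t \<in> {0..1} \<Longrightarrow> b t = c t) \<Longrightarrow> room_right n b i \<epsilon> = room_right n c i \<epsilon>"
  by (auto simp: room_right_def)

text \<open>By compactness of the parameter square the distance of strand \<open>i\<close> from each
  other strand has a positive minimum, so one width suits all stages of the isotopy.\<close>

lemma isotopy_room:
  assumes h: "isotopy n h" and i: "i < n"
  obtains \<epsilon> where "\<epsilon> > 0" "\<And>s. s \<in> {0..1} \<Longrightarrow> room_right n (h s) i \<epsilon>"
proof -
  have "\<exists>m>0. \<forall>s\<in>{0..1}. \<forall>t\<in>{0..1}. m < cmod (h s t j - h s t i)" if j: "j < n" "j \<noteq> i" for j
  proof -
    have hc: "continuous_on ({0..1}\<times>{0..1}) (\<lambda>y. h (fst y) (snd y) k)" for k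
      using h by (auto simp: isotopy_def cfam_def dest: continuous_on_product_then_coordinatewise)
    have c: "continuous_on ({0..1}\<times>{0..1}) (\<lambda>y. cmod (h (fst y) (snd y) j - h (fst y) (snd y) i))"
      by (intro continuous_on_norm continuous_on_diff hc)
    obtain y where y: "y \<in> {0..1}\<times>{0..1}" 
      "\<And>z. z \<in> {0..1}\<times>{0..1} \<Longrightarrow> cmod (h (fst y) (snd y) j - h (fst y) (snd y) i) \<le> cmod (h (fst z) (snd z) j - h (fst z) (snd z) i)"
      using continuous_attains_inf[OF compact_Times[OF compact_Icc compact_Icc] _ c] by (auto simp: less_eq_prod_def)
    have "h (fst y) (snd y) \<in> config_space n" using h y(1) by (auto simp: isotopy_def cfam_def)
    then have "h (fst y) (snd y) j \<noteq> h (fst y) (snd y) i"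
      using i j by (auto simp: config_space_def dest: inj_onD)
    then have "cmod (h (fst y) (snd y) j - h (fst y) (snd y) i) > 0" by simp
    moreover have "cmod (h (fst y) (snd y) j - h (fst y) (snd y) i) \<le> cmod (h s t j - h s t i)"
      if "s \<in> {0..1}" "t \<in> {0..1}" for s t using y(2)[of "(s, t)"] that by simp
    ultimately show ?thesis
      by (intro exI[of _ "cmod (h (fst y) (snd y) j - h (fst y) (snd y) i) / 2"]) (smt (verit) half_gt_zero field_sum_of_halves)
  qed
  then have "\<forall>j\<in>{..<n}-{i}. \<exists>m>0. \<forall>s\<in>{0..1}. \<forall>t\<in>{0..1}. m < cmod (h s t j - h s t i)" by auto
  then obtain m where m: "\<And>j. j \<in> {..<n}-{i} \<Longrightarrow> m j > (0::real)"
    "\<And>j s t. j \<in> {..<n}-{i} \<Longrightarrow> s \<in> {0..1} \<Longrightarrow> t \<in> {0..1} \<Longrightarrow> m j < cmod (h s t j - h s t i)"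
    by metis
  \<comment> \<open>The element 1 keeps the set nonempty when there is only one strand.\<close>
  define \<epsilon> where "\<epsilon> = Min (insert 1 (m ` ({..<n}-{i})))"
  have e: "\<epsilon> > 0" using m(1) by (auto simp: \<epsilon>_def)
  have em: "\<epsilon> \<le> m j" if "j \<in> {..<n}-{i}" for j using that by (auto simp: \<epsilon>_def)
  have "room_right n (h s) i \<epsilon>" if s: "s \<in> {0..1}" for s
    unfolding room_right_def
  proof (intro ballI allI impI notI)
    fix t :: real and j r assume a: "t \<in> {0..1}" "j < n" "j \<noteq> i" "r \<in> {0..\<epsilon>}" 
      "h s t j = h s t i + complex_of_real r"
    then have "cmod (h s t j - h s t i) = r" by simp
    then show False using m(2)[of j s t] em[of j] a s by auto
  qed
  with e that show ?thesis by blast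
qed

lemma braid_room:
  assumes "is_braid n b" "i < n"
  obtains \<epsilon> where "\<epsilon> > 0" "room_right n b i \<epsilon>"
  using isotopy_room[OF isotopy_const[OF assms(1)] assms(2)] by (metis atLeastAtMost_iff order_refl zero_le_one)

text \<open>The width \<open>e\<close> may depend on the stage, so that two admissible widths for
  the same braid can be joined by an isotopy.\<close>

lemma cfam_double:
  assumes h: "cfam n h" and i: "i < n" and e: "continuous_on {0..1} e"
    and room: "\<And>s. s \<in> {0..1} \<Longrightarrow> e s > 0 \<and> room_right n (h s) i (e s)"
  shows "cfam (Suc n) (\<lambda>s. double_strand i (e s) (h s))"
  unfolding cfam_def
proof (intro conjI ballI)
  show "continuous_on ({0..1} \<times> {0..1}) (\<lambda>y. double_strand i (e (fst y)) (h (fst y)) (snd y))"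
  proof (rule continuous_on_coordinatewise_then_product)
    fix k
    have "continuous_on ({0..1} \<times> {0..1}) (\<lambda>y. h (fst y) (snd y) j)" for j
      using h by (auto simp: cfam_def dest: continuous_on_product_then_coordinatewise)
    moreover have "continuous_on ({0..1}\<times>{0..1}) (e \<circ> (fst :: real \<times> real \<Rightarrow> real))"
      using e by (intro continuous_on_compose continuous_intros) (auto elim: continuous_on_subset)
    ultimately show "continuous_on ({0..1} \<times> {0..1}) (\<lambda>y. double_strand i (e (fst y)) (h (fst y)) (snd y) k)"
      unfolding double_strand_eq by (cases "k = Suc i") (auto intro!: continuous_intros simp: o_def)
  qed
  fix s t :: real assume st: "s \<in> {0..1}" "t \<in> {0..1}"
  have conf: "h s t \<in> config_space n" using cfam_config[OF h st] .
  have ne: "h s t j \<noteq> h s t i + complex_of_real (e s)" if "j < n" "j \<noteq> i" for j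
    using room[OF st(1)] room_rightD[of n "h s" i "e s" t j "e s"] that st by auto
  have e0: "e s \<noteq> 0" using room[OF st(1)] by auto
  have neq: "h s t j \<noteq> h s t k" if "j < n" "k < n" "j \<noteq> k" for j k
    using conf that by (auto simp: config_space_def dest: inj_onD)
  show "double_strand i (e s) (h s) t \<in> config_space (Suc n)"
    unfolding config_space_iff
  proof (intro conjI allI impI)
    fix k l assume kl: "k < l" "l < Suc n"
    show "double_strand i (e s) (h s) t k \<noteq> double_strand i (e s) (h s) t l"
    proof (cases "k = i \<and> l = Suc i")
      case True then show ?thesis using e0 by (auto simp: double_strand_eq)
    next
      case False
      define u where "u m = (if m \<le> i then m else m - 1)" for m
      have u: "u k < n" "u l < n" "u k \<noteq> u l" "k = Suc i \<Longrightarrow> u k = i" "l = Suc i \<Longrightarrow> u l = i" 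
        using False kl i by (auto simp: u_def)
      show ?thesis
        unfolding double_strand_eq u_def[symmetric]
        using ne[of "u k"] ne[of "u l"] neq[of "u k" "u l"] u kl
        by (cases "k = Suc i"; cases "l = Suc i") auto
    qed
  next
    fix k assume "Suc n \<le> k"
    then show "double_strand i (e s) (h s) t k = 0"
      using i config_zero[OF conf, of "k - 1"] by (auto simp: double_strand_eq)
  qed
qed

text \<open>For real points an unobstructed horizontal segment is a gap in the order: nothing lies
  between a strand and its copy.\<close>

lemma real_room:
  assumes "room_right n b i \<epsilon>" "t \<in> {0..1}" "j < n" "j \<noteq> i" "i < n" "b t i \<in> \<real>" "b t j \<in> \<real>"
  shows "Re (b t j) < Re (b t i) \<or> Re (b t i) + \<epsilon> < Re (b t j)"
proof (rule ccontr)
  assume "\<not> ?thesis"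
  then have "0 \<le> Re (b t j) - Re (b t i)" "Re (b t j) - Re (b t i) \<le> \<epsilon>" by auto
  moreover have "b t j = b t i + complex_of_real (Re (b t j) - Re (b t i))"
    using assms(6,7) by (metis add_diff_cancel_left' diff_add_cancel of_real_Re of_real_add)
  ultimately show False using room_rightD[OF assms(1-4)] by blast
qed

lemma isotopy_double:
  assumes h: "isotopy n h" and i: "i < n" and e: "continuous_on {0..1} e"
    and room: "\<And>s. s \<in> {0..1} \<Longrightarrow> e s > 0 \<and> room_right n (h s) i (e s)"
  shows "isotopy (Suc n) (\<lambda>s. double_strand i (e s) (h s))"
  unfolding isotopy_def
proof (intro conjI ballI)
  show "cfam (Suc n) (\<lambda>s. double_strand i (e s) (h s))"
    using assms by (intro cfam_double) (auto simp: isotopy_def)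
  fix s :: real assume s: "s \<in> {0..1}"
  have b: "is_braid n (h s)" by (rule isotopy_is_braid[OF h s])
  have lt: "Re (h s 0 i) + e s < Re (h s 0 j)" if "i < j" "j < n" for j
    using real_room[of n "h s" i "e s" 0 j] room[OF s] that i b is_braid_start_mono[OF b that]
    by (auto simp: is_braid_start_real)
  show "ends_on_line (Suc n) (double_strand i (e s) (h s))"
    unfolding ends_on_line_iff
  proof (intro conjI allI impI)
    fix k assume "k < Suc n"
    then show "double_strand i (e s) (h s) 0 k \<in> \<real>" "double_strand i (e s) (h s) 1 k \<in> \<real>"
      using i b by (auto simp: double_strand_eq is_braid_start_real is_braid_finish_real)
  next
    fix k l assume kl: "k < l" "l < Suc n"
    show "Re (double_strand i (e s) (h s) 0 k) < Re (double_strand i (e s) (h s) 0 l)"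
    proof (cases "k = i \<and> l = Suc i")
      case True then show ?thesis using room[OF s] by (auto simp: double_strand_eq)
    next
      case False
      define u where "u m = (if m \<le> i then m else m - 1)" for m
      have u: "u k < n" "u l < n" "u k < u l" "k = Suc i \<Longrightarrow> u k = i" "l = Suc i \<Longrightarrow> u l = i" 
        using False kl i by (auto simp: u_def)
      show ?thesis
        unfolding double_strand_eq u_def[symmetric]
        using lt[of "u l"] is_braid_start_mono[OF b, of "u k" "u l"] room[OF s] u kl
        by (cases "k = Suc i"; cases "l = Suc i") auto
    qed
  qed
qed

lemma double_strand_is_braid:
  assumes "is_braid n b" "i < n" "\<epsilon> > 0" "room_right n b i \<epsilon>"
  shows "is_braid (Suc n) (double_strand i \<epsilon> b)"
  using isotopy_is_braid[OF isotopy_double[OF isotopy_const[OF assms(1)] assms(2), of "\<lambda>s. \<epsilon>"], of 0] assms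
  by auto

text \<open>The two widths are first changed, each on its own braid, to a common width
  \<open>e\<close> that suits the whole isotopy; then the isotopy itself is doubled. Widths between
  two admissible ones are admissible because the larger one is.\<close>

lemma double_strand_isotopic:
  assumes bc: "isotopic n b c" and i: "i < n" and \<epsilon>: "\<epsilon> > 0" "room_right n b i \<epsilon>"
    and \<delta>: "\<delta> > 0" "room_right n c i \<delta>"
  shows "isotopic (Suc n) (double_strand i \<epsilon> b) (double_strand i \<delta> c)"
proof -
  have b: "is_braid n b" and c: "is_braid n c" using isotopic_is_braid[OF bc] by auto
  have width: "isotopic (Suc n) (double_strand i \<alpha> d) (double_strand i \<beta> d)"
    if d: "is_braid n d" and r: "room_right n d i \<alpha>" "\<alpha> > 0" "room_right n d i \<beta>" "\<beta> > 0" for d \<alpha> \<beta>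
  proof (rule isotopicI)
    show "isotopy (Suc n) (\<lambda>s. double_strand i ((1-s) * \<alpha> + s * \<beta>) d)"
    proof (rule isotopy_double[OF isotopy_const[OF d] i])
      fix s :: real assume s: "s \<in> {0..1}"
      have "(1 - s) * \<alpha> + s * \<beta> \<le> max \<alpha> \<beta>" 
        using s by (intro convex_bound_le) auto
      moreover have "room_right n d i (max \<alpha> \<beta>)" using r by (auto simp: max_def)
      moreover have "(1 - s) * \<alpha> + s * \<beta> > 0" 
        using convex_less[of 0 \<alpha> 0 \<beta> s] r s by simp
      ultimately show "0 < (1 - s) * \<alpha> + s * \<beta> \<and> room_right n d i ((1 - s) * \<alpha> + s * \<beta>)"
        using room_right_mono by blast
    qed (intro continuous_intros)
  qed auto
  obtain h where h: "isotopy n h" "\<And>t. t\<in>{0..1} \<Longrightarrow> h 0 t = b t \<and> h 1 t = c t" 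
    using bc isotopic_iff by blast
  obtain e where e: "e > 0" "\<And>s. s \<in> {0..1} \<Longrightarrow> room_right n (h s) i e" using isotopy_room[OF h(1) i] by blast
  have "isotopic (Suc n) (double_strand i e b) (double_strand i e c)"
  proof (rule isotopicI[OF isotopy_double[OF h(1) i, of "\<lambda>s. e"]])
    show "double_strand i e (h 0) t = double_strand i e b t" "double_strand i e (h 1) t = double_strand i e c t"
      if "t \<in> {0..1}" for t
      using h(2)[OF that] by (auto simp: double_strand_def fun_eq_iff)
  qed (use e in auto)
  moreover have "room_right n b i e" "room_right n c i e"
    using e(2)[of 0] e(2)[of 1] h(2) room_right_cong[of "h 0" b n i e] room_right_cong[of "h 1" c n i e] by auto
  ultimately show ?thesis
    using width[OF b \<epsilon>(2,1), of e] width[OF c _ _ \<delta>(2,1), of e] e(1) isotopic_trans by blast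
qed

text \<open>The permutation of a braid after strand \<open>i\<close>, ending at position \<open>p i\<close>, has been doubled.\<close>

definition double_perm :: "nat \<Rightarrow> (nat \<Rightarrow> nat) \<Rightarrow> nat \<Rightarrow> nat" where
  "double_perm i p k =
     (if k = Suc i then Suc (p i)
      else let q = p (if k \<le> i then k else k - 1) in if p i < q then Suc q else q)"

text \<open>An order-preserving map from the values into \<open>{..<m}\<close> must be the rank. To
  find the permutation of a doubled braid it thus suffices to check that the expected one is
  monotone.\<close>

lemma order_rank_unique:
  assumes f: "inj_on f {..<m}" and q: "\<And>k. k < m \<Longrightarrow> q k < m"
    and ord: "\<And>k l. k < m \<Longrightarrow> l < m \<Longrightarrow> f k < f l \<Longrightarrow> q k < (q l :: nat)" and k: "k < m"
  shows "order_rank m f k = q k"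
proof -
  have iff: "f k < f l \<longleftrightarrow> q k < q l" if "k < m" "l < m" for k l
    using ord[OF that] ord[OF that(2,1)] inj_onD[OF f, of k l] that
    by (cases "f k" "f l" rule: linorder_cases) auto
  have inj: "inj_on q {..<m}"
  proof (rule inj_onI)
    fix k l assume "k \<in> {..<m}" "l \<in> {..<m}" "q k = q l"
    then show "k = l" using iff[of k l] iff[of l k] inj_onD[OF f, of k l]
      by (cases "f k" "f l" rule: linorder_cases) auto
  qed
  have "q ` {..<m} \<subseteq> {..<m}" using q by auto
  then have bij: "bij_betw q {..<m} {..<m}" using inj endo_inj_surj[of "{..<m}" q] by (auto simp: bij_betw_def)
  have "order_rank m f k = order_rank m (\<lambda>j. real (q j)) k"
    unfolding order_rank_def using iff k by (auto intro!: arg_cong[of _ _ card])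
  also have "\<dots> = order_rank m real (q k)" by (rule order_rank_reindex[OF bij])
  also have "\<dots> = q k" using q k by (intro order_rank_increasing) auto
  finally show ?thesis .
qed

lemma end_pos_double:
  assumes b: "is_braid n b" and i: "i < n" and \<epsilon>: "\<epsilon> > 0" "room_right n b i \<epsilon>" and k: "k < Suc n"
  shows "end_pos (Suc n) (double_strand i \<epsilon> b) k = double_perm i (end_pos n b) k"
  unfolding end_pos_order_rank[of "Suc n"]
proof (rule order_rank_unique[OF _ _ _ k])
  let ?p = "end_pos n b"
  show "inj_on (\<lambda>j. Re (double_strand i \<epsilon> b 1 j)) {..<Suc n}"
    by (rule end_inj[OF double_strand_is_braid[OF b i \<epsilon>]])
  have pl: "j < n \<Longrightarrow> ?p j < n" for j by (rule end_pos_less)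
  show "double_perm i ?p k < Suc n" if "k < Suc n" for k
    using that i pl[of k] pl[of "k-1"] pl[of i] by (auto simp: double_perm_def Let_def)
  fix k l assume kl: "k < Suc n" "l < Suc n" and 
    lt: "Re (double_strand i \<epsilon> b 1 k) < Re (double_strand i \<epsilon> b 1 l)"
  let ?u = "\<lambda>k. if k \<le> i then k else k - 1"
  have ul: "?u k < n" "?u l < n" using kl i by auto
  \<comment> \<open>No other strand ends between strand \<open>i\<close> and its copy, so every
    other strand compares with both in the same way.\<close>
  have room: "Re (b 1 j) < Re (b 1 i) \<or> Re (b 1 i) + \<epsilon> < Re (b 1 j)" if "j < n" "j \<noteq> i" for j
    using real_room[OF \<epsilon>(2), of 1 j] that i b by (auto simp: is_braid_finish_real)
  note iff = end_pos_less_iff[OF b]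
  consider "k = Suc i" "l = Suc i" | "k = Suc i" "l \<noteq> Suc i" | "k \<noteq> Suc i" "l = Suc i" | "k \<noteq> Suc i" "l \<noteq> Suc i" by blast
  then show "double_perm i ?p k < double_perm i ?p l"
  proof cases
    case 1 then show ?thesis using lt by auto
  next
    case 2
    then have "Re (b 1 i) + \<epsilon> < Re (b 1 (?u l))" using lt by (simp add: double_strand_eq)
    then have "?p i < ?p (?u l)" using iff[of i "?u l"] i ul \<epsilon> by auto
    then show ?thesis using 2 by (auto simp: double_perm_def Let_def)
  next
    case 3
    then have l: "Re (b 1 (?u k)) < Re (b 1 i) + \<epsilon>" using lt by (simp add: double_strand_eq)
    show ?thesis
    proof (cases "?u k = i")
      case True then show ?thesis using 3 by (auto simp: double_perm_def Let_def)
    next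
      case False
      then have "Re (b 1 (?u k)) < Re (b 1 i)" using room[of "?u k"] l ul by auto
      then have "?p (?u k) < ?p i" using iff[of "?u k" i] i ul by auto
      then show ?thesis using 3 by (auto simp: double_perm_def Let_def)
    qed
  next
    case 4
    then have "Re (b 1 (?u k)) < Re (b 1 (?u l))" using lt by (simp add: double_strand_eq)
    then have "?p (?u k) < ?p (?u l)" using iff[of "?u k" "?u l"] ul by auto
    then show ?thesis using 4 by (auto simp: double_perm_def Let_def)
  qed
qed

text \<open>With one common width the doubled product and the product of the doubled factors are the
  same path, not merely isotopic. In the second factor the strand to double is the one that
  continues strand \<open>i\<close>.\<close>

lemma double_comp:
  assumes b: "is_braid n b" and c: "is_braid n c" and m: "matched n b c" and i: "i < n" and \<epsilon>: "\<epsilon> > 0"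
    "room_right n b i \<epsilon>" "room_right n c (end_pos n b i) \<epsilon>"
  shows "room_right n (braid_comp n b c) i \<epsilon>"
    "matched (Suc n) (double_strand i \<epsilon> b) (double_strand (end_pos n b i) \<epsilon> c)"
    "braid_comp (Suc n) (double_strand i \<epsilon> b) (double_strand (end_pos n b i) \<epsilon> c)
       = double_strand i \<epsilon> (braid_comp n b c)"
proof -
  let ?p = "end_pos n b"
  have pb: "bij_betw ?p {..<n} {..<n}" by (rule end_pos_bij[OF b])
  have pne: "?p j \<noteq> ?p i" if "j < n" "j \<noteq> i" for j
    using pb that i by (auto simp: bij_betw_def dest: inj_onD)
  have pl: "j < n \<Longrightarrow> ?p j < n" for j by (rule end_pos_less)
  note e = end_pos_double[OF b i \<epsilon>(1,2)]
  show "room_right n (braid_comp n b c) i \<epsilon>"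
    unfolding room_right_def
  proof (intro ballI allI impI)
    fix t :: real and j r assume a: "t \<in> {0..1}" "j < n" "j \<noteq> i" "r \<in> {0..\<epsilon>}"
    show "braid_comp n b c t j \<noteq> braid_comp n b c t i + complex_of_real r"
      using a i pl pne room_rightD[OF \<epsilon>(2), of "2*t" j r] room_rightD[OF \<epsilon>(3), of "2*t-1" "?p j" r]
      by (auto simp: braid_comp_def joinpaths_def)
  qed
  have D: "double_strand (?p i) \<epsilon> c t (double_perm i ?p k) = 
       c t (?p (if k \<le> i then k else k - 1)) + (if k = Suc i then complex_of_real \<epsilon> else 0)" 
    if "k < Suc n" for t k
    using pne[of k] pne[of "k-1"] i that by (auto simp: double_strand_eq double_perm_def Let_def)
  show "matched (Suc n) (double_strand i \<epsilon> b) (double_strand (?p i) \<epsilon> c)"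
    unfolding matched_def
  proof (intro allI impI)
    fix k assume k: "k < Suc n"
    then have "(if k \<le> i then k else k - 1) < n" using i by auto
    with m have "c 0 (?p (if k \<le> i then k else k - 1)) = b 1 (if k \<le> i then k else k - 1)"
      unfolding matched_def by blast
    then show "double_strand (?p i) \<epsilon> c 0 (end_pos (Suc n) (double_strand i \<epsilon> b) k) = double_strand i \<epsilon> b 1 k"
      unfolding e[OF k] D[OF k] double_strand_eq[of i] by simp
  qed
  show "braid_comp (Suc n) (double_strand i \<epsilon> b) (double_strand (?p i) \<epsilon> c) = double_strand i \<epsilon> (braid_comp n b c)"
  proof (intro ext)
    fix t k
    show "braid_comp (Suc n) (double_strand i \<epsilon> b) (double_strand (?p i) \<epsilon> c) t k = double_strand i \<epsilon> (braid_comp n b c) t k"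
    proof (cases "t \<le> 1/2")
      case True then show ?thesis by (simp add: braid_comp_def joinpaths_def double_strand_eq)
    next
      case False
      show ?thesis
      proof (cases "k < Suc n")
        case True
        have "braid_comp (Suc n) (double_strand i \<epsilon> b) (double_strand (?p i) \<epsilon> c) t k =
          double_strand (?p i) \<epsilon> c (2*t-1) (end_pos (Suc n) (double_strand i \<epsilon> b) k)"
          using False True by (simp add: braid_comp_def joinpaths_def)
        also have "\<dots> = c (2*t-1) (?p (if k \<le> i then k else k - 1)) + (if k = Suc i then complex_of_real \<epsilon> else 0)"
          by (simp add: e[OF True] D[OF True])
        also have "\<dots> = double_strand i \<epsilon> (braid_comp n b c) t k"
          using False True i by (auto simp: braid_comp_def joinpaths_def double_strand_eq)
        finally show ?thesis .
      next
        case k: False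
        then show ?thesis using False i by (auto simp: braid_comp_def joinpaths_def double_strand_eq)
      qed
    qed
  qed
qed

text \<open>The widths are chosen one after the other: \<delta> has room in the braid already
  doubled at \<open>i\<close>, so it avoids the copy of strand \<open>i\<close> too. Strand
  \<open>j\<close> is numbered \<open>Suc j\<close> there.\<close>

lemma double_double_commute:
  assumes b: "is_braid n b" and ij: "i < j" "j < n"
  obtains \<epsilon> \<delta> where "\<epsilon> > 0" "\<delta> > 0" "room_right n b i \<epsilon>" "room_right n b j \<delta>"
    "room_right (Suc n) (double_strand i \<epsilon> b) (Suc j) \<delta>" "room_right (Suc n) (double_strand j \<delta> b) i \<epsilon>"
    "double_strand (Suc j) \<delta> (double_strand i \<epsilon> b) = double_strand i \<epsilon> (double_strand j \<delta> b)"
proof -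
  have i: "i < n" using ij by simp
  obtain \<epsilon> where \<epsilon>: "\<epsilon> > 0" "room_right n b i \<epsilon>" using braid_room[OF b i] by blast
  obtain \<delta> where \<delta>: "\<delta> > 0" "room_right (Suc n) (double_strand i \<epsilon> b) (Suc j) \<delta>"
    using braid_room[OF double_strand_is_braid[OF b i \<epsilon>], of "Suc j"] ij by auto
  have nj: "b t l \<noteq> b t j + complex_of_real r" if "t \<in> {0..1}" "l < n" "l \<noteq> j" "0 \<le> r" "r \<le> \<delta>" for t l r
    using room_rightD[OF \<delta>(2), of t l r] room_rightD[OF \<delta>(2), of t "Suc l" r] that ij 
    by (cases "l \<le> i") (auto simp: double_strand_eq)
  have rj: "room_right n b j \<delta>" using nj by (auto simp: room_right_def)
  have ri: "room_right (Suc n) (double_strand j \<delta> b) i \<epsilon>"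
    unfolding room_right_def
  proof (intro ballI allI impI)
    fix t :: real and k r assume a: "t \<in> {0..1}" "k < Suc n" "k \<noteq> i" "r \<in> {0..\<epsilon>}"
    show "double_strand j \<delta> b t k \<noteq> double_strand j \<delta> b t i + complex_of_real r"
    proof (cases "k = Suc j")
      case True
      \<comment> \<open>If the copy of \<open>j\<close> met the segment right of \<open>i\<close>,
        then, according to the sign of \<open>r - \<delta>\<close>, either \<open>j\<close> would
        lie on the segment of \<open>i\<close> or \<open>i\<close> on the segment of
        \<open>j\<close>.\<close>
      have "b t j + complex_of_real \<delta> \<noteq> b t i + complex_of_real r"
      proof
        assume "b t j + complex_of_real \<delta> = b t i + complex_of_real r"
        then have "b t j = b t i + complex_of_real (r - \<delta>)" "b t i = b t j + complex_of_real (\<delta> - r)"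
          by (auto simp: algebra_simps)
        then show False 
          using room_rightD[OF \<epsilon>(2), of t j "r - \<delta>"] nj[of t i "\<delta> - r"] a ij \<delta>(1) by (cases "\<delta> \<le> r") auto
      qed
      then show ?thesis using True ij by (simp add: double_strand_eq)
    next
      case False
      then show ?thesis 
        using room_rightD[OF \<epsilon>(2), of t k r] room_rightD[OF \<epsilon>(2), of t "k - 1" r] a ij
        by (auto simp: double_strand_eq)
    qed
  qed
  have "double_strand (Suc j) \<delta> (double_strand i \<epsilon> b) = double_strand i \<epsilon> (double_strand j \<delta> b)"
    using ij by (intro ext) (auto simp: double_strand_def)
  with that \<epsilon> \<delta> rj ri show ?thesis by blast
qed

text \<open>Both ways give three parallel strands at offsets 0, \<epsilon>/2 and \<epsilon>: either
  the outer copy comes first and the middle one is inserted, or copies are added twice to the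
  right.\<close>

lemma double_double_same:
  assumes b: "is_braid n b" and i: "i < n"
  obtains \<epsilon> where "\<epsilon> > 0" "room_right n b i \<epsilon>" "room_right n b i (\<epsilon>/2)"
    "room_right (Suc n) (double_strand i \<epsilon> b) i (\<epsilon>/2)" 
    "room_right (Suc n) (double_strand i (\<epsilon>/2) b) (Suc i) (\<epsilon>/2)"
    "double_strand i (\<epsilon>/2) (double_strand i \<epsilon> b) = double_strand (Suc i) (\<epsilon>/2) (double_strand i (\<epsilon>/2) b)"
proof -
  obtain \<epsilon> where \<epsilon>: "\<epsilon> > 0" "room_right n b i \<epsilon>" using braid_room[OF b i] by blast
  have r: "room_right n b i (\<epsilon>/2)" using \<epsilon> by (auto intro: room_right_mono)
  have r1: "room_right (Suc n) (double_strand i \<epsilon> b) i (\<epsilon>/2)"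
    unfolding room_right_def
  proof (intro ballI allI impI)
    fix t :: real and k r assume a: "t \<in> {0..1}" "k < Suc n" "k \<noteq> i" "r \<in> {0..\<epsilon>/2}"
    have "r \<noteq> \<epsilon>" "r \<le> \<epsilon>" using a \<epsilon> by auto
    then show "double_strand i \<epsilon> b t k \<noteq> double_strand i \<epsilon> b t i + complex_of_real r"
      using room_rightD[OF \<epsilon>(2), of t k r] room_rightD[OF \<epsilon>(2), of t "k - 1" r] a i
      by (auto simp: double_strand_eq)
  qed
  have r2: "room_right (Suc n) (double_strand i (\<epsilon>/2) b) (Suc i) (\<epsilon>/2)"
    unfolding room_right_def
  proof (intro ballI allI impI)
    fix t :: real and k r assume a: "t \<in> {0..1}" "k < Suc n" "k \<noteq> Suc i" "r \<in> {0..\<epsilon>/2}"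
    have "r + \<epsilon>/2 \<noteq> 0" "r + \<epsilon>/2 \<le> \<epsilon>" "0 \<le> r + \<epsilon>/2" using a \<epsilon> by auto
    moreover have "b t i \<noteq> b t i + complex_of_real (r + \<epsilon>/2)" using calculation(1) 
      by (metis add_cancel_right_right of_real_eq_0_iff)
    ultimately show "double_strand i (\<epsilon>/2) b t k \<noteq> double_strand i (\<epsilon>/2) b t (Suc i) + complex_of_real r"
      using room_rightD[OF \<epsilon>(2), of t k "r + \<epsilon>/2"] room_rightD[OF \<epsilon>(2), of t "k - 1" "r+\<epsilon>/2"] a i
      by (cases "k = i") (auto simp: double_strand_eq algebra_simps)
  qed
  have "double_strand i (\<epsilon>/2) (double_strand i \<epsilon> b) = double_strand (Suc i) (\<epsilon>/2) (double_strand i (\<epsilon>/2) b)"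
  proof -
    have "complex_of_real (\<epsilon>/2) + complex_of_real (\<epsilon>/2) = complex_of_real \<epsilon>" 
      unfolding of_real_add[symmetric] by simp
    then show ?thesis by (intro ext) (auto simp: double_strand_def add.assoc)
  qed
  with that \<epsilon> r r1 r2 show ?thesis by blast
qed

subsection \<open>Braid classes\<close>

lemma in_braid_class: "c \<in> braid_class n b \<longleftrightarrow> isotopic n b c"
  by (simp add: braid_class_def)

lemma braid_class_eqI: "isotopic n b c \<Longrightarrow> braid_class n b = braid_class n c"
  unfolding braid_class_def using isotopic_trans isotopic_sym by blast

lemma braid_class_self: "is_braid n b \<Longrightarrow> b \<in> braid_class n b"
  by (simp add: in_braid_class isotopic_refl)

lemma braid_class_in_braids: "is_braid n b \<Longrightarrow> braid_class n b \<in> braids n"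
  by (auto simp: braids_def)

lemma braids_member:
  assumes "\<beta> \<in> braids n" "b \<in> \<beta>"
  shows "is_braid n b" "\<beta> = braid_class n b"
proof -
  obtain a where a: "\<beta> = braid_class n a" using assms(1) by (auto simp: braids_def)
  then have "isotopic n a b" using assms(2) by (simp add: in_braid_class)
  then show "is_braid n b" "\<beta> = braid_class n b" using a isotopic_is_braid(2) braid_class_eqI by blast+
qed

lemma braids_cases:
  assumes "\<beta> \<in> braids n"
  obtains b where "is_braid n b" "\<beta> = braid_class n b" "b \<in> \<beta>"
  using assms by (auto simp: braids_def braid_class_self)

lemma braid_mult_class:
  assumes "is_braid n b" "is_braid n c" "matched n b c"
  shows "braid_mult n (braid_class n b) (braid_class n c) = braid_class n (braid_comp n b c)"
proof (rule Set.set_eqI)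
  fix x
  have "x \<in> braid_mult n (braid_class n b) (braid_class n c) \<longleftrightarrow>
    (\<exists>b' c'. isotopic n b b' \<and> isotopic n c c' \<and> matched n b' c' \<and> isotopic n (braid_comp n b' c') x)"
    unfolding braid_mult_def using isotopic_is_braid(2) matched_iff[symmetric] by (simp add: Bex_def in_braid_class)
  also have "\<dots> \<longleftrightarrow> x \<in> braid_class n (braid_comp n b c)"
    unfolding in_braid_class
  proof
    assume "\<exists>b' c'. isotopic n b b' \<and> isotopic n c c' \<and> matched n b' c' \<and> isotopic n (braid_comp n b' c') x"
    then show "isotopic n (braid_comp n b c) x" using braid_comp_isotopic[OF _ _ assms(3)] isotopic_trans by blast
  next
    assume "isotopic n (braid_comp n b c) x"
    then show "\<exists>b' c'. isotopic n b b' \<and> isotopic n c c' \<and> matched n b' c' \<and> isotopic n (braid_comp n b' c') x"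
      using assms isotopic_refl by blast
  qed
  finally show "x \<in> braid_mult n (braid_class n b) (braid_class n c) \<longleftrightarrow> x \<in> braid_class n (braid_comp n b c)" .
qed

lemma braid_match_class:
  assumes "is_braid n b" "\<gamma> \<in> braids n"
  obtains c where "is_braid n c" "\<gamma> = braid_class n c" "matched n b c" "c \<in> \<gamma>"
proof -
  obtain c where c: "is_braid n c" "\<gamma> = braid_class n c" using assms braids_cases by blast
  obtain c' where "isotopic n c c'" "matched n b c'" using braid_match[OF assms(1) c(1)] by blast
  then show ?thesis using that[of c'] c braid_class_eqI isotopic_is_braid(2) by (metis in_braid_class)
qed

text \<open>The chosen representative does not matter for indices below \<open>n\<close>, since
  \<open>end_pos\<close> is an isotopy invariant.\<close>

definition perm :: "nat \<Rightarrow> braid_class \<Rightarrow> nat \<Rightarrow> nat" where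
  "perm n \<beta> = end_pos n (SOME b. b \<in> \<beta>)"

lemma perm_eq:
  assumes "\<beta> \<in> braids n" "b \<in> \<beta>" "i < n"
  shows "perm n \<beta> i = end_pos n b i"
proof -
  have "(SOME b. b \<in> \<beta>) \<in> \<beta>" using someI[of "\<lambda>b. b \<in> \<beta>", OF assms(2)] .
  then have "isotopic n b (SOME b. b \<in> \<beta>)" using braids_member[OF assms(1,2)] by (simp add: in_braid_class)
  then show ?thesis using isotopic_end_pos assms(3) unfolding perm_def by metis
qed

lemma perm_class: "is_braid n b \<Longrightarrow> i < n \<Longrightarrow> perm n (braid_class n b) i = end_pos n b i"
  by (intro perm_eq braid_class_in_braids braid_class_self)

lemma perm_less: "\<beta> \<in> braids n \<Longrightarrow> i < n \<Longrightarrow> perm n \<beta> i < n"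
  by (simp add: perm_def end_pos_less)

lemma perm_bij:
  assumes "\<beta> \<in> braids n" shows "bij_betw (perm n \<beta>) {..<n} {..<n}"
proof -
  obtain b where b: "is_braid n b" "\<beta> = braid_class n b" using assms braids_cases by blast
  show ?thesis using end_pos_bij[OF b(1)] perm_class[OF b(1)] b(2)
    by (metis (no_types, lifting) bij_betw_cong lessThan_iff)
qed

section \<open>The braid group as a group of classes\<close>

definition one_braid :: "nat \<Rightarrow> braid_class" where "one_braid n = braid_class n (trivial_braid n)"

lemma trivial_braid_is_braid: "is_braid n (trivial_braid n)"
  unfolding trivial_braid_const by (rule const_braid_is_braid) auto

lemma one_braid_in_braids: "one_braid n \<in> braids n"
  by (simp add: one_braid_def braid_class_in_braids trivial_braid_is_braid)

lemma one_braid_const: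
  "(\<And>i j. i < j \<Longrightarrow> j < n \<Longrightarrow> a i < a j) \<Longrightarrow> braid_class n (const_braid n a) = one_braid n"
  unfolding one_braid_def trivial_braid_const by (intro braid_class_eqI const_braid_isotopic) auto

lemma perm_one_braid: "i < n \<Longrightarrow> perm n (one_braid n) i = i"
  by (simp add: one_braid_def perm_class trivial_braid_is_braid) (simp add: trivial_braid_const end_pos_const)

lemma braid_mult_closed: "\<beta> \<in> braids n \<Longrightarrow> \<gamma> \<in> braids n \<Longrightarrow> braid_mult n \<beta> \<gamma> \<in> braids n"
  by (metis braid_class_in_braids braid_comp_is_braid braid_match_class braid_mult_class braids_cases)

lemma braid_mult_assoc:
  assumes "\<beta> \<in> braids n" "\<gamma> \<in> braids n" "\<delta> \<in> braids n"
  shows "braid_mult n (braid_mult n \<beta> \<gamma>) \<delta> = braid_mult n \<beta> (braid_mult n \<gamma> \<delta>)"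
proof -
  obtain b where b: "is_braid n b" "\<beta> = braid_class n b" using assms braids_cases by blast
  obtain c where c: "is_braid n c" "\<gamma> = braid_class n c" "matched n b c" 
    using braid_match_class[OF b(1) assms(2)] by blast
  obtain d where d: "is_braid n d" "\<delta> = braid_class n d" "matched n c d" 
    using braid_match_class[OF c(1) assms(3)] by blast
  note a = braid_comp_assoc[OF b(1) c(1) d(1) c(3) d(3)]
  show ?thesis
    using b c d a by (simp add: braid_mult_class braid_comp_is_braid braid_class_eqI)
qed

lemma braid_mult_one_left:
  assumes "\<beta> \<in> braids n" shows "braid_mult n (one_braid n) \<beta> = \<beta>"
proof -
  obtain b where b: "is_braid n b" "\<beta> = braid_class n b" using assms braids_cases by blast
  have inc: "\<And>i j. i < j \<Longrightarrow> j < n \<Longrightarrow> Re (b 0 i) < Re (b 0 j)" using is_braid_start_mono[OF b(1)] .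
  show ?thesis
    using braid_mult_class[OF const_braid_is_braid[OF inc] b(1) braid_comp_const_left(1)[OF b(1)]]
      one_braid_const[OF inc] b braid_class_eqI[OF braid_comp_const_left(2)[OF b(1)]] by simp
qed

lemma braid_mult_inverse_left:
  assumes "\<beta> \<in> braids n" shows "\<exists>\<gamma>\<in>braids n. braid_mult n \<gamma> \<beta> = one_braid n"
proof -
  obtain b where b: "is_braid n b" "\<beta> = braid_class n b" using assms braids_cases by blast
  obtain c where "is_braid n c" "matched n c b" "isotopic n (braid_comp n c b) (trivial_braid n)"
    using braid_inverse[OF b(1)] by blast
  then show ?thesis using b braid_class_in_braids
    by (intro bexI[of _ "braid_class n c"]) (simp_all add: braid_mult_class one_braid_def braid_class_eqI)
qed

lemma braid_group: "group \<lparr>carrier = braids n, mult = braid_mult n, one = one_braid n\<rparr>"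
  by (rule groupI) (auto simp: braid_mult_closed one_braid_in_braids braid_mult_assoc 
      braid_mult_one_left braid_mult_inverse_left)

lemma braid_mult_one_right: "\<beta> \<in> braids n \<Longrightarrow> braid_mult n \<beta> (one_braid n) = \<beta>"
  using monoid.r_one[OF group.is_monoid[OF braid_group[of n]]] by simp

lemma perm_mult:
  assumes "\<beta> \<in> braids n" "\<gamma> \<in> braids n" "i < n"
  shows "perm n (braid_mult n \<beta> \<gamma>) i = perm n \<gamma> (perm n \<beta> i)"
proof -
  obtain b where b: "is_braid n b" "\<beta> = braid_class n b" using assms braids_cases by blast
  obtain c where c: "is_braid n c" "\<gamma> = braid_class n c" "matched n b c" 
    using braid_match_class[OF b(1) assms(2)] by blast
  show ?thesis using b c assms(3)
    by (simp add: braid_mult_class perm_class braid_comp_is_braid end_pos_comp end_pos_less)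
qed

text \<open>Collects all representatives and all widths, so that no choice enters;
  \<open>cable_eq\<close> shows that any single choice gives the whole class.\<close>

definition cable :: "nat \<Rightarrow> nat \<Rightarrow> braid_class \<Rightarrow> braid_class" where
  "cable n i \<beta> = {x. \<exists>b\<in>\<beta>. \<exists>\<epsilon>>0. room_right n b i \<epsilon> \<and> isotopic (Suc n) (double_strand i \<epsilon> b) x}"

lemma cable_eq:
  assumes "\<beta> \<in> braids n" "b \<in> \<beta>" "i < n" "\<epsilon> > 0" "room_right n b i \<epsilon>"
  shows "cable n i \<beta> = braid_class (Suc n) (double_strand i \<epsilon> b)"
proof (intro Set.set_eqI iffI)
  fix x assume "x \<in> cable n i \<beta>"
  then obtain c \<delta> where "c \<in> \<beta>" "\<delta> > 0" "room_right n c i \<delta>" "isotopic (Suc n) (double_strand i \<delta> c) x"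
    by (auto simp: cable_def)
  moreover then have "isotopic n b c" using braids_member[OF assms(1,2)] by (simp add: in_braid_class)
  ultimately show "x \<in> braid_class (Suc n) (double_strand i \<epsilon> b)"
    using double_strand_isotopic[of n b c i \<epsilon> \<delta>] assms isotopic_trans unfolding in_braid_class by blast
next
  fix x assume "x \<in> braid_class (Suc n) (double_strand i \<epsilon> b)"
  then show "x \<in> cable n i \<beta>" using assms by (auto simp: cable_def in_braid_class)
qed

lemma cable_class:
  assumes "is_braid n b" "i < n" "\<epsilon> > 0" "room_right n b i \<epsilon>"
  shows "cable n i (braid_class n b) = braid_class (Suc n) (double_strand i \<epsilon> b)"
  using assms by (intro cable_eq braid_class_in_braids braid_class_self)

lemma cable_in_braids:
  assumes "\<beta> \<in> braids n" "i < n" shows "cable n i \<beta> \<in> braids (Suc n)"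
proof -
  obtain b where b: "is_braid n b" "\<beta> = braid_class n b" using assms braids_cases by blast
  obtain \<epsilon> where "\<epsilon> > 0" "room_right n b i \<epsilon>" using braid_room[OF b(1) assms(2)] by blast
  then show ?thesis using b assms by (simp add: cable_class braid_class_in_braids double_strand_is_braid)
qed

lemma perm_cable:
  assumes "\<beta> \<in> braids n" "i < n" "k < Suc n"
  shows "perm (Suc n) (cable n i \<beta>) k = double_perm i (perm n \<beta>) k"
proof -
  obtain b where b: "is_braid n b" "\<beta> = braid_class n b" using assms braids_cases by blast
  obtain \<epsilon> where e: "\<epsilon> > 0" "room_right n b i \<epsilon>" using braid_room[OF b(1) assms(2)] by blast
  have "double_perm i (end_pos n b) k = double_perm i (perm n \<beta>) k"
    using perm_class[OF b(1)] b(2) assms by (auto simp: double_perm_def Let_def)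
  then show ?thesis using b e assms
    by (simp add: cable_class perm_class double_strand_is_braid end_pos_double)
qed

text \<open>Multiplicative only in a twisted sense: the second factor is doubled at the place where
  strand \<open>i\<close> of the first one arrives.\<close>

lemma cable_mult:
  assumes "\<beta> \<in> braids n" "\<gamma> \<in> braids n" "i < n"
  shows "cable n i (braid_mult n \<beta> \<gamma>) = braid_mult (Suc n) (cable n i \<beta>) (cable n (perm n \<beta> i) \<gamma>)"
proof -
  obtain b where b: "is_braid n b" "\<beta> = braid_class n b" using assms braids_cases by blast
  obtain c where c: "is_braid n c" "\<gamma> = braid_class n c" "matched n b c" 
    using braid_match_class[OF b(1) assms(2)] by blast
  let ?j = "end_pos n b i"
  have j: "?j < n" "perm n \<beta> i = ?j" using assms b by (auto simp: perm_class end_pos_less)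
  obtain \<epsilon>1 where e1: "\<epsilon>1 > 0" "room_right n b i \<epsilon>1" using braid_room[OF b(1) assms(3)] by blast
  obtain \<epsilon>2 where e2: "\<epsilon>2 > 0" "room_right n c ?j \<epsilon>2" using braid_room[OF c(1) j(1)] by blast
  define \<epsilon> where "\<epsilon> = min \<epsilon>1 \<epsilon>2"
  have e: "\<epsilon> > 0" "room_right n b i \<epsilon>" "room_right n c ?j \<epsilon>"
    using e1 e2 by (auto simp: \<epsilon>_def intro: room_right_mono)
  note d = double_comp[OF b(1) c(1) c(3) assms(3) e]
  show ?thesis using b c j e d assms(3)
    by (simp add: braid_mult_class cable_class braid_comp_is_braid double_strand_is_braid)
qed

lemma cable_one:
  assumes "i < n" shows "cable n i (one_braid n) = one_braid (Suc n)"
proof -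
  \<comment> \<open>Strands stand at the integers, so width 1/2 is free; \<open>a\<close> lists the
    positions after doubling.\<close>
  define a where "a k = (if k \<le> i then real k else if k = Suc i then real i + 1/2 else real k - 1)" for k
  have r: "room_right n (trivial_braid n) i (1/2)"
    unfolding room_right_def
  proof (intro ballI allI impI notI)
    fix t :: real and j r assume a: "t \<in> {0..1}" "j < n" "j \<noteq> i" "r \<in> {0..1/2}" 
      "trivial_braid n t j = trivial_braid n t i + complex_of_real r"
    then have "complex_of_real (real j) = complex_of_real (real i + r)" using assms by (simp add: trivial_braid_def)
    then have "real j = real i + r" using of_real_eq_iff by blast
    then show False using a by auto
  qed
  have "double_strand i (1/2) (trivial_braid n) = const_braid (Suc n) a"
    using assms by (intro ext) (auto simp: double_strand_def trivial_braid_def const_braid_def a_def)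
  moreover have "a k < a l" if "k < l" "l < Suc n" for k l using that by (auto simp: a_def)
  ultimately show ?thesis
    using cable_class[OF trivial_braid_is_braid assms _ r] one_braid_const[of "Suc n" a]
    by (simp add: one_braid_def)
qed

lemma cable_commute:
  assumes "\<beta> \<in> braids n" "i < j" "j < n"
  shows "cable (Suc n) (Suc j) (cable n i \<beta>) = cable (Suc n) i (cable n j \<beta>)"
proof -
  obtain b where b: "is_braid n b" "\<beta> = braid_class n b" using assms braids_cases by blast
  show ?thesis
    by (rule double_double_commute[OF b(1) assms(2,3)])
       (use b assms in \<open>simp add: cable_class double_strand_is_braid\<close>)
qed

text \<open>The braid does not see which of the two copies is doubled next; only the trees of a
  diagram record it. This is what makes \<open>zel_intertwine\<close> work.\<close>

lemma cable_same:
  assumes "\<beta> \<in> braids n" "i < n"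
  shows "cable (Suc n) i (cable n i \<beta>) = cable (Suc n) (Suc i) (cable n i \<beta>)"
proof -
  obtain b where b: "is_braid n b" "\<beta> = braid_class n b" using assms braids_cases by blast
  obtain \<epsilon> where e: "\<epsilon> > 0" "room_right n b i \<epsilon>" "room_right n b i (\<epsilon>/2)"
    "room_right (Suc n) (double_strand i \<epsilon> b) i (\<epsilon>/2)" 
    "room_right (Suc n) (double_strand i (\<epsilon>/2) b) (Suc i) (\<epsilon>/2)"
    "double_strand i (\<epsilon>/2) (double_strand i \<epsilon> b) = double_strand (Suc i) (\<epsilon>/2) (double_strand i (\<epsilon>/2) b)"
    by (rule double_double_same[OF b(1) assms(2)])
  have h: "\<epsilon> / 2 > 0" using e by simp
  have "cable (Suc n) i (cable n i \<beta>) = braid_class (Suc (Suc n)) (double_strand i (\<epsilon>/2) (double_strand i \<epsilon> b))"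
    unfolding b(2) cable_class[OF b(1) assms(2) e(1,2)]
    by (rule cable_class[OF double_strand_is_braid[OF b(1) assms(2) e(1,2)] _ h e(4)]) (use assms in simp)
  moreover have "cable (Suc n) (Suc i) (cable n i \<beta>) = 
      braid_class (Suc (Suc n)) (double_strand (Suc i) (\<epsilon>/2) (double_strand i (\<epsilon>/2) b))"
    unfolding b(2) cable_class[OF b(1) assms(2) h e(3)]
    by (rule cable_class[OF double_strand_is_braid[OF b(1) assms(2) h e(3)] _ h e(5)]) (use assms in simp)
  ultimately show ?thesis using e(6) by simp
qed

text \<open>Removes the representative and the width from \<open>splitting\<close>: a splitting is
  determined by the diagram and the number of the strand.\<close>

lemma splitting_iff:
  "(D, E) \<in> splitting \<longleftrightarrow> (\<exists>T \<beta> U i. D = (T, \<beta>, U) \<and> D \<in> diagrams \<and> i < leaves T \<and>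
     E = (add_caret i T, cable (leaves T) i \<beta>, add_caret (perm (leaves T) \<beta> i) U))"
proof
  assume "(D, E) \<in> splitting"
  moreover obtain T \<beta> U T' \<beta>' U' where DE: "D = (T, \<beta>, U)" "E = (T', \<beta>', U')"
    by (cases D; cases E) auto
  ultimately obtain b i \<epsilon> where 1: "T' = add_caret i T" "\<beta>' = braid_class (Suc (leaves T)) (double_strand i \<epsilon> b)"
    "U' = add_caret (end_pos (leaves T) b i) U"
    "(T, \<beta>, U) \<in> diagrams" "b \<in> \<beta>" "i < leaves T" "0 < \<epsilon>" "room_right (leaves T) b i \<epsilon>"
    by (auto simp: splitting.simps)
  then have "\<beta> \<in> braids (leaves T)" by (auto simp: diagrams_def)
  with 1 show "\<exists>T \<beta> U i. D = (T, \<beta>, U) \<and> D \<in> diagrams \<and> i < leaves T \<and>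
     E = (add_caret i T, cable (leaves T) i \<beta>, add_caret (perm (leaves T) \<beta> i) U)" 
    using DE cable_eq[of \<beta> "leaves T" b i \<epsilon>] perm_eq[of \<beta> "leaves T" b i] by auto
next
  assume "\<exists>T \<beta> U i. D = (T, \<beta>, U) \<and> D \<in> diagrams \<and> i < leaves T \<and>
     E = (add_caret i T, cable (leaves T) i \<beta>, add_caret (perm (leaves T) \<beta> i) U)"
  then obtain T \<beta> U i where D: "D = (T, \<beta>, U)" "D \<in> diagrams" "i < leaves T"
     "E = (add_caret i T, cable (leaves T) i \<beta>, add_caret (perm (leaves T) \<beta> i) U)" by blast
  then have br: "\<beta> \<in> braids (leaves T)" by (auto simp: diagrams_def)
  then obtain b where b: "is_braid (leaves T) b" "b \<in> \<beta>" using braids_cases by blast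
  obtain \<epsilon> where e: "\<epsilon> > 0" "room_right (leaves T) b i \<epsilon>" using braid_room[OF b(1) D(3)] by blast
  show "(D, E) \<in> splitting"
    using splitting.intros[of T \<beta> U b i \<epsilon>] D b e cable_eq[OF br b(2) D(3) e] perm_eq[OF br b(2) D(3)] by simp
qed

section \<open>Trees\<close>

fun addrs :: "btree \<Rightarrow> bool list list" where
  "addrs Leaf = [[]]"
| "addrs (Caret l r) = map ((#) False) (addrs l) @ map ((#) True) (addrs r)"

text \<open>Trees are handled through the set of addresses of their interior vertices. By
  \<open>nodes_eqD\<close> it determines the tree, so identities between trees become identities
  between sets.\<close>

fun nodes :: "btree \<Rightarrow> bool list set" where
  "nodes Leaf = {}"
| "nodes (Caret l r) = insert [] ((#) False ` nodes l \<union> (#) True ` nodes r)"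

fun tree_join :: "btree \<Rightarrow> btree \<Rightarrow> btree" where
  "tree_join Leaf T = T"
| "tree_join (Caret a b) Leaf = Caret a b"
| "tree_join (Caret a b) (Caret c d) = Caret (tree_join a c) (tree_join b d)"

lemma leaves_simps [simp]: "leaves Leaf = 1" "leaves (Caret l r) = leaves l + leaves r"
  by (auto simp: leaves_def)

lemma leaves_pos [simp]: "leaves T > 0" by (simp add: leaves_def)

lemma length_addrs [simp]: "length (addrs T) = leaves T"
  by (induction T) auto

lemma leaves_add_caret [simp]: "i < leaves T \<Longrightarrow> leaves (add_caret i T) = Suc (leaves T)"
  by (induction i T rule: add_caret.induct) auto

lemma carets_eq_iff: "carets T = carets U \<longleftrightarrow> leaves T = leaves U"
  by (simp add: leaves_def)

lemma nodes_tree_join: "nodes (tree_join S T) = nodes S \<union> nodes T"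
  by (induction S T rule: tree_join.induct) (auto simp: image_Un)

lemma nodes_eqD: "nodes S = nodes T \<Longrightarrow> S = T"
proof (induction S arbitrary: T)
  case Leaf then show ?case by (cases T) auto
next
  case (Caret l r)
  then obtain l' r' where T: "T = Caret l' r'" by (cases T) auto
  have *: "x \<in> nodes l \<longleftrightarrow> x \<in> nodes l'" "x \<in> nodes r \<longleftrightarrow> x \<in> nodes r'" for x
  proof -
    have "False # x \<in> nodes (Caret l r) \<longleftrightarrow> False # x \<in> nodes (Caret l' r')" 
      "True # x \<in> nodes (Caret l r) \<longleftrightarrow> True # x \<in> nodes (Caret l' r')" using Caret.prems T by auto
    then show "x \<in> nodes l \<longleftrightarrow> x \<in> nodes l'" "x \<in> nodes r \<longleftrightarrow> x \<in> nodes r'" by auto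
  qed
  show ?case using Caret.IH *  T by (metis subset_antisym subsetI)
qed

lemma finite_nodes [simp]: "finite (nodes T)" by (induction T) auto

lemma addrs_add_caret:
  "i < leaves T \<Longrightarrow> addrs (add_caret i T) = take i (addrs T) @ 
     [addrs T ! i @ [False], addrs T ! i @ [True]] @ drop (Suc i) (addrs T)"
proof (induction i T rule: add_caret.induct)
  case (2 i l r)
  show ?case
  proof (cases "i < leaves l")
    case True
    then show ?thesis using 2 by (simp add: nth_append take_map drop_map)
  next
    case False
    then have "i - leaves l < leaves r" using 2(3) by auto
    then show ?thesis using 2(2) False by (simp add: nth_append take_map drop_map Suc_diff_le)
  qed
qed auto

lemma nth_addrs_add_caret:
  assumes "i < leaves T" "k < Suc (leaves T)"
  shows "addrs (add_caret i T) ! k = 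
    (if k < i then addrs T ! k else if k = i then addrs T ! i @ [False] 
     else if k = Suc i then addrs T ! i @ [True] else addrs T ! (k - 1))"
proof -
  have "k - i = Suc (Suc (k - i - 2))" if "Suc i < k" using that by auto
  moreover have "Suc (i + (k - i - 2)) = k - 1" if "Suc i < k" using that by auto
  ultimately show ?thesis using assms
    unfolding addrs_add_caret[OF assms(1)]
    by (auto simp: nth_append nth_Cons split: nat.splits)
qed

lemma nodes_add_caret: "i < leaves T \<Longrightarrow> nodes (add_caret i T) = insert (addrs T ! i) (nodes T)"
proof (induction i T rule: add_caret.induct)
  case (2 i l r)
  then show ?case by (cases "i < leaves l") (auto simp: nth_append)
qed auto

lemma leaf_iff: "a \<in> set (addrs T) \<longleftrightarrow> a \<notin> nodes T \<and> (a = [] \<or> butlast a \<in> nodes T)"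
proof (induction T arbitrary: a)
  case (Caret l r)
  show ?case
  proof (cases a)
    case (Cons x a')
    have e: "(a' = [] \<longrightarrow> butlast a = []) \<and> (a' \<noteq> [] \<longrightarrow> butlast a = x # butlast a')" using Cons by auto
    show ?thesis using Caret.IH[of a'] e Cons by (cases x; cases "a' = []") (auto simp: image_iff)
  qed auto
qed auto

lemma distinct_addrs: "distinct (addrs T)"
  by (induction T) (auto simp: distinct_map inj_on_def)

lemma addrs_cover: "a \<in> nodes T \<or> (\<exists>l\<in>set (addrs T). \<exists>y. a = l @ y)"
proof (induction T arbitrary: a)
  case (Caret l r)
  show ?case
  proof (cases a)
    case (Cons x a')
    show ?thesis
    proof (cases x)
      case True
      consider "a' \<in> nodes r" | m y where "m \<in> set (addrs r)" "a' = m @ y" using Caret.IH(2) by blast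
      then show ?thesis
      proof cases
        case 2
        then have "True # m \<in> set (addrs (Caret l r))" "a = (True # m) @ y" using Cons True by auto
        then show ?thesis by blast
      qed (use Cons True in simp)
    next
      case False
      consider "a' \<in> nodes l" | m y where "m \<in> set (addrs l)" "a' = m @ y" using Caret.IH(1) by blast
      then show ?thesis
      proof cases
        case 2
        then have "False # m \<in> set (addrs (Caret l r))" "a = (False # m) @ y" using Cons False by auto
        then show ?thesis by blast
      qed (use Cons False in simp)
    qed
  qed auto
qed auto

lemma nth_addrs_not_node: "i < leaves T \<Longrightarrow> addrs T ! i \<notin> nodes T"
  using leaf_iff[of "addrs T ! i" T] by (metis length_addrs nth_mem)

lemma nth_addrs_eq_iff: "i < leaves T \<Longrightarrow> j < leaves T \<Longrightarrow> addrs T ! i = addrs T ! j \<longleftrightarrow> i = j"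
  using nth_eq_iff_index_eq[OF distinct_addrs[of T]] by simp

lemma leafE:
  assumes "a \<in> set (addrs T)" obtains i where "i < leaves T" "addrs T ! i = a"
  using assms by (metis in_set_conv_nth length_addrs)

text \<open>Supplies the place where a smaller tree can grow towards a larger one: as long as the
  trees differ, some leaf of the smaller is interior in the larger.\<close>

lemma nodes_psubsetE:
  assumes "nodes S \<subseteq> nodes T" "S \<noteq> T"
  obtains i where "i < leaves S" "addrs S ! i \<in> nodes T"
proof -
  have "\<exists>i<leaves S. addrs S ! i \<in> nodes T"
    using assms
  proof (induction S arbitrary: T)
    case Leaf then show ?case by (cases T) auto
  next
    case (Caret l r)
    then obtain l' r' where T: "T = Caret l' r'" by (cases T) auto
    have sub: "nodes l \<subseteq> nodes l'" "nodes r \<subseteq> nodes r'" using Caret.prems(1) T by auto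
    show ?case
    proof (cases "l = l'")
      case False
      then obtain i where "i < leaves l" "addrs l ! i \<in> nodes l'" using Caret.IH(1) sub by blast
      then show ?thesis using T by (intro exI[of _ i]) (auto simp: nth_append)
    next
      case True
      then have "r \<noteq> r'" using T Caret.prems by auto
      then obtain i where "i < leaves r" "addrs r ! i \<in> nodes r'" using Caret.IH(2) sub by blast
      then show ?thesis using T by (intro exI[of _ "leaves l + i"]) (auto simp: nth_append)
    qed
  qed
  with that show ?thesis by blast
qed

text \<open>Both sides insert the same two addresses into \<open>nodes T\<close>;
  \<open>Suc j\<close> appears because the caret at \<open>i < j\<close> adds a leaf to the left of
  leaf \<open>j\<close>.\<close>

lemma add_caret_commute:
  assumes "i < j" "j < leaves T"
  shows "add_caret (Suc j) (add_caret i T) = add_caret i (add_caret j T)"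
proof (rule nodes_eqD)
  have "addrs (add_caret i T) ! Suc j = addrs T ! j" "addrs (add_caret j T) ! i = addrs T ! i"
    using assms by (auto simp: nth_addrs_add_caret)
  then show "nodes (add_caret (Suc j) (add_caret i T)) = nodes (add_caret i (add_caret j T))"
    using assms by (auto simp: nodes_add_caret)
qed

section \<open>Expansions of diagrams\<close>

fun split_at :: "diagram \<Rightarrow> nat \<Rightarrow> diagram" where
  "split_at (T, \<beta>, U) i = (add_caret i T, cable (leaves T) i \<beta>, add_caret (perm (leaves T) \<beta> i) U)"

declare split_at.simps [simp del]

fun dom_tree :: "diagram \<Rightarrow> btree" where "dom_tree (T, \<beta>, U) = T"
fun ran_tree :: "diagram \<Rightarrow> btree" where "ran_tree (T, \<beta>, U) = U"
fun dbraid :: "diagram \<Rightarrow> braid_class" where "dbraid (T, \<beta>, U) = \<beta>"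

abbreviation expansion :: "(diagram \<times> diagram) set" where "expansion \<equiv> splitting\<^sup>*"

lemma diagrams_iff: "(T, \<beta>, U) \<in> diagrams \<longleftrightarrow> leaves T = leaves U \<and> \<beta> \<in> braids (leaves T)"
  by (auto simp: diagrams_def carets_eq_iff)

lemma splitting_split_at:
  "(D, E) \<in> splitting \<longleftrightarrow> D \<in> diagrams \<and> (\<exists>i<leaves (dom_tree D). E = split_at D i)"
  by (cases D) (auto simp: splitting_iff split_at.simps)

lemma split_at_diagrams: "D \<in> diagrams \<Longrightarrow> i < leaves (dom_tree D) \<Longrightarrow> split_at D i \<in> diagrams"
  by (cases D) (auto simp: diagrams_iff perm_less cable_in_braids split_at.simps)

text \<open>The local diamond for splittings. On the range side the two strands may arrive in either
  order, hence the case distinction on \<open>?p\<close>.\<close>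

lemma split_at_commute:
  assumes "D \<in> diagrams" "i < j" "j < leaves (dom_tree D)"
  shows "split_at (split_at D i) (Suc j) = split_at (split_at D j) i"
proof -
  obtain T \<beta> U where D: "D = (T, \<beta>, U)" by (cases D)
  let ?n = "leaves T" let ?p = "perm ?n \<beta>"
  have br: "\<beta> \<in> braids ?n" "leaves U = ?n" and ij: "i < ?n" "j < ?n" using assms D by (auto simp: diagrams_iff)
  have p: "?p i < ?n" "?p j < ?n" "?p i \<noteq> ?p j" 
    using perm_less[OF br(1)] perm_bij[OF br(1)] assms ij by (auto simp: bij_betw_def dest: inj_onD)
  have "add_caret (double_perm i ?p (Suc j)) (add_caret (?p i) U) = add_caret (double_perm j ?p i) (add_caret (?p j) U)"
    using add_caret_commute[of "?p i" "?p j" U] add_caret_commute[of "?p j" "?p i" U] p br assms(2)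
    by (cases "?p i < ?p j") (auto simp: double_perm_def Let_def)
  then show ?thesis
    using assms ij br by (simp add: D add_caret_commute cable_commute perm_cable split_at.simps)
qed

text \<open>\<open>side\<close> and \<open>tip\<close> treat the two trees of a diagram uniformly.\<close>

definition side :: "bool \<Rightarrow> diagram \<Rightarrow> btree" where
  "side s D = (if s then dom_tree D else ran_tree D)"

definition tip :: "bool \<Rightarrow> diagram \<Rightarrow> nat \<Rightarrow> bool list" where
  "tip s D i = (if s then addrs (dom_tree D) ! i 
                else addrs (ran_tree D) ! perm (leaves (dom_tree D)) (dbraid D) i)"

lemma nodes_side_split:
  assumes "D \<in> diagrams" "i < leaves (dom_tree D)"
  shows "nodes (side s (split_at D i)) = insert (tip s D i) (nodes (side s D))" "tip s D i \<notin> nodes (side s D)"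
proof -
  obtain T \<beta> U where D: "D = (T, \<beta>, U)" by (cases D)
  have "perm (leaves T) \<beta> i < leaves U" using assms D perm_less by (auto simp: diagrams_iff)
  then show "nodes (side s (split_at D i)) = insert (tip s D i) (nodes (side s D))" "tip s D i \<notin> nodes (side s D)"
    using assms D by (auto simp: side_def tip_def nodes_add_caret nth_addrs_not_node split_at.simps)
qed

lemma tip_exists:
  assumes "D \<in> diagrams" "nodes (side s D) \<subseteq> nodes T'" "side s D \<noteq> T'"
  obtains i where "i < leaves (dom_tree D)" "tip s D i \<in> nodes T'"
proof -
  obtain T \<beta> U where D: "D = (T, \<beta>, U)" by (cases D)
  obtain j where j: "j < leaves (side s D)" "addrs (side s D) ! j \<in> nodes T'"
    using nodes_psubsetE assms by blast
  show ?thesis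
  proof (cases s)
    case True then show ?thesis using j that[of j] D by (auto simp: side_def tip_def)
  next
    case False
    have "\<beta> \<in> braids (leaves T)" "leaves U = leaves T" using assms D by (auto simp: diagrams_iff)
    then have "j \<in> perm (leaves T) \<beta> ` {..<leaves T}" using perm_bij[of \<beta> "leaves T"] j False D
      by (auto simp: bij_betw_def side_def)
    then obtain i where "i < leaves T" "perm (leaves T) \<beta> i = j" by auto
    then show ?thesis using j that[of i] D False by (auto simp: side_def tip_def)
  qed
qed

lemma tip_split_neq:
  assumes "D \<in> diagrams" "i < j" "j < leaves (dom_tree D)"
  shows "tip s (split_at D i) (Suc j) = tip s D j"
proof -
  obtain T \<beta> U where D: "D = (T, \<beta>, U)" by (cases D)
  let ?n = "leaves T" let ?p = "perm ?n \<beta>"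
  have br: "\<beta> \<in> braids ?n" "leaves U = ?n" and ij: "i < ?n" "j < ?n" using assms D by (auto simp: diagrams_iff)
  have p: "?p i < ?n" "?p j < ?n" "?p i \<noteq> ?p j" 
    using perm_less[OF br(1)] perm_bij[OF br(1)] assms ij by (auto simp: bij_betw_def dest: inj_onD)
  show ?thesis using assms ij br p
    by (auto simp: tip_def D nth_addrs_add_caret perm_cable double_perm_def Let_def split_at.simps)
qed

section \<open>Existence, uniqueness and confluence of expansions\<close>

lemma expansion_diagrams: "(D, E) \<in> expansion \<Longrightarrow> D \<in> diagrams \<Longrightarrow> E \<in> diagrams"
proof (induction rule: rtrancl_induct)
  case (step y z)
  then obtain i where "y \<in> diagrams" "i < leaves (dom_tree y)" "z = split_at y i"
    using splitting_split_at[of y z] by auto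
  then show ?case using split_at_diagrams[of y i] by simp
qed

lemma expansion_split_at: "D \<in> diagrams \<Longrightarrow> i < leaves (dom_tree D) \<Longrightarrow> (D, split_at D i) \<in> expansion"
  by (rule r_into_rtrancl) (simp only: splitting_split_at, intro conjI exI[of _ i], simp_all)

lemma expansion_nodes:
  "(D, E) \<in> expansion \<Longrightarrow> D \<in> diagrams \<Longrightarrow> nodes (side s D) \<subseteq> nodes (side s E)"
proof (induction rule: rtrancl_induct)
  case (step y z)
  then show ?case using nodes_side_split[of y _ s] by (auto simp: splitting_split_at)
qed auto

text \<open>Each splitting adds an interior vertex to both trees, so a nontrivial expansion changes
  each of them.\<close>

lemma expansion_side_eq:
  assumes "(D, E) \<in> expansion" "D \<in> diagrams" "side s D = side s E"
  shows "E = D"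
  using assms(1)
proof (cases rule: converse_rtranclE)
  case (step y)
  then obtain i where i: "i < leaves (dom_tree D)" "y = split_at D i" by (auto simp: splitting_split_at)
  then have "tip s D i \<in> nodes (side s E)" "tip s D i \<notin> nodes (side s D)"
    using expansion_nodes[OF step(2), of s] nodes_side_split[OF assms(2) i(1), of s] split_at_diagrams assms(2) by auto
  then show ?thesis using assms(3) by simp
qed auto

text \<open>Splitting the strand at a leaf that is interior in \<open>T'\<close> lowers the number
  of missing vertices. The other tree of the diagram follows along.\<close>

lemma expansion_exists:
  assumes "D \<in> diagrams" "nodes (side s D) \<subseteq> nodes T'"
  obtains E where "(D, E) \<in> expansion" "side s E = T'"
proof -
  have "\<exists>E. (D, E) \<in> expansion \<and> side s E = T'"
    using assms
  proof (induction "card (nodes T' - nodes (side s D))" arbitrary: D rule: less_induct)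
    case less
    show ?case
    proof (cases "side s D = T'")
      case False
      then obtain i where i: "i < leaves (dom_tree D)" "tip s D i \<in> nodes T'"
        using tip_exists less.prems by blast
      note n = nodes_side_split[OF less.prems(1) i(1), of s]
      have "card (nodes T' - nodes (side s (split_at D i))) < card (nodes T' - nodes (side s D))"
        using n i(2) by (intro psubset_card_mono) auto
      then obtain E where "(split_at D i, E) \<in> expansion" "side s E = T'"
        using less.hyps[of "split_at D i"] split_at_diagrams[OF less.prems(1) i(1)] n i(2) less.prems(2) by auto
      then show ?thesis using rtrancl_trans[OF expansion_split_at[OF less.prems(1) i(1)]] by (intro exI[of _ E]) simp
    qed (intro exI[of _ D], simp)
  qed
  with that show ?thesis by blast
qed

text \<open>Induction on the number of missing vertices. If the two expansions begin with the same
  strand, the induction hypothesis applies at once; if not, the two first splittings are completed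
  by the diamond \<open>split_at_commute\<close>.\<close>

lemma expansion_unique:
  assumes "(D, E) \<in> expansion" "(D, F) \<in> expansion" "D \<in> diagrams" "side s E = side s F"
  shows "E = F"
  using assms
proof (induction "card (nodes (side s E) - nodes (side s D))" arbitrary: D E F rule: less_induct)
  case less
  show ?case
  proof (cases "side s D = side s E")
    case True
    then show ?thesis using expansion_side_eq less.prems by metis
  next
    case False
    have first: "\<exists>i<leaves (dom_tree D). (split_at D i, G) \<in> expansion" if "(D, G) \<in> expansion" "side s G = side s E" for G
      using that(1)
    proof (cases rule: converse_rtranclE)
      case base then show ?thesis using False that by auto
    next
      case (step y) then show ?thesis by (auto simp: splitting_split_at)
    qed
    obtain i where i: "i < leaves (dom_tree D)" "(split_at D i, E) \<in> expansion" using first less.prems by blast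
    obtain j where j: "j < leaves (dom_tree D)" "(split_at D j, F) \<in> expansion" using first[of F] less.prems by auto
    have tip_in: "tip s D k \<in> nodes (side s E)" 
      if "k < leaves (dom_tree D)" "(split_at D k, G) \<in> expansion" "side s G = side s E" for k G
      using expansion_nodes[OF that(2), of s] nodes_side_split[OF less.prems(3) that(1), of s] 
        split_at_diagrams[OF less.prems(3) that(1)] that(3) by auto
    have IH: "G = H" if "k < leaves (dom_tree D)" "(split_at D k, G) \<in> expansion" "(split_at D k, H) \<in> expansion"
      "side s G = side s E" "side s H = side s E" for k G H
    proof -
      note n = nodes_side_split[OF less.prems(3) that(1), of s]
      have "card (nodes (side s G) - nodes (side s (split_at D k))) < card (nodes (side s E) - nodes (side s D))"
        using n tip_in[OF that(1,2,4)] that(4) by (intro psubset_card_mono) auto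
      then show ?thesis using less.hyps[of G "split_at D k" H] that split_at_diagrams[OF less.prems(3) that(1)] by auto
    qed
    have diamond: "E' = F'" 
      if kl: "k < l" "l < leaves (dom_tree D)" and E': "(split_at D k, E') \<in> expansion" "side s E' = side s E"
       and F': "(split_at D l, F') \<in> expansion" "side s F' = side s E" for k l E' F'
    proof -
      have k: "k < leaves (dom_tree D)" using kl by simp
      \<comment> \<open>\<open>?K\<close> has both strands split, and its tree still lies inside the
        target tree. An expansion \<open>G\<close> of \<open>?K\<close> with that tree is reached
        through either first splitting, so by induction it equals \<open>E'\<close> as well as
        \<open>F'\<close>.\<close>
      let ?K = "split_at (split_at D k) (Suc l)"
      have d: "split_at D k \<in> diagrams" "split_at D l \<in> diagrams" using split_at_diagrams less.prems(3) kl k by auto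
      have sl: "Suc l < leaves (dom_tree (split_at D k))" "k < leaves (dom_tree (split_at D l))" 
        using kl by (cases D; simp add: split_at.simps)+
      have "nodes (side s ?K) = insert (tip s D l) (insert (tip s D k) (nodes (side s D)))"
        using nodes_side_split(1)[OF d(1) sl(1), of s] nodes_side_split(1)[OF less.prems(3) k, of s]
          tip_split_neq[OF less.prems(3) kl] by simp
      also have "\<dots> \<subseteq> nodes (side s E)"
        using tip_in[OF k E'] tip_in[OF kl(2) F'] expansion_nodes[OF less.prems(1,3)] by auto
      finally obtain G where G: "(?K, G) \<in> expansion" "side s G = side s E"
        using expansion_exists[OF split_at_diagrams[OF d(1) sl(1)]] by blast
      have "(split_at D k, G) \<in> expansion" using expansion_split_at[OF d(1) sl(1)] G(1) by simp
      moreover have "(split_at D l, G) \<in> expansion" 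
        using expansion_split_at[OF d(2) sl(2)] G(1) split_at_commute[OF less.prems(3) kl] by simp
      ultimately show ?thesis using IH[OF k E'(1) _ E'(2) G(2)] IH[OF kl(2) F'(1) _ F'(2) G(2)] by simp
    qed
    consider "i = j" | "i < j" | "j < i" by linarith
    then show ?thesis
    proof cases
      case 1 show ?thesis by (rule IH[OF i _ refl less.prems(4)[symmetric]], unfold 1, rule j(2))
    next
      case 2 show ?thesis by (rule diamond[OF 2 j(1) i(2) refl j(2) less.prems(4)[symmetric]])
    next
      case 3 show ?thesis by (rule diamond[OF 3 i(1) j(2) less.prems(4)[symmetric] i(2) refl, symmetric])
    qed
  qed
qed

text \<open>Both expansions continue to the union of their domain trees, and expansions of
  \<open>D\<close> with the same domain tree coincide.\<close>

lemma expansion_confluent: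
  assumes "(D, E) \<in> expansion" "(D, F) \<in> expansion" "D \<in> diagrams"
  obtains G where "(E, G) \<in> expansion" "(F, G) \<in> expansion"
proof -
  let ?J = "tree_join (side True E) (side True F)"
  obtain G where G: "(E, G) \<in> expansion" "side True G = ?J"
    using expansion_exists[of E True ?J] expansion_diagrams assms by (auto simp: nodes_tree_join)
  obtain H where H: "(F, H) \<in> expansion" "side True H = ?J"
    using expansion_exists[of F True ?J] expansion_diagrams assms by (auto simp: nodes_tree_join)
  have "(D, G) \<in> expansion" "(D, H) \<in> expansion" using G H assms by (auto intro: rtrancl_trans)
  then have "G = H" using expansion_unique[of D G H True] assms G H by simp
  with that G H show ?thesis by blast
qed

lemma expansion_equiv: "(D, E) \<in> expansion \<Longrightarrow> (D, E) \<in> diagram_equiv"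
  unfolding diagram_equiv_def by (meson in_rtrancl_UnI)

lemma diagram_equiv_sym: "(D, E) \<in> diagram_equiv \<Longrightarrow> (E, D) \<in> diagram_equiv"
  unfolding diagram_equiv_def by (metis converse_Un converse_converse rtrancl_converseD rtrancl_converseI sup_commute)

lemma diagram_equiv_trans: "(D, E) \<in> diagram_equiv \<Longrightarrow> (E, F) \<in> diagram_equiv \<Longrightarrow> (D, F) \<in> diagram_equiv"
  unfolding diagram_equiv_def by (rule rtrancl_trans)

text \<open>Church-Rosser from confluence: a reduction step only prolongs one of the expansions, a
  splitting step is absorbed by \<open>expansion_confluent\<close>.\<close>

lemma diagram_equiv_common_expansion:
  assumes "(D, E) \<in> diagram_equiv" "D \<in> diagrams"
  obtains F where "(D, F) \<in> expansion" "(E, F) \<in> expansion" "E \<in> diagrams"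
proof -
  have "\<exists>F. (D, F) \<in> expansion \<and> (E, F) \<in> expansion \<and> E \<in> diagrams"
    using assms(1) unfolding diagram_equiv_def
  proof (induction rule: rtrancl_induct)
    case base then show ?case using assms by (intro exI[of _ D]) simp
  next
    case (step y z)
    then obtain F where F: "(D, F) \<in> expansion" "(y, F) \<in> expansion" "y \<in> diagrams" by blast
    from step(2) show ?case
    proof
      assume yz: "(y, z) \<in> splitting"
      then obtain G where "(F, G) \<in> expansion" "(z, G) \<in> expansion" using expansion_confluent[OF F(2) _ F(3)] by blast
      moreover have "z \<in> diagrams" using yz expansion_diagrams F(3) by blast
      ultimately show ?thesis using F(1) by (meson rtrancl_trans)
    next
      assume "(y, z) \<in> splitting\<inverse>"
      then have zy: "(z, y) \<in> splitting" by simp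
      then have "(z, F) \<in> expansion" using F(2) by (rule converse_rtrancl_into_rtrancl)
      moreover have "z \<in> diagrams" using zy splitting_split_at by metis
      ultimately show ?thesis using F(1) by (intro exI[of _ F]) simp
    qed
  qed
  then obtain F where "(D, F) \<in> expansion \<and> (E, F) \<in> expansion \<and> E \<in> diagrams" ..
  then show ?thesis using that[of F] by simp
qed

section \<open>The group structure\<close>

abbreviation dclass :: "diagram \<Rightarrow> diagram set" where "dclass D \<equiv> diagram_equiv `` {D}"

lemma dclass_eq: "(D, E) \<in> diagram_equiv \<Longrightarrow> dclass D = dclass E"
  using diagram_equiv_sym diagram_equiv_trans by blast

lemma dclass_self: "D \<in> dclass D" by (auto simp: diagram_equiv_def)

lemma dclass_expansion: "(D, E) \<in> expansion \<Longrightarrow> dclass D = dclass E"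
  by (intro dclass_eq expansion_equiv)

lemma carrier_BV: "carrier BV = dclass ` diagrams"
  by (auto simp: BV_def quotient_def)

lemma mult_BV: "X \<otimes>\<^bsub>BV\<^esub> Y = BV_mult X Y" by (simp add: BV_def)

lemma one_BV: "\<one>\<^bsub>BV\<^esub> = dclass (Leaf, one_braid 1, Leaf)" by (simp add: BV_def one_braid_def)

lemma dmult_in_diagrams:
  assumes "(T, \<beta>, U) \<in> diagrams" "(U, \<gamma>, W) \<in> diagrams"
  shows "(T, braid_mult (leaves U) \<beta> \<gamma>, W) \<in> diagrams"
  using assms by (auto simp: diagrams_iff braid_mult_closed)

text \<open>Splitting strand \<open>i\<close> of the left factor forces the splitting of its
  continuation in the right factor, and together they split strand \<open>i\<close> of the
  product.\<close>

lemma expansion_mult: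
  assumes "(D, D') \<in> expansion" "D = (T, \<beta>, U)" "D \<in> diagrams" "(U, \<gamma>, W) \<in> diagrams"
  shows "\<exists>T' \<beta>' U' \<gamma>' W'. D' = (T', \<beta>', U') \<and> ((U, \<gamma>, W), (U', \<gamma>', W')) \<in> expansion \<and>
    ((T, braid_mult (leaves U) \<beta> \<gamma>, W), (T', braid_mult (leaves U') \<beta>' \<gamma>', W')) \<in> expansion"
  using assms(1)
proof (induction rule: rtrancl_induct)
  case base
  then show ?case using assms(2) by auto
next
  case (step y z)
  then obtain T1 \<beta>1 U1 \<gamma>1 W1 where y: "y = (T1, \<beta>1, U1)" "((U, \<gamma>, W), (U1, \<gamma>1, W1)) \<in> expansion"
    "((T, braid_mult (leaves U) \<beta> \<gamma>, W), (T1, braid_mult (leaves U1) \<beta>1 \<gamma>1, W1)) \<in> expansion" by blast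
  obtain i where i: "i < leaves T1" "z = split_at y i" and yd: "y \<in> diagrams" using step y by (auto simp: splitting_split_at)
  have g: "(U1, \<gamma>1, W1) \<in> diagrams" using expansion_diagrams[OF y(2) assms(4)] .
  have n: "leaves U1 = leaves T1" "\<beta>1 \<in> braids (leaves T1)" "\<gamma>1 \<in> braids (leaves T1)" 
    using yd g y(1) by (auto simp: diagrams_iff)
  have p: "perm (leaves T1) \<beta>1 i < leaves T1" using perm_less n i by blast
  have "((U1, \<gamma>1, W1), split_at (U1, \<gamma>1, W1) (perm (leaves T1) \<beta>1 i)) \<in> expansion"
    using g p n by (intro expansion_split_at) auto
  moreover have "((T1, braid_mult (leaves U1) \<beta>1 \<gamma>1, W1), split_at (T1, braid_mult (leaves U1) \<beta>1 \<gamma>1, W1) i) \<in> expansion"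
    using dmult_in_diagrams[of T1 \<beta>1 U1 \<gamma>1 W1] yd g y(1) i by (intro expansion_split_at) auto
  ultimately show ?case
    using y i n p by (auto simp: cable_mult perm_mult split_at.simps intro!: exI elim!: rtrancl_trans)
qed

text \<open>This is well-definedness of the product: any two composable choices of representatives
  have products with a common expansion.\<close>

lemma BV_mult_dclass:
  assumes D: "(T, \<beta>, U) \<in> diagrams" and E: "(U, \<gamma>, W) \<in> diagrams"
  shows "dclass (T, \<beta>, U) \<otimes>\<^bsub>BV\<^esub> dclass (U, \<gamma>, W) = dclass (T, braid_mult (leaves U) \<beta> \<gamma>, W)"
proof -
  have key: "((T', braid_mult (leaves U') \<beta>' \<gamma>', W'), (T, braid_mult (leaves U) \<beta> \<gamma>, W)) \<in> diagram_equiv"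
    if "(T', \<beta>', U') \<in> dclass (T, \<beta>, U)" "(U', \<gamma>', W') \<in> dclass (U, \<gamma>, W)" for T' \<beta>' U' \<gamma>' W'
  proof -
    have "((T, \<beta>, U), (T', \<beta>', U')) \<in> diagram_equiv" using that by simp
    then obtain F where F: "((T, \<beta>, U), F) \<in> expansion" "((T', \<beta>', U'), F) \<in> expansion" and D': "(T', \<beta>', U') \<in> diagrams"
      by (rule diagram_equiv_common_expansion[OF _ D])
    have "((U, \<gamma>, W), (U', \<gamma>', W')) \<in> diagram_equiv" using that by simp
    then obtain H where H: "((U, \<gamma>, W), H) \<in> expansion" "((U', \<gamma>', W'), H) \<in> expansion" and E': "(U', \<gamma>', W') \<in> diagrams"
      by (rule diagram_equiv_common_expansion[OF _ E])
    have FH: "F \<in> diagrams" "H \<in> diagrams" using F(1) H(1) expansion_diagrams D E by blast+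
    \<comment> \<open>The common expansions \<open>F\<close> and \<open>H\<close> of the left and of
      the right factors need not be composable; expanding both to the union \<open>M\<close> of the
      middle trees makes them so.\<close>
    define M where "M = tree_join (ran_tree F) (dom_tree H)"
    obtain F2 where F2: "(F, F2) \<in> expansion" "ran_tree F2 = M"
      using expansion_exists[OF FH(1), of False M] by (auto simp: side_def M_def nodes_tree_join)
    obtain H2 where H2: "(H, H2) \<in> expansion" "dom_tree H2 = M"
      using expansion_exists[OF FH(2), of True M] by (auto simp: side_def M_def nodes_tree_join)
    have *: "((A, braid_mult (leaves B) b c, C), (dom_tree F2, braid_mult (leaves M) (dbraid F2) (dbraid H2), ran_tree H2)) \<in> expansion"
      if "((A, b, B), F) \<in> expansion" "((B, c, C), H) \<in> expansion" "(A, b, B) \<in> diagrams" "(B, c, C) \<in> diagrams" for A B C b c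
    proof -
      note h = that
      have e: "((A, b, B), F2) \<in> expansion" "((B, c, C), H2) \<in> expansion" 
        using h F2(1) H2(1) rtrancl_trans by metis+
      obtain T2 b2 U2 c2 W2 where r: "F2 = (T2, b2, U2)" "((B, c, C), (U2, c2, W2)) \<in> expansion"
        "((A, braid_mult (leaves B) b c, C), (T2, braid_mult (leaves U2) b2 c2, W2)) \<in> expansion"
        using expansion_mult[OF e(1) refl h(3,4)] by metis
      \<comment> \<open>The expansion of the right factor forced by \<open>F2\<close> also has
        domain tree \<open>M\<close>, so by uniqueness it is \<open>H2\<close>, regardless of the
        pair started with.\<close>
      have "H2 = (U2, c2, W2)"
        using expansion_unique[OF e(2) r(2) h(4), of True] r(1) F2 H2 by (auto simp: side_def)
      then show ?thesis using r F2 by auto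
    qed
    show ?thesis using *[OF F(1) H(1) D E] *[OF F(2) H(2) D' E']
      by (meson expansion_equiv diagram_equiv_sym diagram_equiv_trans)
  qed
  show ?thesis
    unfolding mult_BV BV_mult_def
  proof (intro Set.set_eqI iffI)
    fix X assume "X \<in> dclass (T, braid_mult (leaves U) \<beta> \<gamma>, W)"
    then show "X \<in> {Da. \<exists>T' \<beta>' U' \<gamma>' W'. (T', \<beta>', U') \<in> dclass (T, \<beta>, U) \<and> (U', \<gamma>', W') \<in> dclass (U, \<gamma>, W) \<and>
           ((T', braid_mult (leaves U') \<beta>' \<gamma>', W'), Da) \<in> diagram_equiv}"
      using dclass_self by blast
  next
    fix X assume "X \<in> {Da. \<exists>T' \<beta>' U' \<gamma>' W'. (T', \<beta>', U') \<in> dclass (T, \<beta>, U) \<and> (U', \<gamma>', W') \<in> dclass (U, \<gamma>, W) \<and>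
           ((T', braid_mult (leaves U') \<beta>' \<gamma>', W'), Da) \<in> diagram_equiv}"
    then show "X \<in> dclass (T, braid_mult (leaves U) \<beta> \<gamma>, W)"
      using key diagram_equiv_sym diagram_equiv_trans by blast
  qed
qed

lemma BV_carrier_cases:
  assumes "X \<in> carrier BV"
  obtains T \<beta> U where "(T, \<beta>, U) \<in> diagrams" "X = dclass (T, \<beta>, U)"
  using assms unfolding carrier_BV by auto

lemma dclass_in_carrier: "D \<in> diagrams \<Longrightarrow> dclass D \<in> carrier BV"
  by (auto simp: carrier_BV)

lemma BV_matched:
  assumes "D \<in> diagrams" "E \<in> diagrams"
  obtains T \<beta> U \<gamma> W where "(T, \<beta>, U) \<in> diagrams" "(D, (T, \<beta>, U)) \<in> expansion" 
    "(U, \<gamma>, W) \<in> diagrams" "(E, (U, \<gamma>, W)) \<in> expansion"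
proof -
  define M where "M = tree_join (ran_tree D) (dom_tree E)"
  obtain F where F: "(D, F) \<in> expansion" "ran_tree F = M"
    using expansion_exists[OF assms(1), of False M] by (auto simp: side_def M_def nodes_tree_join)
  obtain H where H: "(E, H) \<in> expansion" "dom_tree H = M"
    using expansion_exists[OF assms(2), of True M] by (auto simp: side_def M_def nodes_tree_join)
  show ?thesis using that[of "dom_tree F" "dbraid F" M "dbraid H" "ran_tree H"] F H
      expansion_diagrams[OF F(1) assms(1)] expansion_diagrams[OF H(1) assms(2)] by (cases F; cases H) auto
qed

lemma expansion_trans_left:
  assumes "((U, \<gamma>, W), (U2, \<gamma>2, W2)) \<in> expansion" "(T, \<beta>, U) \<in> diagrams"  "(U, \<gamma>, W) \<in> diagrams"
  obtains T2 \<beta>2 where "((T, \<beta>, U), (T2, \<beta>2, U2)) \<in> expansion"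
proof -
  have "nodes U \<subseteq> nodes U2" using expansion_nodes[OF assms(1,3), of True] by (simp add: side_def)
  then obtain F where F: "((T, \<beta>, U), F) \<in> expansion" "side False F = U2"
    using expansion_exists[OF assms(2), of False U2] by (metis ran_tree.simps side_def)
  obtain A b C where "F = (A, b, C)" by (cases F)
  then show ?thesis using that[of A b] F by (simp add: side_def)
qed

lemma one_diagram: "(T, one_braid (leaves T), T) \<in> diagrams"
  by (simp add: diagrams_iff one_braid_in_braids)

lemma split_at_one:
  "i < leaves T \<Longrightarrow> split_at (T, one_braid (leaves T), T) i = (add_caret i T, one_braid (leaves (add_caret i T)), add_caret i T)"
  by (simp add: cable_one perm_one_braid split_at.simps)

text \<open>Splitting a straight diagram with equal trees gives such a diagram again, and the
  one-leaf diagram expands to every domain tree.\<close>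

lemma one_BV_tree: "\<one>\<^bsub>BV\<^esub> = dclass (T, one_braid (leaves T), T)"
proof -
  have "\<exists>\<beta> U. E = (dom_tree E, one_braid (leaves (dom_tree E)), dom_tree E)" 
    if "((Leaf, one_braid (leaves Leaf), Leaf), E) \<in> expansion" for E
    using that
  proof (induction rule: rtrancl_induct)
    case (step y z)
    then obtain S where y: "y = (S, one_braid (leaves S), S)" by (metis dom_tree.simps)
    then obtain i where "i < leaves S" "z = split_at y i" using step(2) by (auto simp: splitting_split_at)
    then show ?case using y split_at_one[of i S] by (metis dom_tree.simps)
  qed auto
  moreover obtain E where "((Leaf, one_braid (leaves Leaf), Leaf), E) \<in> expansion" "dom_tree E = T"
    using expansion_exists[OF one_diagram[of Leaf], of True T] by (auto simp: side_def)
  ultimately show ?thesis using dclass_expansion by (metis leaves_simps(1) one_BV)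
qed

theorem group_BV: "group BV"
proof (rule groupI)
  show "\<one>\<^bsub>BV\<^esub> \<in> carrier BV" unfolding one_BV_tree[of Leaf] by (intro dclass_in_carrier one_diagram)
next
  fix X Y assume X: "X \<in> carrier BV" and Y: "Y \<in> carrier BV"
  then obtain D E where D: "D \<in> diagrams" "X = dclass D" and E: "E \<in> diagrams" "Y = dclass E" by (auto simp: carrier_BV)
  obtain T \<beta> U \<gamma> W where m: "(T, \<beta>, U) \<in> diagrams" "(D, (T, \<beta>, U)) \<in> expansion" 
    "(U, \<gamma>, W) \<in> diagrams" "(E, (U, \<gamma>, W)) \<in> expansion" using BV_matched[OF D(1) E(1)] by blast
  then have "X \<otimes>\<^bsub>BV\<^esub> Y = dclass (T, braid_mult (leaves U) \<beta> \<gamma>, W)"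
    using D E dclass_expansion BV_mult_dclass by metis
  then show "X \<otimes>\<^bsub>BV\<^esub> Y \<in> carrier BV" using dmult_in_diagrams m dclass_in_carrier by metis
next
  fix X Y Z assume "X \<in> carrier BV" "Y \<in> carrier BV" "Z \<in> carrier BV"
  then obtain D E F where D: "D \<in> diagrams" "X = dclass D" and E: "E \<in> diagrams" "Y = dclass E" 
    and F: "F \<in> diagrams" "Z = dclass F" by (auto simp: carrier_BV)
  obtain T \<beta> U \<gamma> W where m: "(T, \<beta>, U) \<in> diagrams" "(D, (T, \<beta>, U)) \<in> expansion" 
    "(U, \<gamma>, W) \<in> diagrams" "(E, (U, \<gamma>, W)) \<in> expansion" using BV_matched[OF D(1) E(1)] by blast
  obtain U2 \<gamma>2 W2 \<delta> V where m2: "(U2, \<gamma>2, W2) \<in> diagrams" "((U, \<gamma>, W), (U2, \<gamma>2, W2)) \<in> expansion" 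
    "(W2, \<delta>, V) \<in> diagrams" "(F, (W2, \<delta>, V)) \<in> expansion" using BV_matched[OF m(3) F(1)] by blast
  \<comment> \<open>Matching with the third factor has enlarged the trees of the second one; the
    first factor is expanded again to fit.\<close>
  obtain T2 \<beta>2 where m3: "((T, \<beta>, U), (T2, \<beta>2, U2)) \<in> expansion" using expansion_trans_left[OF m2(2) m(1,3)] by blast
  have dg: "(T2, \<beta>2, U2) \<in> diagrams" using expansion_diagrams[OF m3 m(1)] .
  have c: "X = dclass (T2, \<beta>2, U2)" "Y = dclass (U2, \<gamma>2, W2)" "Z = dclass (W2, \<delta>, V)"
    using D E F m m2 m3 dclass_expansion by metis+
  have n: "leaves U2 = leaves T2" "leaves W2 = leaves T2" "\<beta>2 \<in> braids (leaves T2)" "\<gamma>2 \<in> braids (leaves T2)" "\<delta> \<in> braids (leaves T2)"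
    using dg m2 by (auto simp: diagrams_iff)
  show "X \<otimes>\<^bsub>BV\<^esub> Y \<otimes>\<^bsub>BV\<^esub> Z = X \<otimes>\<^bsub>BV\<^esub> (Y \<otimes>\<^bsub>BV\<^esub> Z)"
    using dg m2 dmult_in_diagrams[of T2 \<beta>2 U2 \<gamma>2 W2] dmult_in_diagrams[of U2 \<gamma>2 W2 \<delta> V]
    by (simp add: c BV_mult_dclass n braid_mult_assoc)
next
  fix X assume "X \<in> carrier BV"
  then obtain T \<beta> U where D: "(T, \<beta>, U) \<in> diagrams" "X = dclass (T, \<beta>, U)" by (rule BV_carrier_cases)
  then have br: "\<beta> \<in> braids (leaves T)" "leaves U = leaves T" by (auto simp: diagrams_iff)
  show "\<one>\<^bsub>BV\<^esub> \<otimes>\<^bsub>BV\<^esub> X = X"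
    unfolding one_BV_tree[of T] using D br by (simp add: BV_mult_dclass one_diagram braid_mult_one_left)
  obtain \<gamma> where g: "\<gamma> \<in> braids (leaves T)" "braid_mult (leaves T) \<gamma> \<beta> = one_braid (leaves T)"
    using braid_mult_inverse_left[OF br(1)] by blast
  have d: "(U, \<gamma>, T) \<in> diagrams" using g br by (simp add: diagrams_iff)
  then have "dclass (U, \<gamma>, T) \<otimes>\<^bsub>BV\<^esub> X = \<one>\<^bsub>BV\<^esub>"
    unfolding one_BV_tree[of U] using D g br by (simp add: BV_mult_dclass)
  then show "\<exists>Y\<in>carrier BV. Y \<otimes>\<^bsub>BV\<^esub> X = \<one>\<^bsub>BV\<^esub>" using d dclass_in_carrier by blast
qed

section \<open>Elements supported in a ribbon\<close>

text \<open>The second caret hangs on the left child in the domain tree and on the right child in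
  the range tree: the usual tree pair of the generator \<open>x\<^sub>0\<close>, grafted at leaf
  \<open>i\<close>.\<close>

definition shift_diagram :: "btree \<Rightarrow> nat \<Rightarrow> diagram" where
  "shift_diagram T i = (add_caret i (add_caret i T), one_braid (Suc (Suc (leaves T))), add_caret (Suc i) (add_caret i T))"

fun spine :: "bool list \<Rightarrow> btree" where
  "spine [] = Leaf"
| "spine (x # a) = (if x then Caret Leaf (spine a) else Caret (spine a) Leaf)"

text \<open>
  The generator \<open>x\<^sub>0\<close> of Thompson's group \<open>F\<close>, acting on the subtree with root \<open>a\<close>; all strands are
  straight.
\<close>

definition zel :: "bool list \<Rightarrow> diagram set" where
  "zel a = dclass (shift_diagram (spine a) (SOME i. i < leaves (spine a) \<and> addrs (spine a) ! i = a))"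

lemma shift_diagram_in_diagrams: "i < leaves T \<Longrightarrow> shift_diagram T i \<in> diagrams"
  by (simp add: shift_diagram_def diagrams_iff one_braid_in_braids)

lemma spine_leaf: "a \<in> set (addrs (spine a))"
  by (induction a) auto

lemma nodes_spine: "b \<in> nodes (spine a) \<Longrightarrow> \<exists>y. a = b @ y"
  by (induction a arbitrary: b) (auto split: if_splits)

lemma nodes_shift:
  assumes "i < leaves T"
  shows "nodes (add_caret i (add_caret i T)) = nodes T \<union> {addrs T ! i, addrs T ! i @ [False]}"
    "nodes (add_caret (Suc i) (add_caret i T)) = nodes T \<union> {addrs T ! i, addrs T ! i @ [True]}"
  using assms by (auto simp: nodes_add_caret nth_addrs_add_caret)

lemma nth_addrs_shift:
  assumes "i < leaves T" "k < leaves T" "k \<noteq> i" "m = (if k < i then k else Suc (Suc k))"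
  shows "addrs (add_caret i (add_caret i T)) ! m = addrs T ! k"
    "addrs (add_caret (Suc i) (add_caret i T)) ! m = addrs T ! k"
    "m < Suc (Suc (leaves T))"
  using assms by (auto simp: nth_addrs_add_caret)

text \<open>A caret at a leaf other than \<open>i\<close> grows in both trees alike. In the diagram
  that leaf has number \<open>m\<close>, since leaves to the right of \<open>i\<close> have moved by
  two.\<close>

lemma shift_split:
  assumes i: "i < leaves T" and k: "k < leaves T" "k \<noteq> i"
    and i': "i' < Suc (leaves T)" "addrs (add_caret k T) ! i' = addrs T ! i"
  shows "dclass (shift_diagram T i) = dclass (shift_diagram (add_caret k T) i')"
proof -
  define m where "m = (if k < i then k else Suc (Suc k))"
  note m = nth_addrs_shift[OF i k m_def]
  have "split_at (shift_diagram T i) m = shift_diagram (add_caret k T) i'"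
  proof -
    have "add_caret m (add_caret i (add_caret i T)) = add_caret i' (add_caret i' (add_caret k T))"
      using i k i' m nodes_shift[OF i] nodes_shift[of i' "add_caret k T"] 
      by (intro nodes_eqD) (simp add: nodes_add_caret[of m] nodes_add_caret[of k] insert_commute)
    moreover have "add_caret m (add_caret (Suc i) (add_caret i T)) = add_caret (Suc i') (add_caret i' (add_caret k T))"
      using i k i' m nodes_shift[OF i] nodes_shift[of i' "add_caret k T"] 
      by (intro nodes_eqD) (simp add: nodes_add_caret[of m] nodes_add_caret[of k] insert_commute)
    ultimately show ?thesis using i k m
      by (simp add: shift_diagram_def split_at.simps cable_one perm_one_braid)
  qed
  moreover have "(shift_diagram T i, split_at (shift_diagram T i) m) \<in> expansion"
    using shift_diagram_in_diagrams[OF i] m i by (intro expansion_split_at) (auto simp: shift_diagram_def)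
  ultimately show ?thesis using dclass_expansion by metis
qed

lemma leaf_persists:
  assumes "a \<in> set (addrs S)" "nodes S \<subseteq> nodes T" "a \<notin> nodes T"
  shows "a \<in> set (addrs T)"
  using assms by (auto simp: leaf_iff)

lemma shift_mono:
  assumes "nodes S \<subseteq> nodes T" "i < leaves S" "j < leaves T" "addrs S ! i = addrs T ! j"
  shows "dclass (shift_diagram S i) = dclass (shift_diagram T j)"
  using assms
proof (induction "card (nodes T - nodes S)" arbitrary: S i rule: less_induct)
  case less
  show ?case
  proof (cases "S = T")
    case True
    then show ?thesis using less.prems nth_addrs_eq_iff by metis
  next
    case False
    obtain k where k: "k < leaves S" "addrs S ! k \<in> nodes T" using nodes_psubsetE[OF less.prems(1) False] by blast
    have a: "addrs S ! i \<notin> nodes T" using nth_addrs_not_node less.prems by metis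
    then have ki: "k \<noteq> i" using k by metis
    have sub: "nodes (add_caret k S) \<subseteq> nodes T" using k less.prems by (simp add: nodes_add_caret)
    have "addrs S ! i \<in> set (addrs (add_caret k S))"
    proof (rule leaf_persists[of _ S])
      show "addrs S ! i \<in> set (addrs S)" using less.prems(2) by simp
      show "nodes S \<subseteq> nodes (add_caret k S)" using k(1) by (auto simp: nodes_add_caret)
      show "addrs S ! i \<notin> nodes (add_caret k S)" using a sub by blast
    qed
    then obtain i' where i': "i' < Suc (leaves S)" "addrs (add_caret k S) ! i' = addrs S ! i"
      using k by (auto elim!: leafE)
    have "card (nodes T - nodes (add_caret k S)) < card (nodes T - nodes S)"
      using k nth_addrs_not_node[OF k(1)] by (intro psubset_card_mono) (auto simp: nodes_add_caret)
    then have "dclass (shift_diagram (add_caret k S) i') = dclass (shift_diagram T j)"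
      using sub i' k less.prems by (intro less.hyps) auto
    then show ?thesis using shift_split[OF less.prems(2) k(1) ki i'] by simp
  qed
qed

text \<open>Any two trees with leaf \<open>a\<close> sit inside their union, where \<open>a\<close>
  is still a leaf, and \<open>shift_mono\<close> compares both with it. So every tree containing the
  leaf may be used to compute with \<open>zel a\<close>.\<close>

lemma zel_eq:
  assumes "i < leaves T" "addrs T ! i = a"
  shows "zel a = dclass (shift_diagram T i)"
proof -
  define k where "k = (SOME i. i < leaves (spine a) \<and> addrs (spine a) ! i = a)"
  have "\<exists>i. i < leaves (spine a) \<and> addrs (spine a) ! i = a" using spine_leaf[of a] by (auto elim: leafE)
  then have k: "k < leaves (spine a)" "addrs (spine a) ! k = a" unfolding k_def by (metis (mono_tags, lifting) someI_ex)+
  let ?J = "tree_join (spine a) T"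
  have "a \<notin> nodes ?J" using k assms nth_addrs_not_node nodes_tree_join by (metis UnE)
  then have "a \<in> set (addrs ?J)" by (rule leaf_persists[OF spine_leaf, rotated]) (auto simp: nodes_tree_join)
  then obtain j where j: "j < leaves ?J" "addrs ?J ! j = a" by (rule leafE)
  have "dclass (shift_diagram (spine a) k) = dclass (shift_diagram ?J j)"
    "dclass (shift_diagram T i) = dclass (shift_diagram ?J j)"
    using k j assms by (intro shift_mono; auto simp: nodes_tree_join)+
  then show ?thesis by (simp add: zel_def k_def)
qed

lemma zel_in_carrier: "zel a \<in> carrier BV"
proof -
  obtain i where "i < leaves (spine a)" "addrs (spine a) ! i = a" using leafE[OF spine_leaf] .
  then show ?thesis using zel_eq shift_diagram_in_diagrams dclass_in_carrier by metis
qed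

text \<open>A uniform description of both trees after a splitting: new strand \<open>k\<close> comes
  from the old strand \<open>u\<close>, and both of its addresses are prolonged by the same word
  \<open>e\<close>.\<close>

lemma split_leaf:
  assumes "(T, \<beta>, U) \<in> diagrams" "i < leaves T" "k < Suc (leaves T)"
    and "u = (if k \<le> i then k else k - 1)" "e = (if k = i then [False] else if k = Suc i then [True] else [])"
  defines "p \<equiv> perm (leaves T) \<beta>"
  shows "addrs (add_caret i T) ! k = addrs T ! u @ e"
    "addrs (add_caret (p i) U) ! perm (Suc (leaves T)) (cable (leaves T) i \<beta>) k = addrs U ! p u @ e"
proof -
  have br: "\<beta> \<in> braids (leaves T)" "leaves U = leaves T" using assms by (auto simp: diagrams_iff)
  have p: "p j < leaves T" if "j < leaves T" for j unfolding p_def using perm_less[OF br(1) that] .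
  have pne: "p u \<noteq> p i" if "k \<noteq> i" "k \<noteq> Suc i"
  proof -
    have "u \<noteq> i" "u < leaves T" using that assms(2-4) by auto
    then show ?thesis using perm_bij[OF br(1)] assms(2) unfolding p_def bij_betw_def by (auto dest: inj_onD)
  qed
  show "addrs (add_caret i T) ! k = addrs T ! u @ e"
    using assms by (auto simp: nth_addrs_add_caret)
  have u: "u < leaves T" using assms by auto
  have pk: "perm (Suc (leaves T)) (cable (leaves T) i \<beta>) k = double_perm i p k"
    using perm_cable br assms by auto
  have "double_perm i p k < Suc (leaves T)" using p[OF assms(2)] p[OF u] assms(4) by (auto simp: double_perm_def Let_def)
  then show "addrs (add_caret (p i) U) ! perm (Suc (leaves T)) (cable (leaves T) i \<beta>) k = addrs U ! p u @ e"
    unfolding pk using p[OF assms(2)] br pne assms(4,5)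
    by (auto simp: nth_addrs_add_caret double_perm_def Let_def)
qed

text \<open>Following the word \<open>d\<close> downwards, one splitting per letter, turns any
  address below a leaf into a leaf itself.\<close>

lemma expand_leaf:
  assumes "(T, \<beta>, U) \<in> diagrams" "i < leaves T"
  shows "\<exists>T' \<beta>' U' k. ((T, \<beta>, U), (T', \<beta>', U')) \<in> expansion \<and> k < leaves T' \<and>
    addrs T' ! k = addrs T ! i @ d \<and> addrs U' ! perm (leaves T') \<beta>' k = addrs U ! perm (leaves T) \<beta> i @ d"
  using assms
proof (induction d arbitrary: T \<beta> U i)
  case Nil
  then show ?case by auto
next
  case (Cons x d)
  let ?k = "if x then Suc i else i"
  let ?T = "add_caret i T" and ?b = "cable (leaves T) i \<beta>" and ?U = "add_caret (perm (leaves T) \<beta> i) U"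
  have E: "((T, \<beta>, U), (?T, ?b, ?U)) \<in> expansion" "(?T, ?b, ?U) \<in> diagrams"
    using expansion_split_at[OF Cons.prems(1), of i] split_at_diagrams[OF Cons.prems(1), of i] Cons.prems(2)
    by (auto simp: split_at.simps)
  have L: "addrs ?T ! ?k = addrs T ! i @ [x]" "addrs ?U ! perm (leaves ?T) ?b ?k = addrs U ! perm (leaves T) \<beta> i @ [x]"
    using split_leaf[OF Cons.prems, of ?k _ "[x]"] Cons.prems(2) by auto
  have "?k < leaves ?T" using Cons.prems by auto
  then obtain T' \<beta>' U' k where "((?T, ?b, ?U), (T', \<beta>', U')) \<in> expansion" "k < leaves T'"
    "addrs T' ! k = addrs ?T ! ?k @ d" "addrs U' ! perm (leaves T') \<beta>' k = addrs ?U ! perm (leaves ?T) ?b ?k @ d"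
    using Cons.IH[OF E(2), of ?k] by blast
  then show ?case using E(1) L by (intro exI[of _ T'] exI[of _ \<beta>'] exI[of _ U'] exI[of _ k]) (auto intro: rtrancl_trans)
qed

text \<open>Split strand \<open>i\<close> twice, in the second step on the left or on the right
  copy. By \<open>cable_same\<close> both give the same braid \<open>?c\<close>, with left or right
  carets in both trees. Multiplying by the straight \<open>zel\<close> on either side yields left
  carets in the domain, \<open>?c\<close>, and right carets in the range.\<close>

lemma zel_intertwine:
  assumes D: "(T, \<beta>, U) \<in> diagrams" and i: "i < leaves T"
  shows "zel (addrs T ! i) \<otimes>\<^bsub>BV\<^esub> dclass (T, \<beta>, U) = dclass (T, \<beta>, U) \<otimes>\<^bsub>BV\<^esub> zel (addrs U ! perm (leaves T) \<beta> i)"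
proof -
  let ?n = "leaves T" let ?j = "perm ?n \<beta> i" let ?b = "cable ?n i \<beta>"
  let ?c = "cable (Suc ?n) i ?b"
  have br: "\<beta> \<in> braids ?n" "leaves U = ?n" using D by (auto simp: diagrams_iff)
  have j: "?j < ?n" using perm_less[OF br(1) i] .
  have jU: "?j < leaves U" using j br by simp
  have d1: "split_at (T, \<beta>, U) i \<in> diagrams" "((T, \<beta>, U), split_at (T, \<beta>, U) i) \<in> expansion"
    using split_at_diagrams[OF D] expansion_split_at[OF D] i by auto
  have dt: "leaves (dom_tree (split_at (T, \<beta>, U) i)) = Suc ?n" using i by (simp add: split_at.simps)
  have two: "((T, \<beta>, U), split_at (split_at (T, \<beta>, U) i) k) \<in> expansion" 
     "split_at (split_at (T, \<beta>, U) i) k \<in> diagrams" if "k < Suc ?n" for k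
    using expansion_split_at[OF d1(1)] split_at_diagrams[OF d1(1)] d1(2) dt that by (auto intro: rtrancl_trans)
  have p: "perm (Suc ?n) ?b i = ?j" "perm (Suc ?n) ?b (Suc i) = Suc ?j"
    using perm_cable[OF br(1) i] i by (auto simp: double_perm_def)
  have s1: "split_at (split_at (T, \<beta>, U) i) i = (add_caret i (add_caret i T), ?c, add_caret ?j (add_caret ?j U))"
    using i p by (simp add: split_at.simps)
  have s2: "split_at (split_at (T, \<beta>, U) i) (Suc i) = (add_caret (Suc i) (add_caret i T), ?c, add_caret (Suc ?j) (add_caret ?j U))"
    using i p cable_same[OF br(1) i] by (simp add: split_at.simps)
  have cb: "?c \<in> braids (Suc (Suc ?n))" using cable_in_braids br i by auto
  have 1: "dclass (T, \<beta>, U) = dclass (add_caret i (add_caret i T), ?c, add_caret ?j (add_caret ?j U))"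
    using dclass_expansion[OF two(1)[of i]] i s1 by simp
  have 2: "dclass (T, \<beta>, U) = dclass (add_caret (Suc i) (add_caret i T), ?c, add_caret (Suc ?j) (add_caret ?j U))"
    using dclass_expansion[OF two(1)[of "Suc i"]] i s2 by simp
  have g1: "(add_caret i (add_caret i T), ?c, add_caret ?j (add_caret ?j U)) \<in> diagrams" 
    using two(2)[of i] i unfolding s1 by simp
  have g2: "(add_caret (Suc i) (add_caret i T), ?c, add_caret (Suc ?j) (add_caret ?j U)) \<in> diagrams" 
    using two(2)[of "Suc i"] i unfolding s2 by simp
  have "zel (addrs T ! i) \<otimes>\<^bsub>BV\<^esub> dclass (T, \<beta>, U) = dclass (add_caret i (add_caret i T), ?c, add_caret (Suc ?j) (add_caret ?j U))"
    unfolding 2 zel_eq[OF i refl] shift_diagram_def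
    using BV_mult_dclass[OF shift_diagram_in_diagrams[OF i, unfolded shift_diagram_def] g2] i cb
    by (simp add: braid_mult_one_left)
  moreover have "dclass (T, \<beta>, U) \<otimes>\<^bsub>BV\<^esub> zel (addrs U ! ?j) = dclass (add_caret i (add_caret i T), ?c, add_caret (Suc ?j) (add_caret ?j U))"
    unfolding 1 zel_eq[OF jU refl] shift_diagram_def
    using BV_mult_dclass[OF g1, of "one_braid (Suc (Suc (leaves U)))" "add_caret (Suc ?j) (add_caret ?j U)"]
      shift_diagram_in_diagrams[of ?j U] j cb br
    by (simp add: braid_mult_one_right shift_diagram_def)
  ultimately show ?thesis by simp
qed

subsection \<open>The action on the Cantor set\<close>

text \<open>Prefix replacement along the strands, as a relation so that it needs no choice of the
  leaf; domain to range matches the left-to-right product of diagrams.\<close>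

fun act :: "diagram \<Rightarrow> (bool stream \<times> bool stream) set" where
  "act (T, \<beta>, U) = {(addrs T ! i @- x, addrs U ! perm (leaves T) \<beta> i @- x) | i x. i < leaves T}"

text \<open>The leaves of a tree form a prefix code.\<close>

lemma leaf_shift_eq:
  "a \<in> set (addrs T) \<Longrightarrow> b \<in> set (addrs T) \<Longrightarrow> a @- x = b @- y \<Longrightarrow> a = b \<and> x = y"
proof (induction T arbitrary: a b)
  case (Caret l r)
  then obtain c a' d b' where ab: "a = c # a'" "b = d # b'" by auto
  then have "c = d" "a' @- x = b' @- y" using Caret.prems(3) by auto
  moreover from this have "a' = b' \<and> x = y"
    using Caret.IH(1)[of a' b'] Caret.IH(2)[of a' b'] Caret.prems(1,2) ab by (cases d) auto
  ultimately show ?case using ab by simp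
qed simp

lemma leaf_shift_cover: "\<exists>a\<in>set (addrs T). \<exists>y. x = a @- y"
proof (induction T arbitrary: x)
  case (Caret l r)
  obtain c x' where x: "x = c ## x'" by (metis stream.collapse)
  show ?case
  proof (cases c)
    case True
    obtain a y where "a \<in> set (addrs r)" "x' = a @- y" using Caret.IH(2) by blast
    then show ?thesis using x True by (intro bexI[of _ "True # a"] exI[of _ y]) auto
  next
    case False
    obtain a y where "a \<in> set (addrs l)" "x' = a @- y" using Caret.IH(1) by blast
    then show ?thesis using x False by (intro bexI[of _ "False # a"] exI[of _ y]) auto
  qed
qed auto

lemma nth_leaf_shift_eq:
  assumes "i < leaves T" "j < leaves T" "addrs T ! i @- x = addrs T ! j @- y"
  shows "i = j" "x = y"
  using leaf_shift_eq[of "addrs T ! i" T "addrs T ! j" x y] assms nth_addrs_eq_iff by auto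

text \<open>If one word ended before the other, a constant stream of the opposite letter would tell
  them apart.\<close>

lemma shift_eqD: "(\<And>x :: bool stream. a @- x = b @- x) \<Longrightarrow> a = b"
proof (induction a arbitrary: b)
  case Nil
  show ?case
  proof (cases b)
    case (Cons c b')
    have "shd (sconst (\<not> c)) = shd (b @- sconst (\<not> c))" using Nil[of "sconst (\<not> c)"] by simp
    then show ?thesis using Cons by simp
  qed simp
next
  case (Cons c a)
  show ?case
  proof (cases b)
    case Nil
    have "shd (sconst (\<not> c)) = shd ((c # a) @- sconst (\<not> c))" using Cons.prems[of "sconst (\<not> c)"] Nil by simp
    then show ?thesis by simp
  next
    case (Cons d b')
    then show ?thesis using Cons.prems Cons.IH[of b'] by auto
  qed
qed

lemma act_split_at:
  assumes "D \<in> diagrams" "i < leaves (dom_tree D)"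
  shows "act (split_at D i) = act D"
proof -
  obtain T \<beta> U where D: "D = (T, \<beta>, U)" by (cases D)
  let ?p = "perm (leaves T) \<beta>" let ?p' = "perm (Suc (leaves T)) (cable (leaves T) i \<beta>)"
  let ?T = "add_caret i T" and ?U = "add_caret (?p i) U"
  have dg: "(T, \<beta>, U) \<in> diagrams" and i: "i < leaves T" using assms D by auto
  have 1: "act (split_at D i) = {(addrs ?T ! k @- x, addrs ?U ! ?p' k @- x) | k x. k < Suc (leaves T)}"
    using i by (simp add: D split_at.simps)
  note L = split_leaf[OF dg i _ refl refl]
  show ?thesis
  proof (intro subset_antisym subrelI)
    fix y z assume "(y, z) \<in> act (split_at D i)"
    then obtain k x where k: "k < Suc (leaves T)" "y = addrs ?T ! k @- x" "z = addrs ?U ! ?p' k @- x" unfolding 1 by auto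
    have "(if k \<le> i then k else k - 1) < leaves T" using k i by auto
    then show "(y, z) \<in> act D" unfolding k(2,3) L[OF k(1)] D by (auto simp del: shift.simps)
  next
    fix y z assume "(y, z) \<in> act D"
    then obtain u x where u: "u < leaves T" "y = addrs T ! u @- x" "z = addrs U ! ?p u @- x" unfolding D by auto
    obtain c x' where x: "x = c ## x'" by (metis stream.collapse)
    \<comment> \<open>The letter of the stream behind leaf \<open>i\<close> decides which of the two
      new leaves it passes through.\<close>
    define k where "k = (if u < i then u else if u = i then (if c then Suc i else i) else Suc u)"
    define e where "e = (if k = i then [False] else if k = Suc i then [True] else [])"
    have k: "k < Suc (leaves T)" "(if k \<le> i then k else k - 1) = u" using u by (auto simp: k_def)
    have Lk: "addrs ?T ! k = addrs T ! u @ e" "addrs ?U ! ?p' k = addrs U ! ?p u @ e"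
      using split_leaf[OF dg i k(1) k(2)[symmetric] e_def] by auto
    have "e = [] \<or> e = [c]" by (auto simp: e_def k_def)
    then obtain x'' where "x = e @- x''" using x by (metis shift.simps)
    then have "y = addrs ?T ! k @- x''" "z = addrs ?U ! ?p' k @- x''" using u Lk by simp_all
    then show "(y, z) \<in> act (split_at D i)" unfolding 1 using k(1) by blast
  qed
qed

lemma act_expansion: "(D, E) \<in> expansion \<Longrightarrow> act E = act D"
proof (induction rule: rtrancl_induct)
  case (step y z)
  then obtain i where "y \<in> diagrams" "i < leaves (dom_tree y)" "z = split_at y i"
    using splitting_split_at[of y z] by auto
  then show ?case using act_split_at step by simp
qed simp

definition BV_act :: "diagram set \<Rightarrow> (bool stream \<times> bool stream) set" where
  "BV_act g = (\<Union>D\<in>g. act D)"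

lemma BV_act_dclass:
  assumes "D \<in> diagrams" shows "BV_act (dclass D) = act D"
proof -
  have "act E = act D" if "E \<in> dclass D" for E
  proof -
    have "(D, E) \<in> diagram_equiv" using that by simp
    then obtain F where "(D, F) \<in> expansion" "(E, F) \<in> expansion" 
      by (rule diagram_equiv_common_expansion[OF _ assms])
    then show ?thesis using act_expansion by metis
  qed
  then show ?thesis unfolding BV_act_def using dclass_self[of D] by blast
qed

lemma BV_act_unique:
  assumes "g \<in> carrier BV" "(x, y) \<in> BV_act g" "(x, z) \<in> BV_act g"
  shows "y = z"
proof -
  obtain T \<beta> U where D: "(T, \<beta>, U) \<in> diagrams" "g = dclass (T, \<beta>, U)" using assms(1) by (rule BV_carrier_cases)
  obtain i x' where i: "i < leaves T" "x = addrs T ! i @- x'" "y = addrs U ! perm (leaves T) \<beta> i @- x'"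
    using assms(2) BV_act_dclass[OF D(1)] D(2) by auto
  obtain j x'' where j: "j < leaves T" "x = addrs T ! j @- x''" "z = addrs U ! perm (leaves T) \<beta> j @- x''"
    using assms(3) BV_act_dclass[OF D(1)] D(2) by auto
  show ?thesis using nth_leaf_shift_eq[of i T j x' x''] i j by simp
qed

lemma BV_act_total:
  assumes "g \<in> carrier BV" shows "\<exists>y. (x, y) \<in> BV_act g"
proof -
  obtain T \<beta> U where D: "(T, \<beta>, U) \<in> diagrams" "g = dclass (T, \<beta>, U)" using assms(1) by (rule BV_carrier_cases)
  obtain a x' where a: "a \<in> set (addrs T)" "x = a @- x'" using leaf_shift_cover by blast
  then obtain i where "i < leaves T" "addrs T ! i = a" by (auto elim: leafE)
  then show ?thesis using BV_act_dclass[OF D(1)] D(2) a by auto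
qed

lemma BV_act_one: "(x, y) \<in> BV_act \<one>\<^bsub>BV\<^esub> \<longleftrightarrow> x = y"
  unfolding one_BV_tree[of Leaf] BV_act_dclass[OF one_diagram] by (auto simp: perm_one_braid)

lemma BV_act_mult:
  assumes "g \<in> carrier BV" "h \<in> carrier BV" "(x, y) \<in> BV_act g" "(y, z) \<in> BV_act h"
  shows "(x, z) \<in> BV_act (g \<otimes>\<^bsub>BV\<^esub> h)"
proof -
  obtain D E where D: "D \<in> diagrams" "g = dclass D" and E: "E \<in> diagrams" "h = dclass E" using assms by (auto simp: carrier_BV)
  obtain T \<beta> U \<gamma> W where m: "(T, \<beta>, U) \<in> diagrams" "(D, (T, \<beta>, U)) \<in> expansion" 
    "(U, \<gamma>, W) \<in> diagrams" "(E, (U, \<gamma>, W)) \<in> expansion" using BV_matched[OF D(1) E(1)] by blast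
  have g: "g = dclass (T, \<beta>, U)" "h = dclass (U, \<gamma>, W)" using D E dclass_expansion m by metis+
  have gh: "g \<otimes>\<^bsub>BV\<^esub> h = dclass (T, braid_mult (leaves U) \<beta> \<gamma>, W)" unfolding g by (rule BV_mult_dclass[OF m(1,3)])
  have n: "leaves U = leaves T" "\<beta> \<in> braids (leaves T)" "\<gamma> \<in> braids (leaves T)" using m by (auto simp: diagrams_iff)
  obtain i x' where i: "i < leaves T" "x = addrs T ! i @- x'" "y = addrs U ! perm (leaves T) \<beta> i @- x'"
    using assms(3) BV_act_dclass[OF m(1)] g by auto
  obtain j x'' where j: "j < leaves U" "y = addrs U ! j @- x''" "z = addrs W ! perm (leaves U) \<gamma> j @- x''"
    using assms(4) BV_act_dclass[OF m(3)] g by auto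
  have "perm (leaves T) \<beta> i < leaves U" using perm_less n i by auto
  then have "perm (leaves T) \<beta> i = j" "x' = x''" using nth_leaf_shift_eq[of _ U j x' x''] i j by auto
  then show ?thesis unfolding gh BV_act_dclass[OF dmult_in_diagrams[OF m(1,3)]]
    using i j n by (auto simp: perm_mult intro!: exI[of _ i])
qed

subsection \<open>Ribbons carried by an element\<close>

text \<open>
  \<open>carries g a b\<close>: the ribbon below the address \<open>a\<close> is carried by \<open>g\<close> as one strand to the address \<open>b\<close>.
  The intertwining property excludes braiding within the ribbon, which the action does not see.
\<close>

definition carries :: "diagram set \<Rightarrow> bool list \<Rightarrow> bool list \<Rightarrow> bool" where
  "carries g a b \<longleftrightarrow> g \<in> carrier BV \<and> (\<forall>x. (a @- x, b @- x) \<in> BV_act g) \<and>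
     (\<forall>d. zel (a @ d) \<otimes>\<^bsub>BV\<^esub> g = g \<otimes>\<^bsub>BV\<^esub> zel (b @ d))"

lemma carries_carrier: "carries g a b \<Longrightarrow> g \<in> carrier BV" by (simp add: carries_def)

lemma carries_append: "carries g a b \<Longrightarrow> carries g (a @ d) (b @ d)"
  by (auto simp: carries_def)

lemma carries_one: "carries \<one>\<^bsub>BV\<^esub> a a"
  using group.is_monoid[OF group_BV] zel_in_carrier
  by (auto simp: carries_def BV_act_one monoid.one_closed monoid.l_one monoid.r_one)

lemma carries_mult:
  assumes "carries g a b" "carries h b c" shows "carries (g \<otimes>\<^bsub>BV\<^esub> h) a c"
proof -
  interpret group BV by (rule group_BV)
  have c: "g \<in> carrier BV" "h \<in> carrier BV" using assms carries_carrier by auto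
  have "zel (a @ d) \<otimes>\<^bsub>BV\<^esub> (g \<otimes>\<^bsub>BV\<^esub> h) = g \<otimes>\<^bsub>BV\<^esub> h \<otimes>\<^bsub>BV\<^esub> zel (c @ d)" for d
  proof -
    have "zel (a @ d) \<otimes>\<^bsub>BV\<^esub> (g \<otimes>\<^bsub>BV\<^esub> h) = (g \<otimes>\<^bsub>BV\<^esub> zel (b @ d)) \<otimes>\<^bsub>BV\<^esub> h"
      using assms(1) c zel_in_carrier by (simp add: carries_def m_assoc[symmetric])
    also have "\<dots> = g \<otimes>\<^bsub>BV\<^esub> (h \<otimes>\<^bsub>BV\<^esub> zel (c @ d))"
      using assms(2) c zel_in_carrier by (simp add: carries_def m_assoc)
    finally show ?thesis using c zel_in_carrier by (simp add: m_assoc)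
  qed
  then show ?thesis using assms c BV_act_mult unfolding carries_def by blast
qed

lemma carries_inv:
  assumes "carries g a b" shows "carries (inv\<^bsub>BV\<^esub> g) b a"
proof -
  interpret group BV by (rule group_BV)
  have g: "g \<in> carrier BV" "inv\<^bsub>BV\<^esub> g \<in> carrier BV" using assms carries_carrier by auto
  have "(b @- x, a @- x) \<in> BV_act (inv\<^bsub>BV\<^esub> g)" for x
  proof -
    obtain y where y: "(b @- x, y) \<in> BV_act (inv\<^bsub>BV\<^esub> g)" using BV_act_total g by blast
    have "(a @- x, y) \<in> BV_act (g \<otimes>\<^bsub>BV\<^esub> inv\<^bsub>BV\<^esub> g)"
      using assms y g by (intro BV_act_mult) (auto simp: carries_def)
    then have "a @- x = y" using g by (simp add: BV_act_one)
    then show ?thesis using y by simp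
  qed
  moreover have "zel (b @ d) \<otimes>\<^bsub>BV\<^esub> inv\<^bsub>BV\<^esub> g = inv\<^bsub>BV\<^esub> g \<otimes>\<^bsub>BV\<^esub> zel (a @ d)" for d
  proof -
    have "g \<otimes>\<^bsub>BV\<^esub> zel (b @ d) = zel (a @ d) \<otimes>\<^bsub>BV\<^esub> g" using assms by (simp add: carries_def)
    then have "zel (b @ d) = inv\<^bsub>BV\<^esub> g \<otimes>\<^bsub>BV\<^esub> (zel (a @ d) \<otimes>\<^bsub>BV\<^esub> g)"
      using g zel_in_carrier by (subst inv_solve_left) auto
    then have "zel (b @ d) = inv\<^bsub>BV\<^esub> g \<otimes>\<^bsub>BV\<^esub> zel (a @ d) \<otimes>\<^bsub>BV\<^esub> g"
      using g zel_in_carrier by (simp add: m_assoc)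
    then have "inv\<^bsub>BV\<^esub> g \<otimes>\<^bsub>BV\<^esub> zel (a @ d) = zel (b @ d) \<otimes>\<^bsub>BV\<^esub> inv\<^bsub>BV\<^esub> g"
      using g zel_in_carrier by (subst inv_solve_right) auto
    then show ?thesis by simp
  qed
  ultimately show ?thesis using g by (simp add: carries_def)
qed

text \<open>Every strand of a representing diagram is a carried ribbon; addresses below it are made
  leaves by \<open>expand_leaf\<close>, where \<open>zel_intertwine\<close> applies.\<close>

lemma carries_leaf:
  assumes D: "(T, \<beta>, U) \<in> diagrams" and i: "i < leaves T"
  shows "carries (dclass (T, \<beta>, U)) (addrs T ! i) (addrs U ! perm (leaves T) \<beta> i)"
  unfolding carries_def
proof (intro conjI allI)
  show "dclass (T, \<beta>, U) \<in> carrier BV" by (rule dclass_in_carrier[OF D])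
  show "(addrs T ! i @- x, addrs U ! perm (leaves T) \<beta> i @- x) \<in> BV_act (dclass (T, \<beta>, U))" for x
    using BV_act_dclass[OF D] i by auto
  fix d
  obtain T' \<beta>' U' k where E: "((T, \<beta>, U), (T', \<beta>', U')) \<in> expansion" "k < leaves T'"
    "addrs T' ! k = addrs T ! i @ d" "addrs U' ! perm (leaves T') \<beta>' k = addrs U ! perm (leaves T) \<beta> i @ d"
    using expand_leaf[OF D i] by blast
  show "zel (addrs T ! i @ d) \<otimes>\<^bsub>BV\<^esub> dclass (T, \<beta>, U) = dclass (T, \<beta>, U) \<otimes>\<^bsub>BV\<^esub> zel (addrs U ! perm (leaves T) \<beta> i @ d)"
    using zel_intertwine[OF expansion_diagrams[OF E(1) D] E(2)] E(3,4) dclass_expansion[OF E(1)] by simp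
qed

lemma carries_zel:
  shows "carries (zel a) (a @ [False, False]) (a @ [False])" "carries (zel a) (a @ [False, True]) (a @ [True, False])"
    "carries (zel a) (a @ [True]) (a @ [True, True])"
proof -
  obtain i where i: "i < leaves (spine a)" "addrs (spine a) ! i = a" using leafE[OF spine_leaf] .
  let ?T = "add_caret i (add_caret i (spine a))" and ?U = "add_caret (Suc i) (add_caret i (spine a))"
  have *: "carries (zel a) (addrs ?T ! k) (addrs ?U ! k)" if "k < Suc (Suc (leaves (spine a)))" for k
    using carries_leaf[OF shift_diagram_in_diagrams[OF i(1), unfolded shift_diagram_def], of k] that i
    by (simp add: zel_eq[OF i] shift_diagram_def perm_one_braid)
  have "addrs ?T ! i = a @ [False, False]" "addrs ?T ! Suc i = a @ [False, True]" "addrs ?T ! Suc (Suc i) = a @ [True]"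
    "addrs ?U ! i = a @ [False]" "addrs ?U ! Suc i = a @ [True, False]" "addrs ?U ! Suc (Suc i) = a @ [True, True]"
    using i by (auto simp: nth_addrs_add_caret)
  then show "carries (zel a) (a @ [False, False]) (a @ [False])" "carries (zel a) (a @ [False, True]) (a @ [True, False])"
    "carries (zel a) (a @ [True]) (a @ [True, True])" using *[of i] *[of "Suc i"] *[of "Suc (Suc i)"] i by auto
qed

text \<open>The address \<open>b\<close> lies below a leaf of \<open>spine a\<close> other than
  \<open>a\<close>, and both trees of the straight diagram agree outside the subtree at
  \<open>a\<close>.\<close>

lemma carries_zel_incomparable:
  assumes "\<nexists>y. b = a @ y" "\<nexists>y. a = b @ y"
  shows "carries (zel a) b b"
proof -
  obtain i where i: "i < leaves (spine a)" "addrs (spine a) ! i = a" using leafE[OF spine_leaf] .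
  have "b \<notin> nodes (spine a)" using nodes_spine assms(2) by blast
  then obtain l y where l: "l \<in> set (addrs (spine a))" "b = l @ y" using addrs_cover by blast
  obtain k where k: "k < leaves (spine a)" "addrs (spine a) ! k = l" using leafE[OF l(1)] .
  have "k \<noteq> i" using k i l(2) assms(1) by auto
  define m where "m = (if k < i then k else Suc (Suc k))"
  note m = nth_addrs_shift[OF i(1) k(1) \<open>k \<noteq> i\<close> m_def]
  have "carries (zel a) l l"
    using carries_leaf[OF shift_diagram_in_diagrams[OF i(1), unfolded shift_diagram_def], of m] m i k
    by (simp add: zel_eq[OF i] shift_diagram_def perm_one_braid)
  then show ?thesis using l(2) carries_append by simp
qed

lemma carries_unique:
  assumes "carries g a b" "carries g a c" shows "b = c"
proof (rule shift_eqD)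
  fix x show "b @- x = c @- x" using assms BV_act_unique unfolding carries_def by blast
qed

text \<open>Choose \<open>N\<close> larger than the depths of all vertices of a representing
  diagram. A deeper address lies below a leaf, and then only the prefix is exchanged.\<close>

lemma carries_bound:
  assumes "g \<in> carrier BV"
  shows "\<exists>N. (\<forall>a. N \<le> length a \<longrightarrow> (\<exists>b. carries g a b)) \<and>
    (\<forall>a b. carries g a b \<longrightarrow> length b \<le> length a + N \<and> length a \<le> length b + N)"
proof -
  obtain T \<beta> U where D: "(T, \<beta>, U) \<in> diagrams" "g = dclass (T, \<beta>, U)" using assms(1) by (rule BV_carrier_cases)
  define A where "A = set (addrs T) \<union> set (addrs U) \<union> nodes T"
  define N where "N = Suc (Max (length ` A))"
  have fin: "finite A" by (simp add: A_def)
  have len: "length a < N" if "a \<in> A" for a 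
    using Max_ge[of "length ` A" "length a"] that fin unfolding N_def by (intro le_imp_less_Suc) auto
  have br: "\<beta> \<in> braids (leaves T)" "leaves U = leaves T" using D by (auto simp: diagrams_iff)
  have leaf: "\<exists>l l' y. a = l @ y \<and> carries g l l' \<and> length l < N \<and> length l' < N" if "N \<le> length a" for a
  proof -
    have "a \<notin> nodes T" using len[of a] that by (auto simp: A_def)
    then obtain l y where l: "l \<in> set (addrs T)" "a = l @ y" using addrs_cover by blast
    obtain i where i: "i < leaves T" "addrs T ! i = l" using leafE[OF l(1)] .
    have "addrs U ! perm (leaves T) \<beta> i \<in> set (addrs U)" using perm_less[OF br(1) i(1)] br(2) by simp
    then show ?thesis using carries_leaf[OF D(1) i(1)] i l D(2) len by (auto simp: A_def)
  qed
  have "\<exists>b. carries g a b" if "N \<le> length a" for a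
    using leaf[OF that] carries_append by blast
  moreover have "length b \<le> length a + N \<and> length a \<le> length b + N" if ab: "carries g a b" for a b
  proof -
    \<comment> \<open>Padding makes a short address deep enough to lie below a leaf; by uniqueness
      of the image it does not change the difference of lengths.\<close>
    let ?d = "replicate N False"
    obtain l l' y where l: "a @ ?d = l @ y" "carries g l l'" "length l < N" "length l' < N"
      using leaf[of "a @ ?d"] by auto
    have "b @ ?d = l' @ y" using carries_unique carries_append[OF ab, of ?d] carries_append[OF l(2), of y] l(1) by metis
    then have "length b + N = length l' + length y" "length a + N = length l + length y"
      using l(1) by (metis length_append length_replicate)+
    then show ?thesis using l(3,4) by linarith
  qed
  ultimately show ?thesis by blast
qed

section \<open>Word length and paths\<close>

locale word_group = group G for G (structure) +
  fixes S
  assumes S_subset: "S \<subseteq> carrier G" and S_gen: "generate G S = carrier G"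
begin

abbreviation "gens \<equiv> S \<union> m_inv G ` S"
abbreviation "wprod ws \<equiv> foldr (\<otimes>) ws \<one>"
abbreviation "len \<equiv> word_length G S"

lemma gens_carrier: "gens \<subseteq> carrier G" using S_subset by auto

lemma gens_inv: "s \<in> gens \<Longrightarrow> inv s \<in> gens"
  using S_subset by (auto simp: image_iff)

lemma wprod_closed [simp]: "set ws \<subseteq> gens \<Longrightarrow> wprod ws \<in> carrier G"
  using gens_carrier by (induction ws) auto

lemma wprod_append: "set us \<subseteq> gens \<Longrightarrow> set vs \<subseteq> gens \<Longrightarrow> wprod (us @ vs) = wprod us \<otimes> wprod vs"
proof (induction us)
  case (Cons u us)
  then have "u \<in> carrier G" using gens_carrier by auto
  then show ?case using Cons by (simp add: m_assoc)
qed simp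

lemma wprod_inverse: "set ws \<subseteq> gens \<Longrightarrow> wprod (rev (map (m_inv G) ws)) = inv (wprod ws)"
proof (induction ws)
  case (Cons u us)
  have u: "u \<in> carrier G" "inv u \<in> gens" using Cons.prems gens_carrier gens_inv by auto
  have "set (rev (map (m_inv G) us)) \<subseteq> gens"
  proof
    fix s assume "s \<in> set (rev (map (m_inv G) us))"
    then obtain t where "t \<in> set us" "s = inv t" by auto
    then show "s \<in> gens" using gens_inv[of t] Cons.prems by auto
  qed
  then have "wprod (rev (map (m_inv G) (u # us))) = inv (wprod us) \<otimes> inv u"
    using Cons u wprod_append[of "rev (map (m_inv G) us)" "[inv u]"] by simp
  then show ?case using Cons.prems u by (simp add: inv_mult_group)
qed simp

lemma word_exists: "g \<in> carrier G \<Longrightarrow> \<exists>ws. set ws \<subseteq> gens \<and> wprod ws = g"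
  unfolding S_gen[symmetric]
proof (induction rule: generate.induct)
  case one
  show ?case by (intro exI[of _ "[]"]) simp
next
  case (incl h)
  then show ?case using S_subset by (intro exI[of _ "[h]"]) auto
next
  case (inv h)
  then show ?case using S_subset by (intro exI[of _ "[inv h]"]) auto
next
  case (eng h1 h2)
  then obtain us vs where "set us \<subseteq> gens" "wprod us = h1" "set vs \<subseteq> gens" "wprod vs = h2" by blast
  then show ?case by (intro exI[of _ "us @ vs"]) (auto simp: wprod_append simp del: foldr_append)
qed

lemma len_word:
  assumes "g \<in> carrier G"
  obtains ws where "set ws \<subseteq> gens" "wprod ws = g" "length ws = len g"
proof -
  have "\<exists>k ws. length ws = k \<and> set ws \<subseteq> gens \<and> wprod ws = g" using word_exists[OF assms] by blast
  then have "\<exists>ws. length ws = len g \<and> set ws \<subseteq> gens \<and> wprod ws = g"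
    unfolding word_length_def by (rule LeastI_ex)
  with that show ?thesis by blast
qed

lemma len_le: "set ws \<subseteq> gens \<Longrightarrow> len (wprod ws) \<le> length ws"
  unfolding word_length_def by (rule Least_le) blast

lemma len_one [simp]: "len \<one> = 0" using len_le[of "[]"] by simp

lemma len_mult: 
  assumes "g \<in> carrier G" "h \<in> carrier G" shows "len (g \<otimes> h) \<le> len g + len h"
proof -
  obtain us where u: "set us \<subseteq> gens" "wprod us = g" "length us = len g" using len_word[OF assms(1)] .
  obtain vs where v: "set vs \<subseteq> gens" "wprod vs = h" "length vs = len h" using len_word[OF assms(2)] .
  show ?thesis using len_le[of "us @ vs"] u v by (simp add: wprod_append del: foldr_append)
qed

lemma len_inv_le: assumes "g \<in> carrier G" shows "len (inv g) \<le> len g"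
proof -
  obtain us where u: "set us \<subseteq> gens" "wprod us = g" "length us = len g" using len_word[OF assms(1)] .
  then have "set (rev (map (m_inv G) us)) \<subseteq> gens" using gens_inv by auto
  then show ?thesis using len_le[of "rev (map (m_inv G) us)"] u wprod_inverse[of us] by simp
qed

lemma len_inv: "g \<in> carrier G \<Longrightarrow> len (inv g) = len g"
  using len_inv_le[of g] len_inv_le[of "inv g"] by simp

lemma len_right: assumes "x \<in> carrier G" "q \<in> carrier G" shows "len x \<le> len (x \<otimes> q) + len q"
proof -
  have "x = (x \<otimes> q) \<otimes> inv q" using assms by (simp add: m_assoc)
  then show ?thesis using len_mult[of "x \<otimes> q" "inv q"] assms len_inv by simp
qed

lemma len_left: assumes "x \<in> carrier G" "q \<in> carrier G" shows "len q \<le> len (x \<otimes> q) + len x"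
proof -
  have "q = inv x \<otimes> (x \<otimes> q)" using assms by (simp add: m_assoc[symmetric])
  then show ?thesis using len_mult[of "inv x" "x \<otimes> q"] assms len_inv by simp
qed

lemma len_pow: "w \<in> carrier G \<Longrightarrow> len (w [^] (k::nat)) \<le> k * len w"
proof (induction k)
  case (Suc k)
  then show ?case using len_mult[of "w [^] k" w] by simp
qed simp

text \<open>A path in the Cayley graph that avoids the ball of radius \<rho> around
  \<open>\<one>\<close>; \<open>L\<close> bounds its length and is real so that it can scale
  linearly.\<close>

definition far :: "real \<Rightarrow> real \<Rightarrow> 'a \<Rightarrow> 'a \<Rightarrow> bool" where
  "far \<rho> L x y \<longleftrightarrow> x \<in> carrier G \<and> (\<exists>ws. set ws \<subseteq> gens \<and> real (length ws) \<le> L \<and> x \<otimes> wprod ws = y \<and>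
     (\<forall>k\<le>length ws. \<rho> \<le> real (len (x \<otimes> wprod (take k ws)))))"

lemma far_mono: "far \<rho> L x y \<Longrightarrow> \<rho>' \<le> \<rho> \<Longrightarrow> L \<le> L' \<Longrightarrow> far \<rho>' L' x y"
  unfolding far_def
proof (elim conjE exE, intro conjI)
  fix ws assume a: "set ws \<subseteq> gens" "real (length ws) \<le> L" "x \<otimes> wprod ws = y"
    "\<forall>k\<le>length ws. \<rho> \<le> real (len (x \<otimes> wprod (take k ws)))" "\<rho>' \<le> \<rho>" "L \<le> L'"
  then have "\<forall>k\<le>length ws. \<rho>' \<le> real (len (x \<otimes> wprod (take k ws)))" by (meson order_trans)
  with a show "\<exists>ws. set ws \<subseteq> gens \<and> real (length ws) \<le> L' \<and> x \<otimes> wprod ws = y \<and>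
      (\<forall>k\<le>length ws. \<rho>' \<le> real (len (x \<otimes> wprod (take k ws))))" by (intro exI[of _ ws]) simp
qed

lemma far_trans:
  assumes "far \<rho> L x y" "far \<rho> L' y w" shows "far \<rho> (L + L') x w"
proof -
  obtain us where u: "x \<in> carrier G" "set us \<subseteq> gens" "real (length us) \<le> L" "x \<otimes> wprod us = y"
    "\<And>k. k\<le>length us \<Longrightarrow> \<rho> \<le> real (len (x \<otimes> wprod (take k us)))" using assms(1) unfolding far_def by blast
  obtain vs where v: "y \<in> carrier G" "set vs \<subseteq> gens" "real (length vs) \<le> L'" "y \<otimes> wprod vs = w"
    "\<And>k. k\<le>length vs \<Longrightarrow> \<rho> \<le> real (len (y \<otimes> wprod (take k vs)))" using assms(2) unfolding far_def by blast
  have "\<rho> \<le> real (len (x \<otimes> wprod (take k (us @ vs))))" if "k \<le> length (us @ vs)" for k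
  proof (cases "k \<le> length us")
    case True then show ?thesis using u(5)[OF True] by simp
  next
    case False
    then have t: "take k (us @ vs) = us @ take (k - length us) vs" by simp
    have sv: "set (take (k - length us) vs) \<subseteq> gens" using v(2) set_take_subset by (rule order_trans[rotated])
    have "x \<otimes> wprod (take k (us @ vs)) = y \<otimes> wprod (take (k - length us) vs)"
      unfolding t using u sv by (simp add: wprod_append m_assoc[symmetric] del: foldr_append)
    then show ?thesis using v(5)[of "k - length us"] that by simp
  qed
  moreover have "x \<otimes> wprod (us @ vs) = w" using u v by (simp add: wprod_append m_assoc[symmetric] del: foldr_append)
  ultimately show ?thesis using u v unfolding far_def by (intro conjI exI[of _ "us @ vs"]) auto
qed

lemma far_sym:
  assumes "far \<rho> L x y" shows "far \<rho> L y x"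
proof -
  obtain us where u: "x \<in> carrier G" "set us \<subseteq> gens" "real (length us) \<le> L" "x \<otimes> wprod us = y"
    "\<And>k. k\<le>length us \<Longrightarrow> \<rho> \<le> real (len (x \<otimes> wprod (take k us)))" using assms(1) unfolding far_def by blast
  let ?r = "rev (map (m_inv G) us)"
  have r: "set ?r \<subseteq> gens" using u(2) gens_inv by auto
  have y: "y \<in> carrier G" using u by auto
  have "y \<otimes> wprod (take k ?r) = x \<otimes> wprod (take (length us - k) us)" for k
  proof -
    let ?a = "take (length us - k) us" and ?b = "drop (length us - k) us"
    have s: "set ?a \<subseteq> gens" "set ?b \<subseteq> gens" using u(2) set_take_subset set_drop_subset by (meson order_trans)+
    have "take k ?r = rev (map (m_inv G) ?b)" by (simp add: take_rev drop_map)
    then have "wprod (take k ?r) = inv (wprod ?b)" using wprod_inverse[OF s(2)] by simp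
    moreover have "y = x \<otimes> (wprod ?a \<otimes> wprod ?b)" using u(4) wprod_append[OF s] by simp
    ultimately show ?thesis using u(1) s by (simp add: m_assoc)
  qed
  note e = this
  have "y \<otimes> wprod ?r = x" using e[of "length us"] u(1) by simp
  moreover have "\<rho> \<le> real (len (y \<otimes> wprod (take k ?r)))" for k
    unfolding e by (rule u(5)) simp
  ultimately show ?thesis unfolding far_def using y r u(3) by (intro conjI exI[of _ ?r]) auto
qed

lemma far_word:
  assumes "x \<in> carrier G" "q \<in> carrier G" "\<rho> + real (len q) \<le> real (len x)"
  shows "far \<rho> (real (len q)) x (x \<otimes> q)"
proof -
  obtain ws where w: "set ws \<subseteq> gens" "wprod ws = q" "length ws = len q" using len_word[OF assms(2)] .
  have "\<rho> \<le> real (len (x \<otimes> wprod (take k ws)))" for k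
  proof -
    have s: "set (take k ws) \<subseteq> gens" using w(1) set_take_subset by (rule order_trans[rotated])
    have "len x \<le> len (x \<otimes> wprod (take k ws)) + len (wprod (take k ws))"
      using assms(1) s by (intro len_right) auto
    moreover have "len (wprod (take k ws)) \<le> len q" using len_le[OF s] w(3) by simp
    ultimately show ?thesis using assms(3) by linarith
  qed
  then show ?thesis unfolding far_def using assms w by (intro conjI exI[of _ ws]) auto
qed

text \<open>The margin \<open>len w\<close> above \<rho> at each power covers the vertices inside a
  word for \<open>w\<close>.\<close>

lemma far_pow:
  assumes "x \<in> carrier G" "w \<in> carrier G" "\<And>k. k \<le> m \<Longrightarrow> \<rho> + real (len w) \<le> real (len (x \<otimes> w [^] k))"
  shows "far \<rho> (real m * real (len w)) x (x \<otimes> w [^] (m::nat))"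
  using assms(3)
proof (induction m)
  case 0
  then have "\<rho> \<le> real (len x)" using assms(1) by force
  then show ?case using assms(1) unfolding far_def by (intro conjI exI[of _ "[]"]) auto
next
  case (Suc m)
  have "far \<rho> (real (len w)) (x \<otimes> w [^] m) (x \<otimes> w [^] m \<otimes> w)"
    using Suc.prems[of m] assms by (intro far_word) auto
  then have "far \<rho> (real m * real (len w) + real (len w)) x (x \<otimes> w [^] m \<otimes> w)"
    using Suc by (intro far_trans[of _ _ _ "x \<otimes> w [^] m"]) auto
  then show ?case using assms by (simp add: m_assoc algebra_simps)
qed

lemma pow_intertwine:
  assumes "w \<in> carrier G" "w' \<in> carrier G" "q \<in> carrier G" "w \<otimes> q = q \<otimes> w'"
  shows "w [^] (k::nat) \<otimes> q = q \<otimes> w' [^] k"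
proof (induction k)
  case (Suc k)
  have "w [^] Suc k \<otimes> q = w [^] k \<otimes> (q \<otimes> w')" using assms by (simp add: m_assoc)
  also have "\<dots> = w [^] k \<otimes> q \<otimes> w'" using assms by (simp add: m_assoc)
  also have "\<dots> = q \<otimes> w' [^] Suc k" unfolding Suc using assms by (simp add: m_assoc)
  finally show ?case .
qed (use assms in simp)

lemma inv_intertwine:
  assumes "w \<in> carrier G" "w' \<in> carrier G" "q \<in> carrier G" "w \<otimes> q = q \<otimes> w'"
  shows "inv w \<otimes> q = q \<otimes> inv w'"
proof -
  have "w \<otimes> (q \<otimes> inv w') = q" using assms by (metis inv_closed m_assoc r_inv r_one)
  then show ?thesis using assms by (metis inv_closed inv_solve_left m_closed)
qed

end

section \<open>Groups carrying ribbons\<close>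

definition incomparable :: "bool list \<Rightarrow> bool list \<Rightarrow> bool" where
  "incomparable a b \<longleftrightarrow> (\<nexists>y. a = b @ y) \<and> (\<nexists>y. b = a @ y)"

lemma incomparable_sym: "incomparable a b \<Longrightarrow> incomparable b a"
  by (auto simp: incomparable_def)

text \<open>Records exactly what the divergence argument uses of \<open>BV\<close>, with
  \<open>z\<close> for \<open>zel\<close> and \<open>R\<close> for \<open>carries\<close>; braids do
  not occur from here on.\<close>

locale ribbon_group = word_group G S for G (structure) and S +
  fixes z :: "bool list \<Rightarrow> 'a" and R :: "'a \<Rightarrow> bool list \<Rightarrow> bool list \<Rightarrow> bool"
  assumes finite_S: "finite S"
    and z_in [simp]: "z a \<in> carrier G"
    and R_in: "R g a b \<Longrightarrow> g \<in> carrier G"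
    and R_one: "R \<one> a a"
    and R_mult: "R g a b \<Longrightarrow> R h b c \<Longrightarrow> R (g \<otimes> h) a c"
    and R_inv: "R g a b \<Longrightarrow> R (inv g) b a"
    and R_append: "R g a b \<Longrightarrow> R g (a @ d) (b @ d)"
    and R_z: "R g a b \<Longrightarrow> z a \<otimes> g = g \<otimes> z b"
    and z_left: "R (z a) (a @ [False, False]) (a @ [False])"
    and z_mid: "R (z a) (a @ [False, True]) (a @ [True, False])"
    and z_right: "R (z a) (a @ [True]) (a @ [True, True])"
    and z_fix: "incomparable a b \<Longrightarrow> R (z a) b b"
    and R_bound: "g \<in> carrier G \<Longrightarrow> \<exists>N. (\<forall>a. N \<le> length a \<longrightarrow> (\<exists>b. R g a b)) \<and>
      (\<forall>a b. R g a b \<longrightarrow> length b \<le> length a + N \<and> length a \<le> length b + N)"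
    and R_unique: "R g a b \<Longrightarrow> R g a c \<Longrightarrow> b = c"
begin

text \<open>One constant turns word length into depth: it bounds how deep a ribbon must be to be
  carried as one strand and by how much its depth can change.\<close>

definition distortion :: "nat \<Rightarrow> bool" where
  "distortion D \<longleftrightarrow> D \<ge> 1 \<and> (\<forall>g\<in>carrier G. (\<forall>a. D * len g \<le> length a \<longrightarrow> (\<exists>b. R g a b)) \<and>
     (\<forall>a b. R g a b \<longrightarrow> length b \<le> length a + D * len g \<and> length a \<le> length b + D * len g))"

lemma R_pow: "(\<And>j. R g (a j) (a (Suc j))) \<Longrightarrow> R (g [^] (k::nat)) (a 0) (a k)"
  by (induction k) (auto intro: R_one R_mult)

lemma R_pow_fix: "R g a a \<Longrightarrow> R (g [^] (k::nat)) a a"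
  using R_pow[of g "\<lambda>j. a"] by simp

text \<open>Take the largest bound from \<open>R_bound\<close> over the finitely many generators and
  follow a deep address letter by letter along a shortest word; each letter changes the depth by at
  most \<open>D\<close>.\<close>

lemma distortion_exists: "\<exists>D. distortion D"
proof -
  have fin: "finite gens" using finite_S by simp
  have "\<forall>g\<in>gens. \<exists>N. (\<forall>a. N \<le> length a \<longrightarrow> (\<exists>b. R g a b)) \<and>
      (\<forall>a b. R g a b \<longrightarrow> length b \<le> length a + N \<and> length a \<le> length b + N)"
    using R_bound gens_carrier by blast
  then obtain N where N: "\<And>g. g \<in> gens \<Longrightarrow> (\<forall>a. N g \<le> length a \<longrightarrow> (\<exists>b. R g a b)) \<and>
      (\<forall>a b. R g a b \<longrightarrow> length b \<le> length a + N g \<and> length a \<le> length b + N g)" by metis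
  define D where "D = Max (insert 1 (N ` gens))"
  have D1: "D \<ge> 1" using fin by (simp add: D_def)
  have DN: "N g \<le> D" if "g \<in> gens" for g using that fin by (simp add: D_def)
  have *: "\<exists>b. R (wprod ws) a b \<and> length b \<le> length a + D * length ws \<and> length a \<le> length b + D * length ws"
    if "set ws \<subseteq> gens" "D * length ws \<le> length a" for ws a
    using that
  proof (induction ws arbitrary: a)
    case Nil then show ?case using R_one by auto
  next
    case (Cons w ws)
    have w: "w \<in> gens" using Cons.prems by simp
    have "N w \<le> length a" using DN[OF w] Cons.prems(2) by simp
    then obtain b where b: "R w a b" using N[OF w] by blast
    then have lb: "length b \<le> length a + D" "length a \<le> length b + D" using N[OF w] DN[OF w] by (meson add_left_mono order_trans)+
    then obtain c where "R (wprod ws) b c" "length c \<le> length b + D * length ws" "length b \<le> length c + D * length ws"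
      using Cons.IH[of b] Cons.prems by auto
    then show ?case using R_mult[OF b] lb by (intro exI[of _ c]) auto
  qed
  have "distortion D"
    unfolding distortion_def
  proof (intro conjI D1 ballI allI impI)
    fix g and a :: "bool list" assume g: "g \<in> carrier G" "D * len g \<le> length a"
    obtain ws where ws: "set ws \<subseteq> gens" "wprod ws = g" "length ws = len g" using len_word[OF g(1)] .
    then show "\<exists>b. R g a b" using *[of ws a] g by auto
  next
    fix g and a b :: "bool list" assume g: "g \<in> carrier G" and ab: "R g a b"
    obtain ws where ws: "set ws \<subseteq> gens" "wprod ws = g" "length ws = len g" using len_word[OF g(1)] .
    \<comment> \<open>The letterwise argument needs a deep address, so \<open>a\<close> is padded;
      uniqueness transfers the estimate back to \<open>a\<close> and \<open>b\<close>.\<close>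
    let ?d = "replicate (D * len g) False"
    obtain c where c: "R g (a @ ?d) c" "length c \<le> length (a @ ?d) + D * len g" "length (a @ ?d) \<le> length c + D * len g"
      using *[of ws "a @ ?d"] ws by auto
    have "c = b @ ?d" using R_unique[OF c(1) R_append[OF ab]] .
    then show "length b \<le> length a + D * len g" "length a \<le> length b + D * len g" using c by auto
  qed
  then show ?thesis by blast
qed

section \<open>Flats spanned by two elements \<open>z\<close> at incomparable addresses\<close>

abbreviation "zz a \<equiv> {z a, inv (z a)}"

lemma zz_fix: "w \<in> zz a \<Longrightarrow> incomparable a b \<Longrightarrow> R w b b"
  using z_fix R_inv by auto

lemma zz_in: "w \<in> zz a \<Longrightarrow> w \<in> carrier G" by auto

lemma zz_commute:
  assumes "w \<in> zz a" "v \<in> zz b" "incomparable a b" shows "w \<otimes> v = v \<otimes> w"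
proof -
  have "z a \<otimes> v = v \<otimes> z a" using zz_fix[OF assms(2) incomparable_sym[OF assms(3)]] R_z by blast
  then show ?thesis using assms inv_intertwine[of "z a" "z a" v] zz_in[OF assms(2)] by auto
qed

lemma zz_pow_commute:
  assumes "w \<in> zz a" "v \<in> zz b" "incomparable a b"
  shows "w [^] (j::nat) \<otimes> v [^] (k::nat) = v [^] k \<otimes> w [^] j"
proof -
  have "v \<otimes> w [^] j = w [^] j \<otimes> v"
    using pow_intertwine[of w w v j] zz_commute[OF assms] zz_in assms by auto
  then have "v [^] k \<otimes> w [^] j = w [^] j \<otimes> v [^] k" 
    using zz_in[OF assms(1)] zz_in[OF assms(2)] by (intro pow_intertwine) auto
  then show ?thesis by simp
qed

text \<open>Each power of \<open>z a\<close> removes one letter \<open>False\<close> below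
  \<open>a\<close>, and its inverse adds one. The depth thus changes by \<open>j\<close>, which
  bounds the word length from below.\<close>

lemma zz_pow_shift:
  assumes "w \<in> zz a"
  shows "R (w [^] (j::nat)) (a @ replicate (Suc j) False) (a @ [False]) \<or>
         R (w [^] j) (a @ [False]) (a @ replicate (Suc j) False)"
proof -
  have *: "R (z a [^] j) (a @ replicate (Suc j) False) (a @ [False])" for j :: nat
  proof (induction j)
    case 0 then show ?case using R_one by simp
  next
    case (Suc j)
    have "R (z a) (a @ replicate (Suc (Suc j)) False) (a @ replicate (Suc j) False)"
      using R_append[OF z_left[of a], of "replicate j False"] by simp
    then show ?case using R_mult Suc nat_pow_Suc2[OF z_in] by metis
  qed
  have "R (inv (z a) [^] j) (a @ [False]) (a @ replicate (Suc j) False)"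
    using R_inv[OF *[of j]] by (simp add: nat_pow_inv)
  with * assms show ?thesis by auto
qed

text \<open>The factor \<open>v\<close> fixes every address below \<open>a\<close>, so the change of
  depth there comes from \<open>w\<close> alone; by symmetry the second coordinate is seen below
  \<open>b\<close>.\<close>

lemma undistorted:
  assumes D: "distortion D" and w: "w \<in> zz a" and v: "v \<in> zz b" and ab: "incomparable a b"
  shows "j \<le> D * len (w [^] (j::nat) \<otimes> v [^] (k::nat))" "k \<le> D * len (w [^] j \<otimes> v [^] k)"
proof -
  have one: "j \<le> D * len (w [^] (j::nat) \<otimes> v [^] (k::nat))"
    if w: "w \<in> zz a" and v: "v \<in> zz b" and ab: "incomparable a b" for w a v b j k
  proof -
    have fx: "R (v [^] k) (a @ x) (a @ x)" for x
      using R_append[OF R_pow_fix[OF zz_fix[OF v incomparable_sym[OF ab]]]] .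
    have "R (w [^] j \<otimes> v [^] k) (a @ replicate (Suc j) False) (a @ [False]) \<or>
          R (w [^] j \<otimes> v [^] k) (a @ [False]) (a @ replicate (Suc j) False)"
      using zz_pow_shift[OF w, of j] R_mult fx by blast
    moreover have "w [^] j \<otimes> v [^] k \<in> carrier G" using zz_in[OF w] zz_in[OF v] by auto
    ultimately have "length (a @ replicate (Suc j) False) \<le> length (a @ [False]) + D * len (w [^] j \<otimes> v [^] k)"
      using D unfolding distortion_def by blast
    then show ?thesis by simp
  qed
  show "j \<le> D * len (w [^] (j::nat) \<otimes> v [^] (k::nat))" using one[OF w v ab] .
  show "k \<le> D * len (w [^] j \<otimes> v [^] k)" 
    using one[OF v w incomparable_sym[OF ab], of k j] zz_pow_commute[OF w v ab] by simp
qed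

lemma len_zz: "w \<in> zz a \<Longrightarrow> len w = len (z a)" using len_inv by auto

text \<open>
  One of the two rays \<open>x z(a)^k\<close> and \<open>x z(a)^-k\<close> stays far from \<open>\<one>\<close>: otherwise two points on different
  rays would be close to each other, although the line is undistorted and \<open>x\<close> is far away.
\<close>

lemma escape:
  assumes D: "distortion D" and x: "x \<in> carrier G" "r \<le> real (len x)" "0 \<le> r" and l: "real (len (z a)) \<le> l"
  obtains w where "w \<in> zz a" "\<And>k::nat. r / (1 + 2 * real D * l) \<le> real (len (x \<otimes> w [^] k))"
proof -
  \<comment> \<open>If the rays came within \<open>?d\<close> of the identity at exponents
    \<open>k\<close> and \<open>m\<close>, then \<open>m + k\<close> would be at most
    \<open>2 * D * ?d\<close>, hence \<open>len x\<close> less than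
    \<open>?d + 2 * D * ?d * l\<close>, which is \<open>r\<close>.\<close>
  let ?d = "r / (1 + 2 * real D * l)"
  have l0: "0 \<le> l" using l by linarith
  then have den: "0 < 1 + 2 * real D * l" by (intro add_pos_nonneg) auto
  have "(\<forall>k::nat. ?d \<le> real (len (x \<otimes> z a [^] k))) \<or> (\<forall>k::nat. ?d \<le> real (len (x \<otimes> inv (z a) [^] k)))"
  proof (rule ccontr)
    assume "\<not> ?thesis"
    then obtain k m :: nat where k: "real (len (x \<otimes> z a [^] k)) < ?d" and m: "real (len (x \<otimes> inv (z a) [^] m)) < ?d"
      by (auto simp: not_le)
    have e: "inv (x \<otimes> inv (z a) [^] m) \<otimes> (x \<otimes> z a [^] k) = z a [^] (m + k)"
    proof -
      have "inv (x \<otimes> inv (z a) [^] m) = z a [^] m \<otimes> inv x" using x by (simp add: inv_mult_group nat_pow_inv)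
      then show ?thesis using x by (simp add: m_assoc nat_pow_mult[symmetric]) (simp add: m_assoc[symmetric])
    qed
    have "m + k \<le> D * len (z a [^] (m + k))"
    proof -
      have "R (z a [^] (m+k)) (a @ replicate (Suc (m+k)) False) (a @ [False]) \<or>
         R (z a [^] (m+k)) (a @ [False]) (a @ replicate (Suc (m+k)) False)" by (rule zz_pow_shift) simp
      moreover have "z a [^] (m+k) \<in> carrier G" by simp
      ultimately have "length (a @ replicate (Suc (m+k)) False) \<le> length (a @ [False]) + D * len (z a [^] (m+k))"
        using D unfolding distortion_def by blast
      then show ?thesis by simp
    qed
    moreover have "len (z a [^] (m + k)) \<le> len (x \<otimes> inv (z a) [^] m) + len (x \<otimes> z a [^] k)"
      unfolding e[symmetric] using len_mult[of "inv (x \<otimes> inv (z a) [^] m)" "x \<otimes> z a [^] k"] x len_inv by simp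
    ultimately have "m + k \<le> D * (len (x \<otimes> inv (z a) [^] m) + len (x \<otimes> z a [^] k))"
      by (meson mult_le_mono2 order_trans)
    then have "real (m + k) \<le> real D * (real (len (x \<otimes> inv (z a) [^] m)) + real (len (x \<otimes> z a [^] k)))"
      by (metis of_nat_add of_nat_le_iff of_nat_mult)
    also have "\<dots> \<le> real D * (2 * ?d)" using k m by (intro mult_left_mono) auto
    also have "real D * (2 * ?d) = 2 * real D * ?d" by (simp only: mult.assoc mult.left_commute)
    finally have "real (m + k) \<le> 2 * real D * ?d" .
    then have kd: "real k \<le> 2 * real D * ?d" by (rule order_trans[rotated]) simp
    have "len x \<le> len (x \<otimes> z a [^] k) + k * len (z a)"
      using len_right[of x "z a [^] k"] len_pow[of "z a" k] x by simp
    then have "real (len x) \<le> real (len (x \<otimes> z a [^] k)) + real k * real (len (z a))"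
      by (metis of_nat_add of_nat_le_iff of_nat_mult)
    also have "\<dots> < ?d + (2 * real D * ?d) * l"
      using k kd l l0 by (intro add_less_le_mono mult_mono) auto
    also have "\<dots> = ?d * (1 + 2 * real D * l)"
    proof -
      have "d + (2 * real D * d) * l = d * (1 + 2 * real D * l)" for d :: real by (simp add: algebra_simps)
      then show ?thesis .
    qed
    also have "\<dots> = r" using den by simp
    finally show False using x by simp
  qed
  with that show ?thesis by blast
qed

text \<open>Walk in the flat through \<open>y\<close> spanned by \<open>z a\<close> and
  \<open>z b\<close>: from \<open>u^K\<close> up to \<open>u^K v^K\<close>, back down to
  \<open>v^K\<close>, and likewise for the second ray. One coordinate is always \<open>K\<close>, so
  by \<open>undistorted\<close> the path stays far from \<open>y\<close>, and for large
  \<open>K\<close> far from the identity.\<close>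

lemma corner:
  assumes D: "distortion D" and y: "y \<in> carrier G" and ab: "incomparable a b"
    and l: "real (len (z a)) \<le> l" "real (len (z b)) \<le> l"
    and w: "w \<in> zz a" "w' \<in> zz a" and K: "real D * (real (len y) + \<rho> + l) \<le> real K"
  shows "far \<rho> (4 * real K * l) (y \<otimes> w [^] K) (y \<otimes> w' [^] K)"
proof -
  have D0: "real D > 0" using D by (auto simp: distortion_def)
  have big: "\<rho> + l \<le> real (len (y \<otimes> g))" if g: "g \<in> carrier G" "K \<le> D * len g" for g
  proof -
    have "real K \<le> real D * real (len g)" using g(2) by (metis of_nat_le_iff of_nat_mult)
    then have "real D * (real (len y) + \<rho> + l) \<le> real D * real (len g)" using K by linarith
    then have "real (len y) + \<rho> + l \<le> real (len g)" using D0 by simp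
    moreover have "len g \<le> len (y \<otimes> g) + len y" using len_left[OF y g(1)] .
    ultimately show ?thesis by linarith
  qed
  let ?v = "z b"
  have v: "?v \<in> zz b" by simp
  have half: "far \<rho> (2 * real K * l) (y \<otimes> u [^] K) (y \<otimes> ?v [^] K)" if u: "u \<in> zz a" for u
  proof -
    note uc = zz_in[OF u]
    have lu: "real (len u) \<le> l" using len_zz[OF u] l by simp
    have "far \<rho> (real K * real (len ?v)) (y \<otimes> u [^] K) (y \<otimes> u [^] K \<otimes> ?v [^] K)"
    proof (rule far_pow)
      fix k assume "k \<le> K"
      have "\<rho> + l \<le> real (len (y \<otimes> (u [^] K \<otimes> ?v [^] k)))"
        using undistorted(1)[OF D u v ab, of K k] uc by (intro big) auto
      then show "\<rho> + real (len ?v) \<le> real (len (y \<otimes> u [^] K \<otimes> ?v [^] k))"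
        using uc y l by (simp add: m_assoc)
    qed (use y uc in auto)
    moreover have "far \<rho> (real K * real (len u)) (y \<otimes> ?v [^] K) (y \<otimes> ?v [^] K \<otimes> u [^] K)"
    proof (rule far_pow)
      fix k assume "k \<le> K"
      have "\<rho> + l \<le> real (len (y \<otimes> (u [^] k \<otimes> ?v [^] K)))"
        using undistorted(2)[OF D u v ab, of K k] uc by (intro big) auto
      then show "\<rho> + real (len u) \<le> real (len (y \<otimes> ?v [^] K \<otimes> u [^] k))"
        using uc y lu zz_pow_commute[OF u v ab, of k K] by (simp add: m_assoc)
    qed (use y uc in auto)
    moreover have "y \<otimes> ?v [^] K \<otimes> u [^] K = y \<otimes> u [^] K \<otimes> ?v [^] K"
      using uc y zz_pow_commute[OF u v ab, of K K] by (simp add: m_assoc)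
    ultimately have "far \<rho> (real K * real (len ?v) + real K * real (len u)) (y \<otimes> u [^] K) (y \<otimes> ?v [^] K)"
      using far_trans far_sym by metis
    moreover have "real K * real (len ?v) \<le> real K * l" "real K * real (len u) \<le> real K * l" 
      using lu l by (intro mult_left_mono; simp)+
    ultimately show ?thesis by (auto elim: far_mono)
  qed
  show ?thesis using far_trans[OF half[OF w(1)] far_sym[OF half[OF w(2)]]] by (rule far_mono) auto
qed

text \<open>The route is \<open>x\<close>, \<open>x w^K\<close>, \<open>x w^K q = x q w'^K\<close>,
  \<open>x q u^K\<close>, \<open>x q\<close>: out along an escaping ray, across by \<open>q\<close>,
  around a corner, and back along a ray escaping from \<open>x q\<close>. The corner costs
  \<open>4 * K * l\<close>, the two rays \<open>K * l\<close> each.\<close>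

lemma move:
  assumes D: "distortion D" and q: "R q a a'" and ab: "incomparable a' b'"
    and l: "real (len (z a)) \<le> l" "real (len (z a')) \<le> l" "real (len (z b')) \<le> l"
    and x: "x \<in> carrier G" "r \<le> real (len x)" "r \<le> real (len (x \<otimes> q))" "0 \<le> r"
    and \<rho>: "\<rho> + l \<le> r / (1 + 2 * real D * l)"
    and K: "real D * (real (len x) + real (len q) + \<rho> + l) \<le> real K"
  shows "far \<rho> (6 * real K * l + real (len q)) x (x \<otimes> q)"
proof -
  have qc: "q \<in> carrier G" using R_in q by blast
  have D0: "real D > 0" using D by (auto simp: distortion_def)
  let ?y = "x \<otimes> q"
  have ray: "far \<rho> (real K * l) p (p \<otimes> w [^] K)" 
    if "p \<in> carrier G" "w \<in> zz c" "\<And>k::nat. r / (1 + 2 * real D * l) \<le> real (len (p \<otimes> w [^] k))" "real (len (z c)) \<le> l" for p w c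
  proof -
    have lw: "real (len w) \<le> l" using len_zz that by simp
    have "far \<rho> (real K * real (len w)) p (p \<otimes> w [^] K)"
    proof (rule far_pow)
      fix k :: nat
      show "\<rho> + real (len w) \<le> real (len (p \<otimes> w [^] k))" using that(3)[of k] lw \<rho> by linarith
    qed (use that(1) zz_in[OF that(2)] in auto)
    then show ?thesis using lw by (auto elim!: far_mono intro: mult_left_mono)
  qed
  obtain w where w: "w \<in> zz a" "\<And>k::nat. r / (1 + 2 * real D * l) \<le> real (len (x \<otimes> w [^] k))"
    using escape[OF D x(1,2,4) l(1)] by blast
  obtain u where u: "u \<in> zz a'" "\<And>k::nat. r / (1 + 2 * real D * l) \<le> real (len (?y \<otimes> u [^] k))"
    using escape[OF D _ x(3,4) l(2)] x qc by blast
  \<comment> \<open>\<open>w'\<close> has the same sign as \<open>w\<close>, but the ray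
    \<open>u\<close> that escapes from \<open>x q\<close> may have the other sign; this is why the
    corner is needed.\<close>
  obtain w' where w': "w' \<in> zz a'" "w \<otimes> q = q \<otimes> w'"
    using w(1) R_z[OF q] inv_intertwine[of "z a" "z a'" q] qc by auto
  note wc = zz_in[OF w(1)] zz_in[OF w'(1)]
  have 1: "far \<rho> (real K * l) x (x \<otimes> w [^] K)" using ray[OF x(1) w l(1)] .
  have 4: "far \<rho> (real K * l) ?y (?y \<otimes> u [^] K)" using ray[OF _ u l(2)] x qc by simp
  have "far \<rho> (real (len q)) (x \<otimes> w [^] K) (x \<otimes> w [^] K \<otimes> q)"
  proof (rule far_word)
    have "K \<le> D * len (w [^] K)"
    proof -
      have "R (w [^] K) (a @ replicate (Suc K) False) (a @ [False]) \<or>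
         R (w [^] K) (a @ [False]) (a @ replicate (Suc K) False)" by (rule zz_pow_shift[OF w(1)])
      then have "length (a @ replicate (Suc K) False) \<le> length (a @ [False]) + D * len (w [^] K)"
        using D nat_pow_closed[OF wc(1)] unfolding distortion_def by blast
      then show ?thesis by simp
    qed
    then have "real K \<le> real D * real (len (w [^] K))" by (metis of_nat_le_iff of_nat_mult)
    then have "real D * (real (len x) + real (len q) + \<rho> + l) \<le> real D * real (len (w [^] K))" using K by linarith
    then have "real (len x) + real (len q) + \<rho> + l \<le> real (len (w [^] K))" using D0 by simp
    moreover have "len (w [^] K) \<le> len (x \<otimes> w [^] K) + len x" using len_left x wc by simp
    ultimately show "\<rho> + real (len q) \<le> real (len (x \<otimes> w [^] K))" using l(1) by linarith
  qed (use x wc qc in auto)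
  moreover have "x \<otimes> w [^] K \<otimes> q = ?y \<otimes> w' [^] K"
    using pow_intertwine[OF wc qc w'(2), of K] x wc qc by (simp add: m_assoc)
  ultimately have 2: "far \<rho> (real (len q)) (x \<otimes> w [^] K) (?y \<otimes> w' [^] K)" by simp
  have "real (len ?y) \<le> real (len x) + real (len q)" using len_mult[OF x(1) qc] by linarith
  then have "real D * (real (len ?y) + \<rho> + l) \<le> real K" using K D0 
    by (intro order_trans[OF _ K] mult_left_mono) auto
  then have 3: "far \<rho> (4 * real K * l) (?y \<otimes> w' [^] K) (?y \<otimes> u [^] K)"
    using x qc by (intro corner[OF D _ ab l(2,3) w'(1) u(1)]) auto
  have "far \<rho> (real K * l + real (len q) + 4 * real K * l + real K * l) x ?y"
    by (rule far_trans[OF far_trans[OF far_trans[OF 1 2] 3] far_sym[OF 4]])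
  then show ?thesis by (rule far_mono) auto
qed

end

section \<open>Bringing ribbons to standard addresses, and linear divergence\<close>

context ribbon_group begin

lemma z_fix': "(\<And>x y. a @ x \<noteq> b @ y) \<Longrightarrow> R (z a) b b"
  by (rule z_fix) (metis incomparable_def append_Nil2)

text \<open>\<open>z [c]\<close> and \<open>z [c, True]\<close> play the roles of the two standard
  generators of Thompson's group below \<open>c\<close>, and so fix the other half. They shorten any
  \<open>b\<close> containing both letters to \<open>[True, False]\<close>, with at most three
  factors for each letter.\<close>

lemma retract_address:
  assumes l: "real (len (z [c])) \<le> l" "real (len (z [c, True])) \<le> l"
  shows "True \<in> set b \<Longrightarrow> False \<in> set b \<Longrightarrow>
    \<exists>w. R w (c # b) [c, True, False] \<and> R w [\<not> c] [\<not> c] \<and> real (len w) \<le> 3 * l * real (length b)"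
proof (induction "length b" arbitrary: b rule: less_induct)
  case less
  have l0: "0 \<le> l" using l by linarith
  have fx: "R (z [c]) [\<not> c] [\<not> c]" "R (z [c, True]) [\<not> c] [\<not> c]" "R (inv (z [c])) [\<not> c] [\<not> c]"
    by (auto intro!: z_fix' R_inv)
  have li: "real (len (inv (z [c]))) \<le> l" using l by (simp add: len_inv)
  note z0 = R_append[OF z_left[of "[c]"]] and z1 = R_append[OF z_mid[of "[c]"]]
    and z2 = R_append[OF R_inv[OF z_right[of "[c]"]]]
    and y0 = R_append[OF z_left[of "[c, True]"]] and y1 = R_append[OF z_mid[of "[c, True]"]]
  have step: "\<exists>w. R w (c # b1) [c, True, False] \<and> R w [\<not> c] [\<not> c] \<and> real (len w) \<le> C + l"
    if "\<exists>w. R w (c # b2) [c, True, False] \<and> R w [\<not> c] [\<not> c] \<and> real (len w) \<le> C"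
      and "R u (c # b1) (c # b2)" "R u [\<not> c] [\<not> c]" "real (len u) \<le> l" for u b1 b2 C
  proof -
    from that(1) obtain w where w: "R w (c # b2) [c, True, False]" "R w [\<not> c] [\<not> c]" "real (len w) \<le> C" by blast
    have "len (u \<otimes> w) \<le> len u + len w" using len_mult R_in w(1) that(2) by blast
    then have "real (len (u \<otimes> w)) \<le> C + l" using w(3) that(4) by linarith
    then show ?thesis using R_mult w that by blast
  qed
  \<comment> \<open>Once the word starts with \<open>True, False\<close>, its third letter is
    removed: \<open>False\<close> by one \<open>z [c, True]\<close>; \<open>True\<close> by moving
    it forward with \<open>z [c, True]\<close> and cancelling with the inverse of
    \<open>z [c]\<close>.\<close>
  have TF: "\<exists>w. R w (c # True # False # b') [c, True, False] \<and> R w [\<not> c] [\<not> c] \<and> 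
      real (len w) \<le> 3 * l * (real (length b') + 1) + 2 * l" if b': "Suc (Suc (length b')) \<le> length b" for b'
  proof (cases b')
    case Nil
    then show ?thesis using R_one[of "[c, True, False]"] R_one[of "[\<not> c]"] l0 by (intro exI[of _ \<one>]) auto
  next
    case (Cons x b2)
    have IH: "\<exists>w. R w (c # True # False # b2) [c, True, False] \<and> R w [\<not> c] [\<not> c] \<and> 
        real (len w) \<le> 3 * l * (real (length b') + 1)"
      using less.hyps[of "True # False # b2"] b' Cons by (simp add: add.commute)
    show ?thesis
    proof (cases x)
      case False
      have "\<exists>w. R w (c # True # False # b') [c, True, False] \<and> R w [\<not> c] [\<not> c] \<and> 
          real (len w) \<le> 3 * l * (real (length b') + 1) + l"
        using y0[of b2] Cons False fx l by (intro step[OF IH, of "z [c, True]"]) auto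
      then show ?thesis using l0 by force
    next
      case True
      have "\<exists>w. R w (c # True # True # False # b2) [c, True, False] \<and> R w [\<not> c] [\<not> c] \<and> 
          real (len w) \<le> 3 * l * (real (length b') + 1) + l"
        using z2[of "False # b2"] fx li by (intro step[OF IH, of "inv (z [c])"]) auto
      from step[OF this, of "z [c, True]" "True # False # b'"] y1[of b2] Cons True fx l show ?thesis by auto
    qed
  qed
  obtain x1 x2 b' where b: "b = x1 # x2 # b'" using less.prems by (cases b; cases "tl b") auto
  show ?case
  \<comment> \<open>Two equal initial letters are merged by \<open>z [c]\<close> or its inverse;
    \<open>False, True\<close> is turned into \<open>True, False\<close> by \<open>z [c]\<close>,
    and then \<open>TF\<close> applies.\<close>
  proof (cases "x1 = x2")
    case True
    have IH: "\<exists>w. R w (c # x2 # b') [c, True, False] \<and> R w [\<not> c] [\<not> c] \<and> 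
        real (len w) \<le> 3 * l * real (length (x2 # b'))"
      using less.hyps[of "x2 # b'"] less.prems b True by auto
    have "\<exists>w. R w (c # b) [c, True, False] \<and> R w [\<not> c] [\<not> c] \<and> 
        real (len w) \<le> 3 * l * real (length (x2 # b')) + l"
    proof (cases x1)
      case x1: True
      then show ?thesis using z2[of b'] fx li b True by (intro step[OF IH, of "inv (z [c])"]) auto
    next
      case x1: False
      then show ?thesis using z0[of b'] fx l b True by (intro step[OF IH, of "z [c]"]) auto
    qed
    then show ?thesis using l0 b by (force simp: algebra_simps)
  next
    case False
    note t = TF[of b']
    show ?thesis
    proof (cases x1)
      case True
      then have "b = True # False # b'" using b False by simp
      then show ?thesis using t l0 by (force simp: algebra_simps)
    next
      case x1: False
      then have bb: "b = False # True # b'" using b False by simp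
      have "\<exists>w. R w (c # b) [c, True, False] \<and> R w [\<not> c] [\<not> c] \<and> 
          real (len w) \<le> (3 * l * (real (length b') + 1) + 2 * l) + l"
        using z1[of b'] fx l bb by (intro step[of "True # False # b'" _ "z [c]"] t) auto
      then show ?thesis using l0 bb by (force simp: algebra_simps)
    qed
  qed
qed

text \<open>\<open>g\<close> carries some ribbon of depth linear in \<open>len g\<close>. Retracting
  its address and its image to depth 3 costs \<open>w1\<close> and \<open>w2\<close>, and the
  remaining middle factor \<open>h\<close> carries a ribbon between standard addresses. Each factor
  thus carries a ribbon of bounded depth.\<close>

lemma decompose:
  assumes D: "distortion D" and g: "g \<in> carrier G" 
    and l: "\<And>c. real (len (z [c])) \<le> l" "\<And>c. real (len (z [c, True])) \<le> l"
  obtains c w1 w2 h where "R w1 [True] [True]" "R w2 [\<not> c] [\<not> c]" "R h [False, True, False] [c, True, False]"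
    "g = w1 \<otimes> h \<otimes> inv w2" "real (len w1) \<le> 3 * l * (2 * real D * real (len g) + 3)" 
    "real (len w2) \<le> 3 * l * (2 * real D * real (len g) + 3)"
proof -
  have l0: "0 \<le> l" using l(1)[of True] by linarith
  let ?m = "D * len g"
  \<comment> \<open>Deep enough to be carried, with one extra letter so that the image is nonempty
    and has a first letter \<open>c\<close>.\<close>
  let ?a = "False # replicate ?m False"
  obtain b where b: "R g ?a b" using D g unfolding distortion_def by force
  have lb: "length b \<le> length ?a + ?m" "length ?a \<le> length b + ?m" using D g b unfolding distortion_def by blast+
  then have "b \<noteq> []" by auto
  then obtain c b2 where cb: "b = c # b2" by (cases b) auto
  \<comment> \<open>Appending \<open>[True, False]\<close> ensures that both letters occur, as
    \<open>retract_address\<close> requires.\<close>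
  have gb: "R g (False # (replicate ?m False @ [True, False])) (c # (b2 @ [True, False]))"
    using R_append[OF b, of "[True, False]"] cb by simp
  obtain w1 where w1: "R w1 (False # (replicate ?m False @ [True, False])) [False, True, False]" "R w1 [True] [True]"
    "real (len w1) \<le> 3 * l * real (length (replicate ?m False @ [True, False]))"
    using retract_address[of False l "replicate ?m False @ [True, False]"] l by auto
  obtain w2 where w2: "R w2 (c # (b2 @ [True, False])) [c, True, False]" "R w2 [\<not> c] [\<not> c]"
    "real (len w2) \<le> 3 * l * real (length (b2 @ [True, False]))"
    using retract_address[of c l "b2 @ [True, False]"] l by auto
  have c: "w1 \<in> carrier G" "w2 \<in> carrier G" using R_in w1 w2 by blast+
  define h where "h = inv w1 \<otimes> g \<otimes> w2"
  have "R h [False, True, False] [c, True, False]"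
    unfolding h_def using R_mult[OF R_mult[OF R_inv[OF w1(1)] gb] w2(1)] .
  moreover have "g = w1 \<otimes> h \<otimes> inv w2"
  proof -
    have "w1 \<otimes> (inv w1 \<otimes> g) = g" using c g by (simp add: m_assoc[symmetric])
    then show ?thesis unfolding h_def using c g by (simp add: m_assoc)
  qed
  moreover have "real (length (replicate ?m False @ [True, False])) \<le> 2 * real D * real (len g) + 3" by simp
  then have "real (len w1) \<le> 3 * l * (2 * real D * real (len g) + 3)"
    using w1(3) l0 by (meson mult_left_mono order_trans zero_le_mult_iff zero_le_numeral)
  moreover have "length (b2 @ [True, False]) \<le> 2 * ?m + 3" using lb cb by simp
  then have "real (length (b2 @ [True, False])) \<le> real (2 * ?m + 3)" by (rule of_nat_mono)
  then have "real (length (b2 @ [True, False])) \<le> 2 * real D * real (len g) + 3" by (simp add: algebra_simps)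
  then have "real (len w2) \<le> 3 * l * (2 * real D * real (len g) + 3)"
    using w2(3) l0 by (meson mult_left_mono order_trans zero_le_mult_iff zero_le_numeral)
  ultimately show ?thesis using that w1(2) w2(2) by blast
qed

text \<open>\<open>move\<close> with all quantities proportional to the scale \<open>r\<close>;
  \<delta>, \<open>r0\<close> and \<open>L\<close> depend only on \<open>D\<close>, \<open>l\<close>
  and \<Gamma>.\<close>

lemma move_linear:
  assumes D: "distortion D" and l: "1 \<le> l" and \<Gamma>: "1 \<le> \<Gamma>"
  shows "\<exists>\<delta> r0 L. \<delta> > 0 \<and> (\<forall>r x q a a' b'. r0 \<le> r \<longrightarrow> R q a a' \<longrightarrow> incomparable a' b' \<longrightarrow>
     real (len (z a)) \<le> l \<longrightarrow> real (len (z a')) \<le> l \<longrightarrow> real (len (z b')) \<le> l \<longrightarrow> x \<in> carrier G \<longrightarrow> r \<le> real (len x) \<longrightarrow>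
     r \<le> real (len (x \<otimes> q)) \<longrightarrow> real (len x) \<le> \<Gamma> * r \<longrightarrow> real (len q) \<le> \<Gamma> * r \<longrightarrow> far (\<delta> * r) (L * r) x (x \<otimes> q))"
proof -
  have D0: "1 \<le> real D" using D by (auto simp: distortion_def)
  \<comment> \<open>Half of the escape ratio; the other half absorbs the margin \<open>l\<close> as
    soon as \<open>l \<le> \<delta> * r\<close>.\<close>
  define \<delta> where "\<delta> = 1 / (2 * (1 + 2 * real D * l))"
  have Dl: "0 \<le> real D * l" using D0 l by simp
  then have \<delta>: "\<delta> > 0" "\<delta> \<le> 1/2" by (auto simp: \<delta>_def field_simps)
  define r0 where "r0 = max 1 (l / \<delta>)"
  \<comment> \<open>Both lengths are at most \<open>\<Gamma> * r\<close> and
    \<open>\<delta> * r + l \<le> r\<close>, so an exponent \<open>K \<ge> \<kappa> * r\<close> is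
    large enough for \<open>move\<close>.\<close>
  define \<kappa> where "\<kappa> = real D * (2 * \<Gamma> + 1)"
  have \<kappa>: "\<kappa> \<ge> 0" using D0 \<Gamma> by (simp add: \<kappa>_def)
  define L where "L = 6 * (\<kappa> + 1) * l + \<Gamma>"
  have "far (\<delta> * r) (L * r) x (x \<otimes> q)"
    if "r0 \<le> r" and h: "R q a a'" "incomparable a' b'"
     "real (len (z a)) \<le> l" "real (len (z a')) \<le> l" "real (len (z b')) \<le> l" "x \<in> carrier G" "r \<le> real (len x)"
     "r \<le> real (len (x \<otimes> q))" "real (len x) \<le> \<Gamma> * r" "real (len q) \<le> \<Gamma> * r" for r x q a a' b'
  proof -
    have r: "1 \<le> r" "l \<le> \<delta> * r" using that(1) \<delta> by (auto simp: r0_def field_simps)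
    define K where "K = nat \<lceil>\<kappa> * r\<rceil>"
    have kr: "0 \<le> \<kappa> * r" using \<kappa> r by simp
    have K: "\<kappa> * r \<le> real K" "real K \<le> (\<kappa> + 1) * r"
    proof -
      show "\<kappa> * r \<le> real K" unfolding K_def by (rule real_nat_ceiling_ge)
      have "real K = of_int \<lceil>\<kappa> * r\<rceil>" using kr by (simp add: K_def)
      then show "real K \<le> (\<kappa> + 1) * r" using r ceiling_correct[of "\<kappa> * r"] by (simp add: algebra_simps)
    qed
    have rho: "\<delta> * r + l \<le> r / (1 + 2 * real D * l)"
    proof -
      have "r / (1 + 2 * real D * l) = 2 * (\<delta> * r)" using Dl by (simp add: \<delta>_def field_simps)
      then show ?thesis using r by simp
    qed
    have "\<delta> * r \<le> 1/2 * r" using \<delta> r by (intro mult_right_mono) auto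
    moreover have "(2 * \<Gamma> + 1) * r = 2 * (\<Gamma> * r) + r" by (simp add: algebra_simps)
    ultimately have "real (len x) + real (len q) + \<delta> * r + l \<le> (2 * \<Gamma> + 1) * r"
      using h(9,10) r by linarith
    then have "real D * (real (len x) + real (len q) + \<delta> * r + l) \<le> real D * ((2 * \<Gamma> + 1) * r)"
      by (rule mult_left_mono) simp
    also have "\<dots> = \<kappa> * r" by (simp add: \<kappa>_def)
    finally have KK: "real D * (real (len x) + real (len q) + \<delta> * r + l) \<le> real K" using K by linarith
    have "far (\<delta> * r) (6 * real K * l + real (len q)) x (x \<otimes> q)"
      using r by (intro move[OF D h(1-8) _ rho KK]) simp
    moreover have "6 * real K * l + real (len q) \<le> L * r"
    proof -
      have "real K * l \<le> (\<kappa> + 1) * r * l" using K l by (intro mult_right_mono) auto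
      then show ?thesis using h(10) by (simp add: L_def algebra_simps)
    qed
    ultimately show ?thesis by (rule far_mono[OF _ order_refl])
  qed
  with \<delta>(1) show ?thesis by (intro exI[of _ \<delta>] exI[of _ r0] exI[of _ L]) simp
qed

lemma incomparable_cases [simp]:
  "incomparable [c] [\<not> c]" "incomparable [\<not> c] [c]" "incomparable [c, True, False] [c, False]" "incomparable [c, False] [c, True, False]"
  "incomparable [c, False] [\<not> c]" "incomparable [False, False] [True]" "incomparable [True] [False]"
  by (auto simp: incomparable_def)

text \<open>Powers of \<open>z a\<close> grow at rate at least \<open>1 / D\<close>, and multiplying
  by \<open>x\<close> loses at most \<open>len x\<close>.\<close>

lemma len_pow_ge:
  assumes "distortion D" "x \<in> carrier G" shows "real k / real D - real (len x) \<le> real (len (x \<otimes> z a [^] (k::nat)))"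
proof -
  have D0: "real D > 0" using assms by (auto simp: distortion_def)
  have "R (z a [^] k) (a @ replicate (Suc k) False) (a @ [False]) \<or>
       R (z a [^] k) (a @ [False]) (a @ replicate (Suc k) False)" by (rule zz_pow_shift) simp
  moreover have "z a [^] k \<in> carrier G" by simp
  ultimately have "length (a @ replicate (Suc k) False) \<le> length (a @ [False]) + D * len (z a [^] k)"
    using assms(1) unfolding distortion_def by blast
  then have "k \<le> D * len (z a [^] k)" by simp
  then have "real k \<le> real D * real (len (z a [^] k))" by (metis of_nat_le_iff of_nat_mult)
  then have "real k / real D \<le> real (len (z a [^] k))" using D0 by (simp add: field_simps)
  moreover have "len (z a [^] k) \<le> len (x \<otimes> z a [^] k) + len x" using len_left assms(2) by simp
  ultimately show ?thesis by linarith
qed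

text \<open>
  For \<open>g = w1 h w2\<^sup>-\<^sup>1\<close> the path passes through points close to
  \<open>g\<close>, \<open>g w2\<close>, \<open>w1\<close> and \<open>\<one>\<close>, each pushed away from \<open>\<one>\<close> by a high power of a \<open>z\<close> that commutes
  with both neighbouring steps.
\<close>

theorem linear_divergence:
  assumes M: "1 \<le> M"
  shows "\<exists>\<delta>>0. \<exists>L r0. \<forall>r\<ge>r0. \<exists>\<tau>. \<forall>g\<in>carrier G.
      r \<le> real (len g) \<longrightarrow> real (len g) \<le> M * r \<longrightarrow> far (\<delta> * r) (L * r) g \<tau>"
proof -
  obtain D where D: "distortion D" using distortion_exists by blast
  have D0: "1 \<le> real D" using D by (auto simp: distortion_def)
  \<comment> \<open>One bound for all the finitely many \<open>z\<close> that will occur; the 1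
    gives \<open>1 \<le> l\<close>.\<close>
  define l where "l = Max ((\<lambda>a. real (len (z a))) ` (range (\<lambda>c. [c]) \<union> range (\<lambda>c. [c, True]) \<union> range (\<lambda>c. [c, False])
     \<union> range (\<lambda>c. [c, True, False])) \<union> {1})"
  have fin: "finite (range (\<lambda>c :: bool. [c]) \<union> range (\<lambda>c. [c, True]) \<union> range (\<lambda>c. [c, False])
     \<union> range (\<lambda>c. [c, True, False]))"
    by simp
  have l: "1 \<le> l" "real (len (z [c])) \<le> l" "real (len (z [c, True])) \<le> l" "real (len (z [c, False])) \<le> l" 
    "real (len (z [c, True, False])) \<le> l" for c
    unfolding l_def by (rule Max_ge; use fin in auto)+
  \<comment> \<open>The bound on \<open>w1\<close> and \<open>w2\<close> from
    \<open>decompose\<close> at \<open>len g = M * r\<close>, divided by \<open>r\<close>.\<close>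
  define \<beta> where "\<beta> = 3 * l * (2 * real D * M + 3)"
  have \<beta>: "0 \<le> \<beta>" using l(1) M D0 by (simp add: \<beta>_def)
  \<comment> \<open>With \<open>K \<ge> \<kappa> * r\<close> the power contributes at least
    \<open>(1 + M + \<beta>) * r\<close>. Subtracting the length of \<open>g w2\<close>, at most
    \<open>(M + \<beta>) * r\<close>, still leaves \<open>r\<close>.\<close>
  define \<kappa> where "\<kappa> = real D * (1 + M + \<beta>)"
  have \<kappa>: "0 \<le> \<kappa>" using \<beta> M D0 by (simp add: \<kappa>_def)
  \<comment> \<open>Large enough for every intermediate point and every step; the step
    \<open>?q2\<close> contains \<open>h\<close> and two powers.\<close>
  define \<Gamma> where "\<Gamma> = M + 3 * \<beta> + 2 * (\<kappa> + 1) * l"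
  have \<Gamma>: "1 \<le> \<Gamma>" using M \<beta> \<kappa> l(1) by (simp add: \<Gamma>_def add_increasing2)
  obtain \<delta> r0 L where \<delta>: "\<delta> > 0" and mv: "\<forall>r x q a a' b'. r0 \<le> r \<longrightarrow> R q a a' \<longrightarrow> incomparable a' b' \<longrightarrow>
     real (len (z a)) \<le> l \<longrightarrow> real (len (z a')) \<le> l \<longrightarrow> real (len (z b')) \<le> l \<longrightarrow> x \<in> carrier G \<longrightarrow> r \<le> real (len x) \<longrightarrow>
     r \<le> real (len (x \<otimes> q)) \<longrightarrow> real (len x) \<le> \<Gamma> * r \<longrightarrow> real (len q) \<le> \<Gamma> * r \<longrightarrow> far (\<delta> * r) (L * r) x (x \<otimes> q)"
    using move_linear[OF D l(1) \<Gamma>] by (elim exE conjE)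
  note mv = mv[rule_format]
  have main: "\<exists>\<tau>. \<forall>g\<in>carrier G. r \<le> real (len g) \<longrightarrow> real (len g) \<le> M * r \<longrightarrow> far (\<delta> * r) ((3 * L) * r) g \<tau>"
    if r0: "max r0 1 \<le> r" for r
  proof -
    have r: "r0 \<le> r" "1 \<le> r" using r0 by auto
    define K where "K = nat \<lceil>\<kappa> * r\<rceil>"
    have kr: "0 \<le> \<kappa> * r" using \<kappa> r by simp
    have K: "\<kappa> * r \<le> real K" "real K \<le> (\<kappa> + 1) * r"
    proof -
      show "\<kappa> * r \<le> real K" unfolding K_def by (rule real_nat_ceiling_ge)
      have "real K = of_int \<lceil>\<kappa> * r\<rceil>" using kr by (simp add: K_def)
      then show "real K \<le> (\<kappa> + 1) * r" using r ceiling_correct[of "\<kappa> * r"] by (simp add: algebra_simps)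
    qed
    have KD: "(1 + M + \<beta>) * r \<le> real K / real D" using K(1) D0 by (simp add: \<kappa>_def field_simps)
    have Kl: "real (len (z a [^] K)) \<le> (\<kappa> + 1) * l * r" if "real (len (z a)) \<le> l" for a
    proof -
      have "real (len (z a [^] K)) \<le> real K * real (len (z a))" 
        using len_pow[OF z_in, of a K] by (metis of_nat_le_iff of_nat_mult)
      also have "\<dots> \<le> ((\<kappa> + 1) * r) * l" using K(2) that by (intro mult_mono) (use r \<kappa> in auto)
      finally show ?thesis by (simp add: mult.commute mult.left_commute)
    qed
    \<comment> \<open>The target depends on \<open>r\<close> only, through \<open>K\<close>, so any
      two elements at this scale can be joined through it.\<close>
    let ?\<tau> = "z [False, False] [^] K"
    have "far (\<delta> * r) ((3 * L) * r) g ?\<tau>"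
      if g: "g \<in> carrier G" "r \<le> real (len g)" "real (len g) \<le> M * r" for g
    proof -
      obtain c w1 w2 h where w: "R w1 [True] [True]" "R w2 [\<not> c] [\<not> c]" "R h [False, True, False] [c, True, False]"
        "g = w1 \<otimes> h \<otimes> inv w2" "real (len w1) \<le> 3 * l * (2 * real D * real (len g) + 3)" 
        "real (len w2) \<le> 3 * l * (2 * real D * real (len g) + 3)"
        using decompose[OF D g(1) l(2,3)] by metis
      have cc: "w1 \<in> carrier G" "w2 \<in> carrier G" "h \<in> carrier G" using w R_in by blast+
      have B: "3 * l * (2 * real D * real (len g) + 3) \<le> \<beta> * r"
      proof -
        have "2 * real D * real (len g) \<le> 2 * real D * (M * r)" using g(3) by (intro mult_left_mono) auto
        then have "2 * real D * real (len g) + 3 \<le> (2 * real D * M + 3) * r" using r by (simp add: algebra_simps)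
        then have "3 * l * (2 * real D * real (len g) + 3) \<le> 3 * l * ((2 * real D * M + 3) * r)" 
          using l(1) by (intro mult_left_mono) auto
        then show ?thesis by (simp add: \<beta>_def mult.assoc)
      qed
      have w1l: "real (len w1) \<le> \<beta> * r" and w2l: "real (len w2) \<le> \<beta> * r" using w(5,6) B by linarith+
      have hw: "g \<otimes> w2 = w1 \<otimes> h" using w(4) cc by (simp add: m_assoc)
      have gw: "real (len (g \<otimes> w2)) \<le> (M + \<beta>) * r"
        using len_mult[OF g(1) cc(2)] g(3) w2l by (simp add: algebra_simps)
      have hl: "real (len h) \<le> (M + 2 * \<beta>) * r"
      proof -
        have "h = inv w1 \<otimes> (g \<otimes> w2)" unfolding hw using cc by (simp add: m_assoc[symmetric])
        then have "len h \<le> len w1 + len (g \<otimes> w2)" using len_mult[of "inv w1" "g \<otimes> w2"] cc g(1) len_inv by simp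
        then show ?thesis using gw w1l by (simp add: algebra_simps)
      qed
      let ?p = "z [c, False] [^] K" and ?o = "z [False, False] [^] K"
      let ?x1 = "g \<otimes> w2 \<otimes> ?p" and ?x2 = "w1 \<otimes> ?o"
      \<comment> \<open>Each step still carries a ribbon of depth at most 3, as the powers fix it:
        \<open>?q1\<close> fixes \<open>[\<not> c]\<close>, \<open>?q2\<close> carries
        \<open>[c, True, False]\<close> to \<open>[False, True, False]\<close>, \<open>?q3\<close>
        fixes \<open>[True]\<close>.\<close>
      let ?q1 = "w2 \<otimes> ?p" and ?q2 = "inv ?p \<otimes> inv h \<otimes> ?o" and ?q3 = "inv ?o \<otimes> inv w1 \<otimes> ?o"
      have pl: "real (len ?p) \<le> (\<kappa> + 1) * l * r" "real (len ?o) \<le> (\<kappa> + 1) * l * r" using Kl l(4) by blast+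
      have x1: "?x1 = g \<otimes> ?q1" using g cc by (simp add: m_assoc)
      have x2: "?x2 = ?x1 \<otimes> ?q2"
      proof -
        have c1: "?p \<otimes> (inv ?p \<otimes> (inv h \<otimes> ?o)) = inv h \<otimes> ?o" using cc by (simp add: m_assoc[symmetric])
        have c2: "h \<otimes> (inv h \<otimes> ?o) = ?o" using cc by (simp add: m_assoc[symmetric])
        have "?x1 \<otimes> ?q2 = (g \<otimes> w2) \<otimes> (?p \<otimes> (inv ?p \<otimes> (inv h \<otimes> ?o)))" using g cc by (simp add: m_assoc)
        also have "\<dots> = w1 \<otimes> (h \<otimes> (inv h \<otimes> ?o))" unfolding c1 hw using cc by (simp add: m_assoc)
        finally show ?thesis unfolding c2 by simp
      qed
      have x3: "?o = ?x2 \<otimes> ?q3"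
      proof -
        have c1: "?o \<otimes> (inv ?o \<otimes> (inv w1 \<otimes> ?o)) = inv w1 \<otimes> ?o" using cc by (simp add: m_assoc[symmetric])
        have c2: "w1 \<otimes> (inv w1 \<otimes> ?o) = ?o" using cc by (simp add: m_assoc[symmetric])
        have "?x2 \<otimes> ?q3 = w1 \<otimes> (?o \<otimes> (inv ?o \<otimes> (inv w1 \<otimes> ?o)))" using cc by (simp add: m_assoc)
        then show ?thesis unfolding c1 c2 by simp
      qed
      have carr: "?x1 \<in> carrier G" "?x2 \<in> carrier G" using g cc by auto
      have R1: "R ?q1 [\<not> c] [\<not> c]" by (intro R_mult[OF w(2)] R_pow_fix z_fix) simp
      have Rp: "R ?p [c, True, False] [c, True, False]" by (intro R_pow_fix z_fix) simp
      have Ro: "R ?o [False, True, False] [False, True, False]" "R ?o [True] [True]" by (intro R_pow_fix z_fix; simp)+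
      have R2: "R ?q2 [c, True, False] [False, True, False]"
        using R_mult[OF R_mult[OF R_inv[OF Rp] R_inv[OF w(3)]] Ro(1)] .
      have R3: "R ?q3 [True] [True]"
        using R_mult[OF R_mult[OF R_inv[OF Ro(2)] R_inv[OF w(1)]] Ro(2)] .
      have lx1: "r \<le> real (len ?x1)"
        using len_pow_ge[OF D, of "g \<otimes> w2" K "[c, False]"] g cc KD gw by (simp add: algebra_simps)
      have lx2: "r \<le> real (len ?x2)"
      proof -
        have "r \<le> (1 + M) * r" using M r by (intro mult_le_cancel_right1[THEN iffD2]) auto
        then show ?thesis using len_pow_ge[OF D cc(1), of K "[False, False]"] KD w1l by (simp add: algebra_simps)
      qed
      have lx3: "r \<le> real (len ?o)"
      proof -
        have "1 * r \<le> (1 + M + \<beta>) * r" using M r \<beta> by (intro mult_right_mono) auto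
        then show ?thesis using len_pow_ge[OF D one_closed, of K "[False, False]"] KD by simp
      qed
      have Gr: "\<Gamma> * r = M * r + 3 * (\<beta> * r) + 2 * ((\<kappa> + 1) * l * r)" by (simp add: \<Gamma>_def algebra_simps)
      have nn: "0 \<le> M * r" "0 \<le> \<beta> * r" "0 \<le> (\<kappa> + 1) * l * r" using M \<beta> \<kappa> l(1) r by auto
      have gw': "real (len (g \<otimes> w2)) \<le> M * r + \<beta> * r" using gw by (simp add: algebra_simps)
      have hl': "real (len h) \<le> M * r + 2 * (\<beta> * r)" using hl by (simp add: algebra_simps)
      have u0: "real (len g) \<le> \<Gamma> * r" using g(3) nn Gr by linarith
      have u1: "real (len ?x1) \<le> \<Gamma> * r" 
        using len_mult[of "g \<otimes> w2" ?p] g(1) cc gw' pl nn Gr by simp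
      have u2: "real (len ?x2) \<le> \<Gamma> * r" using len_mult[of w1 ?o] cc w1l pl nn Gr by simp
      have v1: "real (len ?q1) \<le> \<Gamma> * r" using len_mult[of w2 ?p] cc w2l pl nn Gr by simp
      have v2: "real (len ?q2) \<le> \<Gamma> * r" 
        using len_mult[of "inv ?p \<otimes> inv h" ?o] len_mult[of "inv ?p" "inv h"] len_inv[of ?p] len_inv[of h] 
          cc hl' pl nn Gr by simp
      have v3: "real (len ?q3) \<le> \<Gamma> * r" 
        using len_mult[of "inv ?o \<otimes> inv w1" ?o] len_mult[of "inv ?o" "inv w1"] len_inv[of ?o] len_inv[of w1] 
          cc w1l pl nn Gr by simp
      have 1: "far (\<delta> * r) (L * r) g ?x1"
        using mv[OF r(1) R1, of "[c]" g] l(2) g u0 v1 lx1 x1 by simp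
      have 2: "far (\<delta> * r) (L * r) ?x1 ?x2"
        using mv[OF r(1) R2, of "[False, False]" ?x1] l carr u1 v2 lx1 lx2 unfolding x2[symmetric] by simp
      have 3: "far (\<delta> * r) (L * r) ?x2 ?o"
        using mv[OF r(1) R3, of "[False]" ?x2] l carr u2 v3 lx2 lx3 unfolding x3[symmetric] by simp
      show ?thesis using far_trans[OF far_trans[OF 1 2] 3] by (rule far_mono) (auto simp: algebra_simps)
    qed
    then show ?thesis by blast
  qed
  show ?thesis
    by (intro exI[of _ \<delta>] exI[of _ "3 * L"] exI[of _ "max r0 1"] conjI \<delta> allI impI main)
qed

end

section \<open>Ultralimits\<close>

text \<open>By compactness the image filter has a cluster point, and for an ultrafilter a cluster
  point is a limit.\<close>

lemma ultrafilter_bounded_limit: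
  fixes f :: "'i \<Rightarrow> real"
  assumes ne: "\<omega> \<noteq> bot" and ultra: "\<And>P. eventually P \<omega> \<or> eventually (\<lambda>i. \<not> P i) \<omega>"
    and f: "eventually (\<lambda>i. f i \<in> {a..b}) \<omega>"
  obtains l where "(f \<longlongrightarrow> l) \<omega>"
proof -
  let ?F = "filtermap f \<omega>"
  have "?F \<noteq> bot" "eventually (\<lambda>x. x \<in> {a..b}) ?F" using ne f by (auto simp: filtermap_bot_iff eventually_filtermap)
  then obtain l where l: "inf (nhds l) ?F \<noteq> bot" using compact_Icc[of a b] unfolding compact_filter by blast
  have "(f \<longlongrightarrow> l) \<omega>"
  proof (rule topological_tendstoI)
    fix U assume U: "open U" "l \<in> U"
    show "eventually (\<lambda>i. f i \<in> U) \<omega>"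
    proof (rule ccontr)
      assume "\<not> ?thesis"
      then have "eventually (\<lambda>x. x \<notin> U) ?F" using ultra[of "\<lambda>i. f i \<in> U"] by (auto simp: eventually_filtermap)
      moreover have "eventually (\<lambda>x. x \<in> U) (nhds l)" using U by (rule eventually_nhds_in_open)
      ultimately have "eventually (\<lambda>x. False) (inf (nhds l) ?F)" unfolding eventually_inf by blast
      then show False using l by (simp add: eventually_False)
    qed
  qed
  with that show ?thesis by blast
qed

locale ultralimit_setup =
  fixes \<omega> :: "'i filter" and M :: "'i \<Rightarrow> 'a set" and d :: "'i \<Rightarrow> 'a \<Rightarrow> 'a \<Rightarrow> real" and e :: "'i \<Rightarrow> 'a"
  assumes ne: "\<omega> \<noteq> bot" and ultra: "\<And>P. eventually P \<omega> \<or> eventually (\<lambda>i. \<not> P i) \<omega>"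
    and e_in: "e i \<in> M i"
    and d_nonneg: "x \<in> M i \<Longrightarrow> y \<in> M i \<Longrightarrow> 0 \<le> d i x y"
    and d_refl: "x \<in> M i \<Longrightarrow> d i x x = 0"
    and d_sym: "x \<in> M i \<Longrightarrow> y \<in> M i \<Longrightarrow> d i x y = d i y x"
    and d_tri: "x \<in> M i \<Longrightarrow> y \<in> M i \<Longrightarrow> w \<in> M i \<Longrightarrow> d i x w \<le> d i x y + d i y w"
begin

abbreviation "Sq \<equiv> ultralimit_seqs \<omega> M d e"
definition "E = ultralimit_eq \<omega> d \<inter> (Sq \<times> Sq)"
abbreviation "pt x \<equiv> E `` {x}"
abbreviation "U \<equiv> ultralimit_space \<omega> M d e"
abbreviation "D \<equiv> ultralimit_dist \<omega> M d e"

lemma Sq_in: "x \<in> Sq \<Longrightarrow> x i \<in> M i" by (simp add: ultralimit_seqs_def)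

lemma Sq_limit:
  assumes "x \<in> Sq" "y \<in> Sq" obtains r where "((\<lambda>i. d i (x i) (y i)) \<longlongrightarrow> r) \<omega>" "0 \<le> r"
proof -
  obtain A B where "eventually (\<lambda>i. d i (e i) (x i) \<le> A) \<omega>" "eventually (\<lambda>i. d i (e i) (y i) \<le> B) \<omega>"
    using assms by (auto simp: ultralimit_seqs_def)
  then have "eventually (\<lambda>i. d i (x i) (y i) \<in> {0..A+B}) \<omega>"
  proof eventually_elim
    case (elim i)
    have "d i (x i) (y i) \<le> d i (x i) (e i) + d i (e i) (y i)" "0 \<le> d i (x i) (y i)" "d i (x i) (e i) = d i (e i) (x i)"
      using Sq_in[OF assms(1), of i] Sq_in[OF assms(2), of i] e_in[of i] d_tri[of "x i" i "e i" "y i"]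
        d_nonneg[of "x i" i "y i"] d_sym[of "x i" i "e i"] by simp_all
    then show ?case using elim by auto
  qed
  then obtain r where r: "((\<lambda>i. d i (x i) (y i)) \<longlongrightarrow> r) \<omega>" by (rule ultrafilter_bounded_limit[OF ne ultra])
  moreover have "0 \<le> d i (x i) (y i)" for i using d_nonneg[OF Sq_in[OF assms(1)] Sq_in[OF assms(2)]] .
  then have "0 \<le> r" by (intro tendsto_lowerbound[OF r _ ne] always_eventually) simp
  ultimately show ?thesis using that by blast
qed

lemma E_iff: "(x, y) \<in> E \<longleftrightarrow> x \<in> Sq \<and> y \<in> Sq \<and> ((\<lambda>i. d i (x i) (y i)) \<longlongrightarrow> 0) \<omega>"
  by (auto simp: E_def ultralimit_eq_def)

lemma E_equiv: "equiv Sq E"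
proof (rule equivI)
  show "refl_on Sq E" using d_refl Sq_in by (auto simp: refl_on_def E_iff)
  show "sym E"
  proof (rule symI)
    fix x y assume xy: "(x, y) \<in> E"
    then have "(\<lambda>i. d i (y i) (x i)) = (\<lambda>i. d i (x i) (y i))" using d_sym Sq_in by (auto simp: E_iff)
    then show "(y, x) \<in> E" using xy by (simp add: E_iff)
  qed
  show "trans E"
  proof (rule transI)
    fix x y w assume "(x, y) \<in> E" "(y, w) \<in> E"
    then have xy: "x \<in> Sq" "y \<in> Sq" "w \<in> Sq" and l: "((\<lambda>i. d i (x i) (y i)) \<longlongrightarrow> 0) \<omega>" "((\<lambda>i. d i (y i) (w i)) \<longlongrightarrow> 0) \<omega>"
      by (auto simp: E_iff)
    have "((\<lambda>i. d i (x i) (w i)) \<longlongrightarrow> 0) \<omega>"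
    proof (rule tendsto_sandwich[OF _ _ tendsto_const])
      show "((\<lambda>i. d i (x i) (y i) + d i (y i) (w i)) \<longlongrightarrow> 0) \<omega>" using tendsto_add[OF l] by simp
      show "eventually (\<lambda>i. 0 \<le> d i (x i) (w i)) \<omega>"
        "eventually (\<lambda>i. d i (x i) (w i) \<le> d i (x i) (y i) + d i (y i) (w i)) \<omega>"
        using xy Sq_in d_nonneg d_tri by (auto intro!: always_eventually)
    qed
    then show "(x, w) \<in> E" using xy by (simp add: E_iff)
  qed
qed (auto simp: E_iff)

lemma U_eq: "U = pt ` Sq" by (auto simp: ultralimit_space_def quotient_def E_def)

text \<open>Changing representatives alters the distances by a null sequence along \<omega>, so the
  description in \<open>ultralimit_dist\<close> has a unique value.\<close>

lemma D_eq:
  assumes x: "x \<in> Sq" and y: "y \<in> Sq" and l: "((\<lambda>i. d i (x i) (y i)) \<longlongrightarrow> r) \<omega>"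
  shows "D (pt x) (pt y) = r"
proof -
  have inv: "((\<lambda>i. d i (x' i) (y' i)) \<longlongrightarrow> r) \<omega>" if "x' \<in> pt x" "y' \<in> pt y" for x' y'
  proof -
    have h: "x' \<in> Sq" "y' \<in> Sq" "((\<lambda>i. d i (x i) (x' i)) \<longlongrightarrow> 0) \<omega>" "((\<lambda>i. d i (y i) (y' i)) \<longlongrightarrow> 0) \<omega>"
      using that by (auto simp: E_iff)
    have z: "((\<lambda>i. d i (x i) (x' i) + d i (y i) (y' i)) \<longlongrightarrow> 0) \<omega>" using tendsto_add[OF h(3,4)] by simp
    have diff: "((\<lambda>i. d i (x' i) (y' i) - d i (x i) (y i)) \<longlongrightarrow> 0) \<omega>"
    proof (rule Lim_null_comparison[OF always_eventually z], rule allI)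
      fix i
      have m: "x i \<in> M i" "y i \<in> M i" "x' i \<in> M i" "y' i \<in> M i" using x y h Sq_in by auto
      have "d i (x' i) (y' i) \<le> d i (x' i) (x i) + d i (x i) (y' i)" "d i (x i) (y' i) \<le> d i (x i) (y i) + d i (y i) (y' i)"
        "d i (x i) (y i) \<le> d i (x i) (x' i) + d i (x' i) (y i)" "d i (x' i) (y i) \<le> d i (x' i) (y' i) + d i (y' i) (y i)"
        "d i (x' i) (x i) = d i (x i) (x' i)" "d i (y' i) (y i) = d i (y i) (y' i)"
        using d_tri[of "x' i" i "x i" "y' i"] d_tri[of "x i" i "y i" "y' i"] d_tri[of "x i" i "x' i" "y i"]
          d_tri[of "x' i" i "y' i" "y i"] d_sym[of "x' i" i "x i"] d_sym[of "y' i" i "y i"] m by simp_all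
      then show "norm (d i (x' i) (y' i) - d i (x i) (y i)) \<le> d i (x i) (x' i) + d i (y i) (y' i)" by simp
    qed
    show ?thesis using tendsto_add[OF diff l] by simp
  qed
  have self: "x \<in> pt x" "y \<in> pt y" by (rule equiv_class_self[OF E_equiv x], rule equiv_class_self[OF E_equiv y])
  have "(THE r. \<exists>x'\<in>pt x. \<exists>y'\<in>pt y. ((\<lambda>i. d i (x' i) (y' i)) \<longlongrightarrow> r) \<omega>) = r"
  proof (rule the_equality)
    show "\<exists>x'\<in>pt x. \<exists>y'\<in>pt y. ((\<lambda>i. d i (x' i) (y' i)) \<longlongrightarrow> r) \<omega>" using self l by blast
    fix q assume "\<exists>x'\<in>pt x. \<exists>y'\<in>pt y. ((\<lambda>i. d i (x' i) (y' i)) \<longlongrightarrow> q) \<omega>"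
    then show "q = r" using inv tendsto_unique[OF ne] by blast
  qed
  moreover have "pt x \<in> U" "pt y \<in> U" using x y by (simp_all add: U_eq)
  ultimately show ?thesis by (simp only: ultralimit_dist_def if_True simp_thms)
qed

lemma pt_eq_iff: "x \<in> Sq \<Longrightarrow> y \<in> Sq \<Longrightarrow> pt x = pt y \<longleftrightarrow> ((\<lambda>i. d i (x i) (y i)) \<longlongrightarrow> 0) \<omega>"
  using eq_equiv_class_iff[OF E_equiv, of x y] E_iff by simp

lemma U_metric: "Metric_space U D"
proof
  have out: "D X Y = 0" if "X \<notin> U \<or> Y \<notin> U" for X Y using that by (auto simp: ultralimit_dist_def)
  have nonneg: "0 \<le> D X Y" and comm: "D X Y = D Y X" and zero: "X \<in> U \<and> Y \<in> U \<Longrightarrow> (D X Y = 0) = (X = Y)" for X Y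
  proof -
    have "0 \<le> D X Y \<and> D X Y = D Y X \<and> (D X Y = 0) = (X = Y)" if "X \<in> U" "Y \<in> U"
    proof -
      from that obtain x y where xy: "x \<in> Sq" "X = pt x" "y \<in> Sq" "Y = pt y" unfolding U_eq by blast
      obtain r where r: "((\<lambda>i. d i (x i) (y i)) \<longlongrightarrow> r) \<omega>" "0 \<le> r" using Sq_limit[OF xy(1,3)] .
      have "(\<lambda>i. d i (y i) (x i)) = (\<lambda>i. d i (x i) (y i))" using d_sym Sq_in xy by auto
      then have "D X Y = r" "D Y X = r" using D_eq[OF xy(1,3) r(1)] D_eq[OF xy(3,1), of r] r xy by simp_all
      moreover have "r = 0 \<longleftrightarrow> X = Y" unfolding xy(2,4) pt_eq_iff[OF xy(1,3)]
        using tendsto_unique[OF ne r(1), of 0] r(1) by (cases "r = 0", simp, blast)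
      ultimately show ?thesis using r by simp
    qed
    then show "0 \<le> D X Y" "D X Y = D Y X" "X \<in> U \<and> Y \<in> U \<Longrightarrow> (D X Y = 0) = (X = Y)"
      using out[of X Y] out[of Y X] by (cases "X \<in> U \<and> Y \<in> U"; auto)+
  qed
  show "0 \<le> D X Y" for X Y by (rule nonneg)
  show "D X Y = D Y X" for X Y by (rule comm)
  show "X \<in> U \<Longrightarrow> Y \<in> U \<Longrightarrow> (D X Y = 0) = (X = Y)" for X Y using zero by blast
  fix X Y Z assume "X \<in> U" "Y \<in> U" "Z \<in> U"
  then obtain x y w where xy: "x \<in> Sq" "X = pt x" "y \<in> Sq" "Y = pt y" "w \<in> Sq" "Z = pt w" unfolding U_eq by blast
  obtain r where r: "((\<lambda>i. d i (x i) (y i)) \<longlongrightarrow> r) \<omega>" using Sq_limit[OF xy(1,3)] .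
  obtain q where q: "((\<lambda>i. d i (y i) (w i)) \<longlongrightarrow> q) \<omega>" using Sq_limit[OF xy(3,5)] .
  obtain p where p: "((\<lambda>i. d i (x i) (w i)) \<longlongrightarrow> p) \<omega>" using Sq_limit[OF xy(1,5)] .
  have "p \<le> r + q"
    using Sq_in[OF xy(1)] Sq_in[OF xy(3)] Sq_in[OF xy(5)] d_tri 
    by (intro tendsto_le[OF ne tendsto_add[OF r q] p] always_eventually) auto
  then show "D X Z \<le> D X Y + D Y Z" unfolding xy(2,4,6) using D_eq xy r q p by simp
qed

lemma topspace_U: "topspace (ultralimit \<omega> M d e) = U"
  unfolding ultralimit_def by (rule Metric_space.topspace_mtopology[OF U_metric])

lemma lipschitz_curve_connected:
  assumes q: "\<And>t. t \<in> {0..C} \<Longrightarrow> q t \<in> Sq"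
    and lip: "\<And>t u. t \<in> {0..C} \<Longrightarrow> u \<in> {0..C} \<Longrightarrow> D (pt (q t)) (pt (q u)) \<le> \<bar>t - u\<bar>"
  shows "connectedin (ultralimit \<omega> M d e) ((\<lambda>t. pt (q t)) ` {0..C::real})"
proof -
  interpret Metric_space U D by (rule U_metric)
  have inU: "pt (q t) \<in> U" if "t \<in> {0..C}" for t using q[OF that] by (simp add: U_eq)
  have "continuous_map (top_of_set {0..C}) mtopology (\<lambda>t. pt (q t))"
    unfolding continuous_map_to_metric
  proof (intro ballI allI impI)
    fix t \<epsilon> :: real assume t: "t \<in> topspace (top_of_set {0..C})" and \<epsilon>: "0 < \<epsilon>"
    show "\<exists>V. openin (top_of_set {0..C}) V \<and> t \<in> V \<and> (\<forall>u\<in>V. pt (q u) \<in> mball (pt (q t)) \<epsilon>)"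
    proof (intro exI[of _ "{0..C} \<inter> ball t \<epsilon>"] conjI ballI)
      show "openin (top_of_set {0..C}) ({0..C} \<inter> ball t \<epsilon>)" by (intro openin_open_Int) simp
      show "t \<in> {0..C} \<inter> ball t \<epsilon>" using t \<epsilon> by simp
      fix u assume u: "u \<in> {0..C} \<inter> ball t \<epsilon>"
      then have "D (pt (q t)) (pt (q u)) < \<epsilon>" using lip[of t u] t by (auto simp: dist_real_def)
      then show "pt (q u) \<in> mball (pt (q t)) \<epsilon>" using inU t u by (simp add: in_mball)
    qed
  qed
  moreover have "connectedin (top_of_set {0..C}) {0..C}"
    by (simp add: connectedin_subtopology)
  ultimately show ?thesis unfolding ultralimit_def by (rule connectedin_continuous_map_image)
qed

end

section \<open>Linear divergence excludes cut points\<close>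

context word_group
begin

abbreviation "wd \<equiv> word_metric G S"

lemma wd_eq: "wd g h = real (len (inv g \<otimes> h))" by (simp add: word_metric_def)

lemma wd_sym: assumes "g \<in> carrier G" "h \<in> carrier G" shows "wd g h = wd h g"
proof -
  have "inv h \<otimes> g = inv (inv g \<otimes> h)" using assms by (simp add: inv_mult_group)
  then show ?thesis unfolding wd_eq using len_inv[of "inv g \<otimes> h"] assms by simp
qed

lemma wd_triangle: 
  assumes "g \<in> carrier G" "h \<in> carrier G" "k \<in> carrier G" shows "wd g k \<le> wd g h + wd h k"
proof -
  have "inv g \<otimes> k = (inv g \<otimes> h) \<otimes> (inv h \<otimes> k)"
    using assms by (simp add: m_assoc) (simp add: m_assoc[symmetric])
  then show ?thesis unfolding wd_eq using len_mult[of "inv g \<otimes> h" "inv h \<otimes> k"] assms by simp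
qed

lemma wd_word: 
  assumes "x \<in> carrier G" "set ws \<subseteq> gens" shows "wd (x \<otimes> wprod (take j ws)) (x \<otimes> wprod (take k ws)) \<le> \<bar>real k - real j\<bar>"
proof -
  have *: "wd (x \<otimes> wprod (take j ws)) (x \<otimes> wprod (take k ws)) \<le> real k - real j" if "j \<le> k" for j k
  proof -
    let ?v = "take (k - j) (drop j ws)"
    have t: "take k ws = take j ws @ ?v" using that by (metis le_add_diff_inverse take_add)
    have s: "set (take j ws) \<subseteq> gens" "set ?v \<subseteq> gens" using assms(2) set_take_subset set_drop_subset by (meson order_trans)+
    have "inv (x \<otimes> wprod (take j ws)) \<otimes> (x \<otimes> wprod (take k ws)) = wprod ?v"
      unfolding t wprod_append[OF s] using assms(1) s by (simp add: inv_mult_group m_assoc) (simp add: m_assoc[symmetric])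
    then have "wd (x \<otimes> wprod (take j ws)) (x \<otimes> wprod (take k ws)) \<le> real (length ?v)"
      unfolding wd_eq using len_le[OF s(2)] by simp
    also have "\<dots> \<le> real k - real j" using that by simp
    finally show ?thesis .
  qed
  have c: "x \<otimes> wprod (take i ws) \<in> carrier G" for i
    using assms set_take_subset[of i ws] by (intro m_closed wprod_closed) auto
  show ?thesis using *[of j k] *[of k j] wd_sym[OF c c, of j k] by (cases "j \<le> k") auto
qed

text \<open>Two points other than \<open>P\<close> are joined by limits of words that avoid balls,
  with radius proportional to \<open>s n\<close>, around representatives of
  \<open>P\<close>.\<close>

lemma no_cut_point:
  fixes \<omega> :: "nat filter" and s :: "nat \<Rightarrow> real"
  assumes divergence: "\<And>M. 1 \<le> M \<Longrightarrow> \<exists>\<delta>>0. \<exists>L r0. \<forall>r\<ge>r0. \<exists>\<tau>. \<forall>g\<in>carrier G. 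
      r \<le> real (len g) \<longrightarrow> real (len g) \<le> M * r \<longrightarrow> far (\<delta> * r) (L * r) g \<tau>"
    and \<omega>: "nonprincipal_ultrafilter \<omega>" and s: "\<And>n. s n > 0" and sinf: "filterlim s at_top sequentially"
  shows "\<not> cut_point (asymptotic_cone G S \<omega> s) P"
proof -
  define d where "d n g h = wd g h / s n" for n g h
  interpret ultralimit_setup \<omega> "\<lambda>n. carrier G" d "\<lambda>n. \<one>"
  proof
    show "\<omega> \<noteq> bot" "eventually Q \<omega> \<or> eventually (\<lambda>i. \<not> Q i) \<omega>" for Q
      using \<omega> by (auto simp: nonprincipal_ultrafilter_def)
    show "\<one> \<in> carrier G" by simp
    show "0 \<le> d i x y" for i x y using s[of i] by (simp add: d_def wd_eq)
    show "x \<in> carrier G \<Longrightarrow> d i x x = 0" for i x by (simp add: d_def wd_eq)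
    show "x \<in> carrier G \<Longrightarrow> y \<in> carrier G \<Longrightarrow> d i x y = d i y x" for i x y using wd_sym by (simp add: d_def)
    show "x \<in> carrier G \<Longrightarrow> y \<in> carrier G \<Longrightarrow> w \<in> carrier G \<Longrightarrow> d i x w \<le> d i x y + d i y w" for i x y w
      using wd_triangle[of x y w] s[of i] by (simp add: d_def add_divide_distrib[symmetric] divide_right_mono)
  qed
  have cone: "asymptotic_cone G S \<omega> s = ultralimit \<omega> (\<lambda>n. carrier G) d (\<lambda>n. \<one>)"
    by (simp add: asymptotic_cone_def d_def[abs_def])
  \<comment> \<open>An ultrafilter that accepts a singleton is principal, so \<omega> contains all
    tails.\<close>
  have \<omega>_seq: "\<omega> \<le> sequentially"
  proof -
    have nk: "eventually (\<lambda>i. i \<noteq> k) \<omega>" for k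
    proof (rule ccontr)
      assume "\<not> ?thesis"
      then have ev: "eventually (\<lambda>i. i = k) \<omega>" using ultra[of "\<lambda>i. i = k"] by auto
      have "\<omega> = principal {k}"
      proof (rule antisym)
        show "\<omega> \<le> principal {k}" using ev by (simp add: le_principal)
        show "principal {k} \<le> \<omega>"
        proof (rule filter_leI)
          fix Q assume "eventually Q \<omega>"
          then have "eventually (\<lambda>i. i = k \<and> Q i) \<omega>" using ev by eventually_elim auto
          then have "\<exists>i. i = k \<and> Q i" using ne eventually_happens by blast
          then show "eventually Q (principal {k})" by (simp add: eventually_principal)
        qed
      qed
      then show False using \<omega> by (auto simp: nonprincipal_ultrafilter_def)
    qed
    have fin: "eventually (\<lambda>i. i \<ge> N) \<omega>" for N
    proof (induction N)
      case (Suc N)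
      then show ?case using nk[of N] by eventually_elim auto
    qed simp
    show ?thesis
    proof (rule filter_leI)
      fix Q :: "nat \<Rightarrow> bool" assume "eventually Q sequentially"
      then obtain N where "\<And>i. i \<ge> N \<Longrightarrow> Q i" by (auto simp: eventually_sequentially)
      then show "eventually Q \<omega>" using fin[of N] by (auto elim: eventually_mono)
    qed
  qed
  have s\<omega>: "filterlim s at_top \<omega>" by (rule filterlim_mono[OF sinf order_refl \<omega>_seq])
  have inv0: "((\<lambda>n. 1 / s n) \<longlongrightarrow> 0) \<omega>"
    using tendsto_inverse_0_at_top[OF s\<omega>] by (simp add: inverse_eq_divide)
  have limit_connected: "\<exists>A. connectedin (ultralimit \<omega> (\<lambda>n. carrier G) d (\<lambda>n. \<one>)) A \<and> pt x \<in> A \<and> pt y \<in> A \<and> pt p \<notin> A"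
    if x: "x \<in> Sq" and y: "y \<in> Sq" and p: "p \<in> Sq" and \<epsilon>: "0 < \<epsilon>" and C: "0 \<le> C"
    and path: "eventually (\<lambda>n. \<exists>ws. set ws \<subseteq> gens \<and> real (length ws) \<le> C * s n \<and> x n \<otimes> wprod ws = y n \<and>
        (\<forall>k. \<epsilon> * s n \<le> wd (p n) (x n \<otimes> wprod (take k ws)))) \<omega>" for x y p \<epsilon> C
  proof -
    define ok where "ok n ws \<longleftrightarrow> set ws \<subseteq> gens \<and> real (length ws) \<le> C * s n \<and> x n \<otimes> wprod ws = y n \<and>
        (\<forall>k. \<epsilon> * s n \<le> wd (p n) (x n \<otimes> wprod (take k ws)))" for n ws
    \<comment> \<open>The empty word is a default outside a set in \<omega>; it keeps
      \<open>q\<close> in the group at every index.\<close>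
    define W where "W n = (if \<exists>ws. ok n ws then SOME ws. ok n ws else [])" for n
    have okW: "ok n (W n)" if "\<exists>ws. ok n ws" for n
      using someI_ex[OF that] that by (simp add: W_def)
    have ev: "eventually (\<lambda>n. ok n (W n)) \<omega>"
      using path by (rule eventually_mono) (use okW in \<open>auto simp: ok_def\<close>)
    have Wg: "set (W n) \<subseteq> gens" for n using okW[of n] by (auto simp: W_def ok_def)
    \<comment> \<open>The word is traversed at speed \<open>s n\<close>. Rounding costs at most
      \<open>1 / s n\<close> after rescaling, so the limit curve is 1-Lipschitz.\<close>
    define q where "q t n = x n \<otimes> wprod (take (nat \<lfloor>t * s n\<rfloor>) (W n))" for t n
    have xc: "x n \<in> carrier G" for n using Sq_in[OF x] .
    have qc: "q t n \<in> carrier G" for t n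
      unfolding q_def using xc Wg[of n] set_take_subset[of _ "W n"] by (intro m_closed wprod_closed) (auto 4 3)
    have dq: "d n (q t n) (q u n) \<le> \<bar>t - u\<bar> + 1 / s n" if "0 \<le> t" "0 \<le> u" for t u n
    proof -
      have sn: "0 < s n" by (rule s)
      have "wd (q t n) (q u n) \<le> \<bar>real (nat \<lfloor>u * s n\<rfloor>) - real (nat \<lfloor>t * s n\<rfloor>)\<bar>"
        unfolding q_def by (rule wd_word[OF xc Wg])
      also have "\<dots> = \<bar>of_int \<lfloor>u * s n\<rfloor> - of_int \<lfloor>t * s n\<rfloor>\<bar>" using that sn by simp
      also have "\<dots> \<le> \<bar>t * s n - u * s n\<bar> + 1" by linarith
      also have "\<dots> = \<bar>t - u\<bar> * s n + 1" using sn by (simp add: left_diff_distrib[symmetric] abs_mult)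
      finally show ?thesis using sn by (simp add: d_def field_simps)
    qed
    have q0: "q 0 = x" using xc by (simp add: q_def fun_eq_iff)
    have qS: "q t \<in> Sq" if "0 \<le> t" for t
    proof -
      obtain A where A: "eventually (\<lambda>n. d n \<one> (x n) \<le> A) \<omega>" using x by (auto simp: ultralimit_seqs_def)
      have "eventually (\<lambda>n. s n \<ge> 1) \<omega>" using s\<omega> by (simp add: filterlim_at_top)
      with A have "eventually (\<lambda>n. d n \<one> (q t n) \<le> A + t + 1) \<omega>"
      proof eventually_elim
        case (elim n)
        have "d n \<one> (q t n) \<le> d n \<one> (x n) + d n (x n) (q t n)" using d_tri xc qc by simp
        moreover have "d n (x n) (q t n) \<le> t + 1 / s n" using dq[of 0 t n] that q0 by simp
        moreover have "1 / s n \<le> 1" using elim by simp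
        ultimately show ?case using elim by linarith
      qed
      then show ?thesis using qc by (auto simp: ultralimit_seqs_def)
    qed
    have lip: "D (pt (q t)) (pt (q u)) \<le> \<bar>t - u\<bar>" if "0 \<le> t" "0 \<le> u" for t u
    proof -
      note tu = that
      obtain r where r: "((\<lambda>n. d n (q t n) (q u n)) \<longlongrightarrow> r) \<omega>"
        by (rule Sq_limit[OF qS[OF tu(1)] qS[OF tu(2)]])
      have "((\<lambda>n. \<bar>t - u\<bar> + 1 / s n) \<longlongrightarrow> \<bar>t - u\<bar> + 0) \<omega>" by (intro tendsto_intros inv0)
      then have "r \<le> \<bar>t - u\<bar>" using tendsto_le[OF ne _ r always_eventually] dq[OF tu] by auto
      then show ?thesis using D_eq[OF qS qS r] tu by simp
    qed
    have "connectedin (ultralimit \<omega> (\<lambda>n. carrier G) d (\<lambda>n. \<one>)) ((\<lambda>t. pt (q t)) ` {0..C})"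
      by (rule lipschitz_curve_connected) (use qS lip in auto)
    moreover have "pt x \<in> (\<lambda>t. pt (q t)) ` {0..C}" using C q0 by (intro image_eqI[of _ _ 0]) auto
    moreover have "pt y \<in> (\<lambda>t. pt (q t)) ` {0..C}"
    proof -
      have "eventually (\<lambda>n. d n (q C n) (y n) = 0) \<omega>"
        using ev
      proof eventually_elim
        case (elim n)
        \<comment> \<open>At time \<open>C\<close> the whole word has been read, so the curve ends
          at \<open>y\<close>.\<close>
        then have "length (W n) \<le> nat \<lfloor>C * s n\<rfloor>" unfolding ok_def by linarith
        then have "q C n = y n" using elim by (simp add: q_def ok_def)
        then show ?case using qc[of C n] d_refl by simp
      qed
      then have "((\<lambda>n. d n (q C n) (y n)) \<longlongrightarrow> 0) \<omega>" by (rule tendsto_eventually)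
      then have "pt (q C) = pt y" using pt_eq_iff[OF qS[OF C] y] by simp
      then show ?thesis using C by (intro image_eqI[of _ _ C]) auto
    qed
    moreover have "pt p \<notin> (\<lambda>t. pt (q t)) ` {0..C}"
    proof
      assume "pt p \<in> (\<lambda>t. pt (q t)) ` {0..C}"
      then obtain t where t: "0 \<le> t" "pt p = pt (q t)" by auto
      then have l: "((\<lambda>n. d n (p n) (q t n)) \<longlongrightarrow> 0) \<omega>" using pt_eq_iff[OF p qS] by simp
      have "eventually (\<lambda>n. \<epsilon> \<le> d n (p n) (q t n)) \<omega>"
        using ev by eventually_elim (use s in \<open>auto simp: ok_def q_def d_def field_simps\<close>)
      then have "\<epsilon> \<le> 0" by (rule tendsto_lowerbound[OF l _ ne])
      then show False using \<epsilon> by simp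
    qed
    ultimately show ?thesis by blast
  qed
  have pair: "\<exists>A. connectedin (ultralimit \<omega> (\<lambda>n. carrier G) d (\<lambda>n. \<one>)) A \<and> pt x \<in> A \<and> pt y \<in> A \<and> pt p \<notin> A"
    if x: "x \<in> Sq" and y: "y \<in> Sq" and p: "p \<in> Sq" and ne_p: "pt x \<noteq> pt p" "pt y \<noteq> pt p" for x y p
  proof -
    obtain \<alpha> where \<alpha>: "((\<lambda>n. d n (p n) (x n)) \<longlongrightarrow> \<alpha>) \<omega>" "0 \<le> \<alpha>" using Sq_limit[OF p x] .
    obtain \<beta> where \<beta>: "((\<lambda>n. d n (p n) (y n)) \<longlongrightarrow> \<beta>) \<omega>" "0 \<le> \<beta>" using Sq_limit[OF p y] .
    have pos: "0 < \<alpha>" "0 < \<beta>"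
      using \<alpha> \<beta> ne_p pt_eq_iff[OF p x] pt_eq_iff[OF p y] by (metis order_le_less)+
    \<comment> \<open>\<open>m\<close> is half the smaller and \<open>M * m\<close> twice the larger
      limit distance; these strict margins place both rescaled distances from \<open>p n\<close>
      between \<open>m\<close> and \<open>M * m\<close> eventually.\<close>
    define m where "m = min \<alpha> \<beta> / 2"
    define M where "M = 2 * max \<alpha> \<beta> / m"
    have m: "0 < m" "m < \<alpha>" "m < \<beta>" using pos by (auto simp: m_def)
    have Mm: "M * m = 2 * max \<alpha> \<beta>" "1 \<le> M" using m pos by (auto simp: M_def field_simps max_def)
    obtain \<delta> L r0 where \<delta>: "0 < \<delta>" and dv: "\<And>r. r0 \<le> r \<Longrightarrow> \<exists>\<tau>. \<forall>g\<in>carrier G. 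
      r \<le> real (len g) \<longrightarrow> real (len g) \<le> M * r \<longrightarrow> far (\<delta> * r) (L * r) g \<tau>" 
      using divergence[OF Mm(2)] by metis
    have e1: "eventually (\<lambda>n. m < d n (p n) (x n)) \<omega>" "eventually (\<lambda>n. d n (p n) (x n) < M * m) \<omega>"
      "eventually (\<lambda>n. m < d n (p n) (y n)) \<omega>" "eventually (\<lambda>n. d n (p n) (y n) < M * m) \<omega>"
      using order_tendstoD[OF \<alpha>(1)] order_tendstoD[OF \<beta>(1)] m pos unfolding Mm(1) by auto
    have e2: "eventually (\<lambda>n. r0 / m \<le> s n) \<omega>" using s\<omega> by (simp add: filterlim_at_top)
    have "eventually (\<lambda>n. \<exists>ws. set ws \<subseteq> gens \<and> real (length ws) \<le> (2 * \<bar>L\<bar> * m) * s n \<and> x n \<otimes> wprod ws = y n \<and>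
        (\<forall>k. (\<delta> * m) * s n \<le> wd (p n) (x n \<otimes> wprod (take k ws)))) \<omega>"
      using e1 e2
    proof eventually_elim
      case (elim n)
      define r where "r = m * s n"
      have sn: "0 < s n" by (rule s)
      have c: "x n \<in> carrier G" "y n \<in> carrier G" "p n \<in> carrier G" using Sq_in x y p by auto
      \<comment> \<open>Left translation moves \<open>p n\<close> to the identity, so distance from
        \<open>p n\<close> becomes word length and divergence applies.\<close>
      let ?g = "inv (p n) \<otimes> x n" and ?h = "inv (p n) \<otimes> y n"
      have gh: "?g \<in> carrier G" "?h \<in> carrier G" using c by auto
      have "r0 \<le> r" using elim(5) m sn by (simp add: r_def field_simps)
      then obtain \<tau> where \<tau>: "\<forall>g\<in>carrier G. r \<le> real (len g) \<longrightarrow> real (len g) \<le> M * r \<longrightarrow> far (\<delta> * r) (L * r) g \<tau>"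
        using dv by blast
      have bg: "r \<le> real (len ?g)" "real (len ?g) \<le> M * r" "r \<le> real (len ?h)" "real (len ?h) \<le> M * r"
        using elim(1-4) sn by (auto simp: d_def wd_eq r_def field_simps)
      have "far (\<delta> * r) (L * r + L * r) ?g ?h"
        using far_trans[OF _ far_sym, of "\<delta> * r" "L * r" ?g \<tau> "L * r" ?h] \<tau> gh bg by blast
      then obtain ws where ws: "set ws \<subseteq> gens" "real (length ws) \<le> L * r + L * r" "?g \<otimes> wprod ws = ?h"
        "\<And>k. k\<le>length ws \<Longrightarrow> \<delta> * r \<le> real (len (?g \<otimes> wprod (take k ws)))" unfolding far_def by blast
      have len_ws: "real (length ws) \<le> (2 * \<bar>L\<bar> * m) * s n"
      proof -
        have "L * r \<le> \<bar>L\<bar> * r" using m sn by (intro mult_right_mono) (auto simp: r_def)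
        then show ?thesis using ws(2) by (simp add: r_def)
      qed
      have "x n = p n \<otimes> ?g" "y n = p n \<otimes> ?h" using c by (simp_all add: m_assoc[symmetric])
      then have "x n \<otimes> wprod ws = y n" using ws(1,3) c gh by (metis m_assoc wprod_closed)
      moreover have "(\<delta> * m) * s n \<le> wd (p n) (x n \<otimes> wprod (take k ws))" for k
      proof -
        have st: "set (take k ws) \<subseteq> gens" using ws(1) set_take_subset by (rule order_trans[rotated])
        \<comment> \<open>For \<open>k\<close> beyond the length, \<open>take\<close> returns the
          full word.\<close>
        have "\<delta> * r \<le> real (len (?g \<otimes> wprod (take k ws)))"
          using ws(4)[of k] ws(4)[of "length ws"] by (cases "k \<le> length ws") auto
        then show ?thesis using c st by (simp add: wd_eq m_assoc r_def)
      qed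
      ultimately show ?case using ws(1) len_ws by blast
    qed
    then show ?thesis by (rule limit_connected[OF x y p, rotated 2]) (use \<delta> m in auto)
  qed
  show ?thesis
  proof
    assume cp: "cut_point (asymptotic_cone G S \<omega> s) P"
    let ?X = "ultralimit \<omega> (\<lambda>n. carrier G) d (\<lambda>n. \<one>)"
    have P: "P \<in> topspace ?X" and nc: "\<not> connected_space (subtopology ?X (topspace ?X - {P}))"
      using cp by (auto simp: cut_point_def cone)
    obtain p where p: "p \<in> Sq" "P = pt p" using P unfolding topspace_U U_eq by blast
    have "connected_space (subtopology ?X (topspace ?X - {P}))"
      unfolding connected_space_subconnected
    proof (intro ballI)
      fix X Y assume "X \<in> topspace (subtopology ?X (topspace ?X - {P}))" "Y \<in> topspace (subtopology ?X (topspace ?X - {P}))"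
      then have XY: "X \<in> U" "Y \<in> U" "X \<noteq> P" "Y \<noteq> P" by (auto simp: topspace_U)
      obtain x y where xy: "x \<in> Sq" "X = pt x" "y \<in> Sq" "Y = pt y" using XY(1,2) unfolding U_eq by blast
      obtain A where A: "connectedin ?X A" "X \<in> A" "Y \<in> A" "P \<notin> A"
        using pair[OF xy(1,3) p(1)] XY unfolding xy p by blast
      then have "connectedin (subtopology ?X (topspace ?X - {P})) A"
        using connectedin_subset_topspace[OF A(1)] by (auto simp: connectedin_subtopology)
      then show "\<exists>A. connectedin (subtopology ?X (topspace ?X - {P})) A \<and> X \<in> A \<and> Y \<in> A" using A by blast
    qed
    then show False using nc by contradiction
  qed
qed

end

section \<open>The theorem\<close>

theorem mainTheorem2:
  fixes S :: "diagram set set"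
    and \<omega> :: "nat filter"
    and s :: "nat \<Rightarrow> real"
  assumes "finite S" and "S \<subseteq> carrier BV" and "generate BV S = carrier BV"
    and "nonprincipal_ultrafilter \<omega>"
    and "\<And>n. s n > 0" and "filterlim s at_top sequentially"
  shows "\<not> (\<exists>p. cut_point (asymptotic_cone BV S \<omega> s) p)"
proof -
  interpret group BV by (rule group_BV)
  interpret ribbon_group BV S zel carries
  proof
    show "carries (zel a) b b" if "incomparable a b" for a b
      using that by (intro carries_zel_incomparable) (auto simp: incomparable_def)
    show "zel a \<otimes>\<^bsub>BV\<^esub> g = g \<otimes>\<^bsub>BV\<^esub> zel b" if "carries g a b" for g a b
      using that unfolding carries_def by (metis append_Nil2)
  qed (use assms in \<open>auto simp: zel_in_carrier carries_zel carries_one carries_bound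
      intro: carries_carrier carries_mult carries_inv carries_append carries_unique\<close>)
  show ?thesis using no_cut_point[OF linear_divergence assms(4-6)] by blast
qed

end
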